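(* Let $\alpha_1,\alpha_2\in\mathbb{R}$ with $\alpha_1+\alpha_2\neq0$, $\underline{\alpha}=(\alpha_1,\alpha_2)$, and let $\theta:\mathbb{R}_+\to\mathbb{R}$ be an essentially bounded function such that, for some $b>0$, $1-\frac{r}{b}\le\theta(r)\le1+\frac{r}{b}$ for almost every $r>0$. Assume that $\theta$ (with $\theta(0)=1$) is differentiable at zero with $\theta'(0)=0$. Fix $\boldsymbol{x}_1\in\mathbb{R}^3$, and for $\boldsymbol{x}_2\neq\boldsymbol{x}_1$ let $R=|\boldsymbol{x}_1-\boldsymbol{x}_2|$ and let $h_{\underline{\alpha},\theta}(R)$ be the Hamiltonian in $L^2(\mathbb{R}^3)$ with two non-local point interactions placed at $\boldsymbol{x}_1,\boldsymbol{x}_2$, as defined in the context. Then $$\lim_{R\to0}h_{\underline{\alpha},\theta}(R)=\mathfrak{h}_{\alpha,\boldsymbol{x}_1}$$ in the norm resolvent sense, where $\mathfrak{h}_{\alpha,\boldsymbol{x}_1}$ is the Hamiltonian in $L^2(\mathbb{R}^3)$ with a point interaction at the fixed point $\boldsymbol{x}_1$ with strength $\alpha$ given by $$\frac1\alpha=\frac1{\alpha_1}+\frac1{\alpha_2},$$ i.e. $\alpha=\frac{\alpha_1\alpha_2}{\alpha_1+\alpha_2}$ (so that $\alpha=0$ if one of the $\alpha_i$ is zero).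
   Context: For $\lambda>0$ put $g^\lambda(\boldsymbol{r})=\frac{e^{-\sqrt\lambda|\boldsymbol{r}|}}{|\boldsymbol{r}|}$ for $\boldsymbol{r}\in\mathbb{R}^3\setminus\{0\}$ and $\delta_{\lambda,\theta}(R)=\frac{\theta(R)-e^{-\sqrt\lambda R}}{R}$ for $R>0$. Let $h_0=-\Delta$ with domain $H^2(\mathbb{R}^3)$. Two-center Hamiltonian. For $\boldsymbol{x}_1\ne\boldsymbol{x}_2$ in $\mathbb{R}^3$, $R=|\boldsymbol{x}_1-\boldsymbol{x}_2|$, the operator $h_{\underline{\alpha},\theta}(R)$ is the self-adjoint operator in $L^2(\mathbb{R}^3)$ whose domain consists of the $\psi\in L^2(\mathbb{R}^3)$ such that, for some $q_1,q_2\in\mathbb{C}$, $$\psi-q_1g^\lambda(\cdot-\boldsymbol{x}_1)-q_2g^\lambda(\cdot-\boldsymbol{x}_2)=w_\lambda\in H^2(\mathbb{R}^3),$$ $$(\alpha_1+\sqrt\lambda)q_1+\delta_{\lambda,\theta}(R)q_2=w_\lambda(\boldsymbol{x}_1),\qquad(\alpha_2+\sqrt\lambda)q_2+\delta_{\lambda,\theta}(R)q_1=w_\lambda(\boldsymbol{x}_2),$$ and which acts as $$h_{\underline{\alpha},\theta}(R)\psi=h_0w_\lambda-\lambda\big(q_1g^\lambda(\cdot-\boldsymbol{x}_1)+q_2g^\lambda(\cdot-\boldsymbol{x}_2)\big).$$ The definition does not depend on the choice of $\lambda>0$. One-center Hamiltonian. For $\alpha\in\mathbb{R}$, $\mathfrak{h}_{\alpha,\boldsymbol{x}_1}$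 is the self-adjoint operator in $L^2(\mathbb{R}^3)$ whose domain consists of the $\psi=w_\lambda+q\,g^\lambda(\cdot-\boldsymbol{x}_1)$ with $w_\lambda\in H^2(\mathbb{R}^3)$, $q\in\mathbb{C}$ and $(\alpha+\sqrt\lambda)q=w_\lambda(\boldsymbol{x}_1)$ (equivalently, $\psi(\boldsymbol{x})=\frac{q}{|\boldsymbol{x}-\boldsymbol{x}_1|}+\alpha q+o(1)$ as $\boldsymbol{x}\to\boldsymbol{x}_1$), acting as $\mathfrak{h}_{\alpha,\boldsymbol{x}_1}\psi=h_0w_\lambda-\lambda q\,g^\lambda(\cdot-\boldsymbol{x}_1)$; again the definition does not depend on $\lambda>0$. *)

theory Defs
  imports "HOL-Analysis.Analysis"
begin

section \<open>The Hilbert space \<open>L\<^sup>2(\<real>\<^sup>3)\<close>\<close>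

type_synonym R3 = "real ^ 3"

definition square_integrable :: "(R3 \<Rightarrow> complex) \<Rightarrow> bool" where
  "square_integrable f \<longleftrightarrow>
     f \<in> borel_measurable lborel \<and> integrable lborel (\<lambda>x. (cmod (f x))\<^sup>2)"

definition l2_rel :: "(R3 \<Rightarrow> complex) \<Rightarrow> (R3 \<Rightarrow> complex) \<Rightarrow> bool" where
  "l2_rel f g \<longleftrightarrow>
     square_integrable f \<and> square_integrable g \<and> (AE x in lborel. f x = g x)"

lemma square_integrable_0: "square_integrable (\<lambda>x. 0)"
  by (simp add: square_integrable_def)

lemma square_integrable_mult:
  assumes "square_integrable f"
  shows "square_integrable (\<lambda>x. c * f x)"
  using assms unfolding square_integrable_def
  by (auto simp: norm_mult power_mult_distrib)

lemma square_integrable_add: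
  assumes "square_integrable f" "square_integrable g"
  shows "square_integrable (\<lambda>x. f x + g x)"
proof -
  have m: "f \<in> borel_measurable borel" "g \<in> borel_measurable borel"
    and i: "integrable lborel (\<lambda>x. (cmod (f x))\<^sup>2)" "integrable lborel (\<lambda>x. (cmod (g x))\<^sup>2)"
    using assms by (auto simp: square_integrable_def)
  have "integrable lborel (\<lambda>x. (cmod (f x + g x))\<^sup>2)"
  proof (rule Bochner_Integration.integrable_bound)
    show "integrable lborel (\<lambda>x. 2 * (cmod (f x))\<^sup>2 + 2 * (cmod (g x))\<^sup>2)"
      using i by simp
    show "(\<lambda>x. (cmod (f x + g x))\<^sup>2) \<in> borel_measurable lborel"
      using m by simp
    show "AE x in lborel. norm ((cmod (f x + g x))\<^sup>2)
            \<le> norm (2 * (cmod (f x))\<^sup>2 + 2 * (cmod (g x))\<^sup>2)"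
    proof (intro AE_I2)
      fix x
      have "(cmod (f x + g x))\<^sup>2 \<le> (cmod (f x) + cmod (g x))\<^sup>2"
        by (intro power_mono norm_triangle_ineq) auto
      also have "\<dots> \<le> 2 * (cmod (f x))\<^sup>2 + 2 * (cmod (g x))\<^sup>2"
        using sum_squares_bound[of "cmod (f x)" "cmod (g x)"] by (simp add: power2_sum)
      finally show "norm ((cmod (f x + g x))\<^sup>2)
            \<le> norm (2 * (cmod (f x))\<^sup>2 + 2 * (cmod (g x))\<^sup>2)" by simp
    qed
  qed
  then show ?thesis
    using m by (simp add: square_integrable_def)
qed

lemma square_integrable_uminus:
  "square_integrable f \<Longrightarrow> square_integrable (\<lambda>x. - f x)"
  using square_integrable_mult[of f "- 1"] by simp

lemma square_integrable_diff:
  "square_integrable f \<Longrightarrow> square_integrable g \<Longrightarrow> square_integrable (\<lambda>x. f x - g x)"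
  using square_integrable_add[of f "\<lambda>x. - g x"] square_integrable_uminus[of g] by simp

lemma square_integrable_scaleR:
  "square_integrable f \<Longrightarrow> square_integrable (\<lambda>x. r *\<^sub>R f x)"
  using square_integrable_mult[of f "of_real r"] by (simp add: scaleR_conv_of_real)

lemma integrable_inner_square_integrable:
  assumes "square_integrable f" "square_integrable g"
  shows "integrable lborel (\<lambda>x. f x \<bullet> g x)"
proof (rule Bochner_Integration.integrable_bound)
  show "integrable lborel (\<lambda>x. (cmod (f x))\<^sup>2 + (cmod (g x))\<^sup>2)"
    using assms by (simp add: square_integrable_def)
  show "(\<lambda>x. f x \<bullet> g x) \<in> borel_measurable lborel"
    using assms by (auto simp: square_integrable_def)
  show "AE x in lborel. norm (f x \<bullet> g x) \<le> norm ((cmod (f x))\<^sup>2 + (cmod (g x))\<^sup>2)"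
  proof (intro AE_I2)
    fix x
    have "\<bar>f x \<bullet> g x\<bar> \<le> cmod (f x) * cmod (g x)"
      by (rule Cauchy_Schwarz_ineq2)
    also have "\<dots> \<le> 2 * cmod (f x) * cmod (g x)" by simp
    also have "\<dots> \<le> (cmod (f x))\<^sup>2 + (cmod (g x))\<^sup>2"
      by (rule sum_squares_bound)
    finally show "norm (f x \<bullet> g x) \<le> norm ((cmod (f x))\<^sup>2 + (cmod (g x))\<^sup>2)" by simp
  qed
qed

quotient_type l2 = "R3 \<Rightarrow> complex" / partial: l2_rel
proof (rule part_equivpI)
  show "\<exists>f. l2_rel f f"
    using square_integrable_0 by (auto simp: l2_rel_def)
  show "symp l2_rel"
    by (auto simp: symp_def l2_rel_def)
  show "transp l2_rel"
    unfolding transp_def l2_rel_def by (auto elim: AE_mp)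
qed

text \<open>\<^term>\<open>abs_l2 f\<close> is the class of \<open>f\<close>; it is meaningful only for square integrable \<open>f\<close>.\<close>

instantiation l2 :: real_vector
begin

lift_definition zero_l2 :: l2 is "\<lambda>x. 0"
  by (simp add: l2_rel_def square_integrable_0)

lift_definition plus_l2 :: "l2 \<Rightarrow> l2 \<Rightarrow> l2" is "\<lambda>f g x. f x + g x"
  by (auto simp: l2_rel_def intro: square_integrable_add)

lift_definition minus_l2 :: "l2 \<Rightarrow> l2 \<Rightarrow> l2" is "\<lambda>f g x. f x - g x"
  by (auto simp: l2_rel_def intro: square_integrable_diff)

lift_definition uminus_l2 :: "l2 \<Rightarrow> l2" is "\<lambda>f x. - f x"
  by (auto simp: l2_rel_def intro: square_integrable_uminus)

lift_definition scaleR_l2 :: "real \<Rightarrow> l2 \<Rightarrow> l2" is "\<lambda>r f x. r *\<^sub>R f x"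
  by (auto simp: l2_rel_def intro: square_integrable_scaleR)

instance
  by standard
    (transfer; auto simp: l2_rel_def algebra_simps
       intro!: square_integrable_add square_integrable_diff square_integrable_uminus
         square_integrable_scaleR square_integrable_0)+

end

lift_definition scaleC :: "complex \<Rightarrow> l2 \<Rightarrow> l2" (infixr "*\<^sub>C" 75) is "\<lambda>c f x. c * f x"
  by (auto simp: l2_rel_def intro: square_integrable_mult)

text \<open>
  The real inner product below is the real part of the usual complex one. It induces the same
  norm, and hence the same operator norm and the same convergence of bounded operators.
\<close>

instantiation l2 :: real_inner
begin

lift_definition inner_l2 :: "l2 \<Rightarrow> l2 \<Rightarrow> real" is "\<lambda>f g. LINT x|lborel. f x \<bullet> g x"
  by (rule integral_cong_AE) (auto simp: l2_rel_def square_integrable_def elim: AE_mp)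

lift_definition norm_l2 :: "l2 \<Rightarrow> real" is "\<lambda>f. sqrt (LINT x|lborel. (cmod (f x))\<^sup>2)"
  by (rule arg_cong[where f = sqrt], rule integral_cong_AE)
    (auto simp: l2_rel_def square_integrable_def elim: AE_mp)

definition dist_l2 :: "l2 \<Rightarrow> l2 \<Rightarrow> real" where "dist_l2 f g = norm (f - g)"

definition sgn_l2 :: "l2 \<Rightarrow> l2" where "sgn_l2 f = f /\<^sub>R norm f"

definition uniformity_l2 :: "(l2 \<times> l2) filter" where
  "uniformity_l2 = (INF e\<in>{0 <..}. principal {(x, y). dist x y < e})"

definition open_l2 :: "l2 set \<Rightarrow> bool" where
  "open_l2 U \<longleftrightarrow> (\<forall>x\<in>U. \<forall>\<^sub>F (x', y) in uniformity. x' = x \<longrightarrow> y \<in> U)"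

instance
proof
  fix f g h :: l2 and r :: real and U :: "l2 set"
  show "dist f g = norm (f - g)" by (rule dist_l2_def)
  show "sgn f = f /\<^sub>R norm f" by (rule sgn_l2_def)
  show "uniformity = (INF e\<in>{0 <..}. principal {(x :: l2, y). dist x y < e})"
    by (rule uniformity_l2_def)
  show "open U \<longleftrightarrow> (\<forall>x\<in>U. \<forall>\<^sub>F (x', y) in uniformity. x' = x \<longrightarrow> y \<in> U)"
    by (rule open_l2_def)
  show "inner f g = inner g f"
    by transfer (simp add: inner_commute)
  show "inner (f + g) h = inner f h + inner g h"
    by transfer (simp add: l2_rel_def inner_add_left integrable_inner_square_integrable)
  show "inner (r *\<^sub>R f) g = r * inner f g"
    by transfer simp
  show "0 \<le> inner f f"
    by transfer simp
  show "inner f f = 0 \<longleftrightarrow> f = 0"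
  proof transfer
    fix f assume "l2_rel f f"
    then have f: "square_integrable f" by (simp add: l2_rel_def)
    have "(LINT x|lborel. f x \<bullet> f x) = 0 \<longleftrightarrow> (AE x in lborel. f x \<bullet> f x = 0)"
      by (rule integral_nonneg_eq_0_iff_AE)
        (use integrable_inner_square_integrable[OF f f] in auto)
    then show "(LINT x|lborel. f x \<bullet> f x) = 0 \<longleftrightarrow> l2_rel f (\<lambda>x. 0)"
      using f square_integrable_0 by (simp add: l2_rel_def)
  qed
  show "norm f = sqrt (inner f f)"
    by transfer (simp add: power2_norm_eq_inner)
qed

end


section \<open>The Sobolev space \<open>H\<^sup>2(\<real>\<^sup>3)\<close> and the free Laplacian\<close>

definition partial_deriv :: "3 \<Rightarrow> (R3 \<Rightarrow> complex) \<Rightarrow> R3 \<Rightarrow> complex" where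
  "partial_deriv i \<phi> x = frechet_derivative \<phi> (at x) (axis i 1)"

definition iter_partial :: "3 list \<Rightarrow> (R3 \<Rightarrow> complex) \<Rightarrow> R3 \<Rightarrow> complex" where
  "iter_partial is \<phi> = foldr partial_deriv is \<phi>"

text \<open>\<open>\<phi> \<in> C\<^sub>c\<^sup>\<infinity>(\<real>\<^sup>3)\<close>; as \<open>is\<close> also ranges over \<^term>\<open>[]\<close>, \<open>\<phi>\<close> itself is differentiable.\<close>

definition test_function :: "(R3 \<Rightarrow> complex) \<Rightarrow> bool" where
  "test_function \<phi> \<longleftrightarrow>
     (\<forall>is x. iter_partial is \<phi> differentiable (at x)) \<and> compact (closure {x. \<phi> x \<noteq> 0})"

lemma iter_partial_borel_measurable:
  assumes "test_function \<phi>"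
  shows "iter_partial is \<phi> \<in> borel_measurable borel"
  using assms
  by (auto simp: test_function_def differentiable_on_def
      intro!: borel_measurable_continuous_onI differentiable_imp_continuous_on
        differentiable_at_withinI)

lift_definition weak_deriv :: "3 list \<Rightarrow> l2 \<Rightarrow> l2 \<Rightarrow> bool" is
  "\<lambda>is w v. \<forall>\<phi>. test_function \<phi> \<longrightarrow>
     (LINT x|lborel. w x * iter_partial is \<phi> x) = (- 1) ^ length is * (LINT x|lborel. v x * \<phi> x)"
proof -
  fix "is" :: "3 list" and w w' v v' :: "R3 \<Rightarrow> complex"
  assume w: "l2_rel w w'" and v: "l2_rel v v'"
  have eq: "(LINT x|lborel. u x * iter_partial js \<phi> x) = (LINT x|lborel. u' x * iter_partial js \<phi> x)"
    if "l2_rel u u'" "test_function \<phi>" for u u' \<phi> js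
    using that iter_partial_borel_measurable[OF that(2), of js]
    by (intro integral_cong_AE) (auto simp: l2_rel_def square_integrable_def elim: AE_mp)
  have eq0: "(LINT x|lborel. v x * \<phi> x) = (LINT x|lborel. v' x * \<phi> x)"
    if "test_function \<phi>" for \<phi>
    using eq[OF v that, of "[]"] by (simp add: iter_partial_def)
  show "(\<forall>\<phi>. test_function \<phi> \<longrightarrow> (LINT x|lborel. w x * iter_partial is \<phi> x)
            = (- 1) ^ length is * (LINT x|lborel. v x * \<phi> x)) \<longleftrightarrow>
        (\<forall>\<phi>. test_function \<phi> \<longrightarrow> (LINT x|lborel. w' x * iter_partial is \<phi> x)
            = (- 1) ^ length is * (LINT x|lborel. v' x * \<phi> x))"
    using eq[OF w] eq0 by auto
qed

definition H2 :: "l2 set" where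
  "H2 = {w. \<forall>is. length is \<le> 2 \<longrightarrow> (\<exists>v. weak_deriv is w v)}"

text \<open>
  Elements of \<open>H\<^sup>2(\<real>\<^sup>3)\<close> are evaluated at a point through their continuous representative, which
  exists by Sobolev embedding; \<^term>\<open>has_value_at w x c\<close> says that this value at \<open>x\<close> is \<open>c\<close>.
\<close>

lift_definition has_value_at :: "l2 \<Rightarrow> R3 \<Rightarrow> complex \<Rightarrow> bool" is
  "\<lambda>w x c. \<exists>f. continuous_on UNIV f \<and> (AE y in lborel. w y = f y) \<and> f x = c"
proof -
  fix w w' :: "R3 \<Rightarrow> complex"
  assume "l2_rel w w'"
  then have ae: "AE y in lborel. w y = w' y" by (simp add: l2_rel_def)
  have "(AE y in lborel. w y = f y) \<longleftrightarrow> (AE y in lborel. w' y = f y)" for f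
    using ae by (auto elim: AE_mp)
  then show "(\<lambda>x c. \<exists>f. continuous_on UNIV f \<and> (AE y in lborel. w y = f y) \<and> f x = c) =
             (\<lambda>x c. \<exists>f. continuous_on UNIV f \<and> (AE y in lborel. w' y = f y) \<and> f x = c)"
    by simp
qed

text \<open>An unbounded operator in \<open>L\<^sup>2(\<real>\<^sup>3)\<close> is represented by its graph.\<close>

type_synonym l2_operator = "(l2 \<times> l2) set"

definition h0 :: l2_operator where
  "h0 = {(w, - (\<Sum>i\<in>UNIV. v i)) | w v. w \<in> H2 \<and> (\<forall>i :: 3. weak_deriv [i, i] w (v i))}"


section \<open>Resolvents and norm resolvent convergence\<close>

definition is_resolvent :: "l2_operator \<Rightarrow> complex \<Rightarrow> (l2 \<Rightarrow>\<^sub>L l2) \<Rightarrow> bool" where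
  "is_resolvent A z B \<longleftrightarrow>
     {(\<psi>, \<phi> - z *\<^sub>C \<psi>) | \<psi> \<phi>. (\<psi>, \<phi>) \<in> A}\<inverse> = {(f, blinfun_apply B f) | f. True}"

definition resolvent_set :: "l2_operator \<Rightarrow> complex set" where
  "resolvent_set A = {z. \<exists>B. is_resolvent A z B}"

definition resolvent :: "l2_operator \<Rightarrow> complex \<Rightarrow> l2 \<Rightarrow>\<^sub>L l2" where
  "resolvent A z = (THE B. is_resolvent A z B)"

text \<open>
  For self-adjoint operators every non-real \<open>z\<close> lies in the resolvent set; the definition demands
  this explicitly, so that \<^const>\<open>resolvent\<close> is never used where it is unspecified.
\<close>

definition norm_resolvent_tendsto ::
    "('i \<Rightarrow> l2_operator) \<Rightarrow> l2_operator \<Rightarrow> 'i filter \<Rightarrow> bool" where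
  "norm_resolvent_tendsto A A0 F \<longleftrightarrow>
     (\<forall>z. Im z \<noteq> 0 \<longrightarrow>
        z \<in> resolvent_set A0 \<and> (\<forall>\<^sub>F i in F. z \<in> resolvent_set (A i)) \<and>
        ((\<lambda>i. resolvent (A i) z) \<longlongrightarrow> resolvent A0 z) F)"


section \<open>Point interaction Hamiltonians\<close>

text \<open>
  The value of \<open>green lam\<close> at the origin is irrelevant (a null set). For \<open>lam > 0\<close> its translates are
  square integrable, so \<open>green_at\<close> is well defined. The operators below are parametrised by
  \<open>lam > 0\<close>, although they do not depend on it.
\<close>

definition green :: "real \<Rightarrow> R3 \<Rightarrow> complex" where
  "green lam r = of_real (exp (- sqrt lam * norm r) / norm r)"

definition green_at :: "real \<Rightarrow> R3 \<Rightarrow> l2" where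
  "green_at lam y = abs_l2 (\<lambda>x. green lam (x - y))"

definition delta_fun :: "real \<Rightarrow> (real \<Rightarrow> real) \<Rightarrow> real \<Rightarrow> real" where
  "delta_fun lam \<theta> R = (\<theta> R - exp (- sqrt lam * R)) / R"

definition two_center ::
    "real \<Rightarrow> real \<Rightarrow> real \<Rightarrow> (real \<Rightarrow> real) \<Rightarrow> R3 \<Rightarrow> R3 \<Rightarrow> l2_operator" where
  "two_center lam \<alpha>1 \<alpha>2 \<theta> x1 x2 =
     {(\<psi>, \<phi>). \<exists>q1 q2 w h0w.
        \<psi> - q1 *\<^sub>C green_at lam x1 - q2 *\<^sub>C green_at lam x2 = w \<and>
        (w, h0w) \<in> h0 \<and>
        has_value_at w x1
          (of_real (\<alpha>1 + sqrt lam) * q1 + of_real (delta_fun lam \<theta> (norm (x1 - x2))) * q2) \<and>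
        has_value_at w x2
          (of_real (\<alpha>2 + sqrt lam) * q2 + of_real (delta_fun lam \<theta> (norm (x1 - x2))) * q1) \<and>
        \<phi> = h0w - of_real lam *\<^sub>C (q1 *\<^sub>C green_at lam x1 + q2 *\<^sub>C green_at lam x2)}"

definition one_center :: "real \<Rightarrow> real \<Rightarrow> R3 \<Rightarrow> l2_operator" where
  "one_center lam \<alpha> x1 =
     {(\<psi>, \<phi>). \<exists>q w h0w.
        \<psi> = w + q *\<^sub>C green_at lam x1 \<and>
        (w, h0w) \<in> h0 \<and>
        has_value_at w x1 (of_real (\<alpha> + sqrt lam) * q) \<and>
        \<phi> = h0w - of_real lam *\<^sub>C (q *\<^sub>C green_at lam x1)}"

end

theory Submission
  imports Defs
begin

text \<open>
  Write a non-real \<open>z\<close> as \<open>- k\<^sup>2\<close> with \<open>Re k > 0\<close>, and put \<open>g\<^sub>i = e\<^bsup>-k|x - x\<^sub>i|\<^esup> / |x - x\<^sub>i|\<close>. Since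
  \<open>g\<^sub>i\<close> is a multiple of the fundamental solution of \<open>- \<Delta> + k\<^sup>2\<close>, eliminating the regular part \<open>w\<close>
  from the boundary conditions turns the resolvent equation into the linear system
  \<open>(\<alpha>\<^sub>1 + k) q\<^sub>1 + d q\<^sub>2 = (R\<^sub>0 f)(x\<^sub>1)\<close>, \<open>d q\<^sub>1 + (\<alpha>\<^sub>2 + k) q\<^sub>2 = (R\<^sub>0 f)(x\<^sub>2)\<close>, where
  \<open>R\<^sub>0 = (- \<Delta> + k\<^sup>2)\<^sup>-\<^sup>1\<close> and \<open>d = (\<theta>(R) - e\<^bsup>-kR\<^esup>) / R\<close>. Hence the resolvent is \<open>R\<^sub>0\<close> plus a rank two
  operator built from \<open>g\<^sub>1\<close>, \<open>g\<^sub>2\<close> and the inverse of the matrix of this system. As \<open>R \<rightarrow> 0\<close>, \<open>d \<rightarrow> k\<close> because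
  \<open>\<theta>'(0) = 0\<close>, and \<open>g\<^sub>2 \<rightarrow> g\<^sub>1\<close> in \<open>L\<^sup>2\<close>; the determinant tends to \<open>(\<alpha>\<^sub>1 + \<alpha>\<^sub>2)(\<alpha> + k) \<noteq> 0\<close> and the
  entries of the inverse sum up to \<open>1 / (\<alpha> + k)\<close>, which is the coefficient in the one-center
  resolvent.

  No Fourier transform is used: \<open>R\<^sub>0\<close> is convolution with the Yukawa kernel, and that it maps into
  \<open>H\<^sup>2\<close> follows from \<open>\<Sum>\<^sub>i\<^sub>j \<parallel>\<partial>\<^sub>i\<partial>\<^sub>j v\<parallel>\<^sup>2 = \<parallel>\<Delta> v\<parallel>\<^sup>2\<close> and the density of test functions.
\<close>


section \<open>Smooth functions and partial derivatives\<close>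

text \<open>Operators are graphs, so a resolvent is recognised by two inclusions between graphs.
  This becomes workable because the graph of \<open>h0\<close> can be expressed through the bounded
  operator R_0 alone, as w = R_0 (h + k^2 w), which settles membership in \<open>H2\<close> once and
  for all. The Hamiltonians are given with a real parameter \<open>lam\<close>, while the resolvent
  at z calls for a complex k. The bridge is that the difference of two kernels with the same center
  lies in the range of R_0 and has an explicit continuous representative. Convergence in norm, and
  not merely strong convergence, is available because all that depends on R is of finite rank and
  depends continuously on kernels in L^2. The cancellation behind the theorem: once d has become k,
  the k^2 in (\<alpha>1 + k)(\<alpha>2 + k) is removed by d^2, so the determinant drops from degree
  two in k to degree one. This is a one-center denominator exactly when \<alpha>1 + \<alpha>2 is
  nonzero, and as \<alpha> is real and k is not, it cannot vanish.\<close>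

abbreviation "pd \<equiv> partial_deriv"

definition smooth :: "(R3 \<Rightarrow> complex) \<Rightarrow> bool" where
  "smooth f \<longleftrightarrow> (\<forall>is x. iter_partial is f differentiable (at x))"

lemma iter_partial_Nil [simp]: "iter_partial [] f = f"
  and iter_partial_Cons [simp]: "iter_partial (i # is) f = pd i (iter_partial is f)"
  by (simp_all add: iter_partial_def)

lemma iter_partial_append: "iter_partial (is @ js) f = iter_partial is (iter_partial js f)"
  by (simp add: iter_partial_def)

lemma partial_deriv_eq: "(f has_derivative D) (at x) \<Longrightarrow> pd i f x = D (axis i 1)"
  unfolding partial_deriv_def using frechet_derivative_at by metis

text \<open>Reduces a smoothness proof to exhibiting a family stable under differentiation, with no
  induction on the order of the derivative. It serves for polynomial algebras, affine substitutions,
  conjugates and convolutions.\<close>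

lemma smooth_coinduct:
  assumes "\<And>f x. f \<in> P \<Longrightarrow> f differentiable (at x)"
    and "\<And>f i. f \<in> P \<Longrightarrow> pd i f \<in> P" and "f \<in> P"
  shows "smooth f"
proof -
  have "iter_partial is f \<in> P" for "is"
    by (induction "is") (use assms in auto)
  then show ?thesis using assms by (auto simp: smooth_def)
qed

lemma smooth_differentiable: "smooth f \<Longrightarrow> f differentiable (at x)"
  unfolding smooth_def by (metis iter_partial_Nil)

lemma smooth_iter_partial: "smooth f \<Longrightarrow> smooth (iter_partial is f)"
  unfolding smooth_def by (metis iter_partial_append)

lemma smooth_partial: "smooth f \<Longrightarrow> smooth (pd i f)"
  using smooth_iter_partial[of f "[i]"] by simp

lemma smooth_continuous_on: "smooth f \<Longrightarrow> continuous_on S f"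
  by (meson continuous_at_imp_continuous_on differentiable_imp_continuous_within smooth_differentiable)

lemma smooth_measurable [measurable_dest]: "smooth f \<Longrightarrow> f \<in> borel_measurable borel"
  by (simp add: borel_measurable_continuous_onI smooth_continuous_on)

section \<open>Differentiation rules and closure properties of smooth functions\<close>

lemma partial_deriv_const [simp]: "pd i (\<lambda>x. c) = (\<lambda>x. 0)"
  by (rule ext) (rule partial_deriv_eq, rule has_derivative_const)

lemma partial_deriv_add:
  assumes "f differentiable (at x)" "g differentiable (at x)"
  shows "pd i (\<lambda>x. f x + g x) x = pd i f x + pd i g x"
proof -
  obtain f' g' where f': "(f has_derivative f') (at x)" and g': "(g has_derivative g') (at x)"
    using assms by (auto simp: differentiable_def)
  show ?thesis
    by (simp add: partial_deriv_eq[OF has_derivative_add[OF f' g']]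
        partial_deriv_eq[OF f'] partial_deriv_eq[OF g'])
qed

lemma partial_deriv_mult:
  assumes "f differentiable (at x)" "g differentiable (at x)"
  shows "pd i (\<lambda>x. f x * g x) x = pd i f x * g x + f x * pd i g x"
proof -
  obtain f' g' where f': "(f has_derivative f') (at x)" and g': "(g has_derivative g') (at x)"
    using assms by (auto simp: differentiable_def)
  show ?thesis
    by (simp add: partial_deriv_eq[OF has_derivative_mult[OF f' g']]
        partial_deriv_eq[OF f'] partial_deriv_eq[OF g'])
qed

lemma partial_deriv_cmult:
  assumes "f differentiable (at x)"
  shows "pd i (\<lambda>x. c * f x) x = c * pd i f x"
  using partial_deriv_mult[of "\<lambda>x. c" x f i] assms by simp

text \<open>Polynomial expressions in the generators. The sum and product rules stay inside this
  set, so differentiability and the form of the derivatives have to be checked on generators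
  only.\<close>

inductive_set alg :: "(R3 \<Rightarrow> complex) set \<Rightarrow> (R3 \<Rightarrow> complex) set" for G where
  const: "(\<lambda>x. c) \<in> alg G"
| gen: "g \<in> G \<Longrightarrow> g \<in> alg G"
| add: "f \<in> alg G \<Longrightarrow> g \<in> alg G \<Longrightarrow> (\<lambda>x. f x + g x) \<in> alg G"
| mult: "f \<in> alg G \<Longrightarrow> g \<in> alg G \<Longrightarrow> (\<lambda>x. f x * g x) \<in> alg G"

lemma smooth_alg:
  assumes d: "\<And>g x. g \<in> G \<Longrightarrow> g differentiable (at x)"
    and p: "\<And>g i. g \<in> G \<Longrightarrow> pd i g \<in> alg G"
    and "f \<in> alg G"
  shows "smooth f"
proof (rule smooth_coinduct[where P = "alg G"])
  have *: "(\<forall>x. f differentiable (at x)) \<and> (\<forall>i. pd i f \<in> alg G)" if "f \<in> alg G" for f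
    using that
  proof induction
    case (const c)
    then show ?case by (auto intro: alg.const)
  next
    case (gen g)
    then show ?case using d p by auto
  next
    case (add f g)
    then have "pd i (\<lambda>x. f x + g x) = (\<lambda>x. pd i f x + pd i g x)" for i
      by (auto simp: partial_deriv_add)
    with add show ?case by (auto intro: alg.intros)
  next
    case (mult f g)
    then have "pd i (\<lambda>x. f x * g x)
        = (\<lambda>x. pd i f x * g x + f x * pd i g x)" for i
      by (auto simp: partial_deriv_mult)
    with mult show ?case by (auto intro!: alg.add alg.mult)
  qed
  show "f differentiable (at x)" if "f \<in> alg G" for f x using * that by blast
  show "pd i f \<in> alg G" if "f \<in> alg G" for f i using * that by blast
qed fact

text \<open>With all smooth functions as generators, closure under sums and products comes at once,
  without a Leibniz formula of higher order.\<close>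

lemma smooth_alg_smooth: "f \<in> alg {f. smooth f} \<Longrightarrow> smooth f"
  by (rule smooth_alg) (auto intro: smooth_differentiable alg.gen smooth_partial)

lemma smooth_const: "smooth (\<lambda>x. c)"
  by (rule smooth_alg_smooth) (rule alg.const)

lemma smooth_add: "smooth f \<Longrightarrow> smooth g \<Longrightarrow> smooth (\<lambda>x. f x + g x)"
  and smooth_mult: "smooth f \<Longrightarrow> smooth g \<Longrightarrow> smooth (\<lambda>x. f x * g x)"
  by (rule smooth_alg_smooth; simp add: alg.intros)+

lemma smooth_cmult: "smooth f \<Longrightarrow> smooth (\<lambda>x. c * f x)"
  by (rule smooth_mult[OF smooth_const])

lemma smooth_diff: "smooth f \<Longrightarrow> smooth g \<Longrightarrow> smooth (\<lambda>x. f x - g x)"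
  using smooth_add[of f "\<lambda>x. (- 1) * g x"] smooth_cmult[of g "- 1"] by simp

lemma smooth_sum: "(\<And>a. a \<in> A \<Longrightarrow> smooth (f a)) \<Longrightarrow> smooth (\<lambda>x. \<Sum>a\<in>A. f a x)"
  by (induction A rule: infinite_finite_induct) (auto intro: smooth_const smooth_add)

lemma smooth_prod: "(\<And>a. a \<in> A \<Longrightarrow> smooth (f a)) \<Longrightarrow> smooth (\<lambda>x. \<Prod>a\<in>A. f a x)"
  by (induction A rule: infinite_finite_induct) (auto intro: smooth_const smooth_mult)

lemma partial_deriv_diff:
  assumes "smooth f" "smooth g"
  shows "pd i (\<lambda>x. f x - g x) x = pd i f x - pd i g x"
  using partial_deriv_add[of f x "\<lambda>x. (- 1) * g x" i] partial_deriv_cmult[of g x i "- 1"]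
    assms smooth_cmult[of g "- 1"] by (simp add: smooth_differentiable)

lemma partial_deriv_affine:
  assumes "smooth f"
  shows "pd i (\<lambda>x. f (c *\<^sub>R x + y)) x = of_real c * pd i f (c *\<^sub>R x + y)"
proof -
  obtain D where D: "(f has_derivative D) (at (c *\<^sub>R x + y))"
    using smooth_differentiable[OF assms] by (auto simp: differentiable_def)
  have "((\<lambda>x. f (c *\<^sub>R x + y)) has_derivative (\<lambda>h. D (c *\<^sub>R h))) (at x)"
    by (rule has_derivative_compose[where g = f]) (auto intro!: derivative_eq_intros D)
  from partial_deriv_eq[OF this, of i] partial_deriv_eq[OF D, of i]
  show ?thesis
    using linear_scale[OF has_derivative_linear[OF D], of c "axis i 1"]
    by (metis scaleR_conv_of_real)
qed

text \<open>The stable family carries a scalar factor \<open>a\<close>, since every derivative emits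
  another factor \<open>c\<close> by the chain rule.\<close>

lemma smooth_affine:
  assumes "smooth f" shows "smooth (\<lambda>x. f (c *\<^sub>R x + y))"
proof (rule smooth_coinduct[where P = "{\<lambda>x. a * g (c *\<^sub>R x + y) | a g. smooth g}"])
  have d: "(\<lambda>x. g (c *\<^sub>R x + y)) differentiable (at x)" if "smooth g" for g x
    using differentiable_chain_at[of "\<lambda>x. c *\<^sub>R x + y" x g] smooth_differentiable[OF that]
    by (simp add: o_def)
  fix h assume "h \<in> {\<lambda>x. a * g (c *\<^sub>R x + y) | a g. smooth g}"
  then obtain a g where h: "h = (\<lambda>x. a * g (c *\<^sub>R x + y))" and g: "smooth g" by auto
  show "h differentiable (at x)" for x
    unfolding h by (intro differentiable_mult d g differentiable_const)
  fix i
  have "pd i h = (\<lambda>x. (a * of_real c) * pd i g (c *\<^sub>R x + y))"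
    unfolding h by (rule ext) (simp add: partial_deriv_cmult d g partial_deriv_affine)
  then show "pd i h \<in> {\<lambda>x. a * g (c *\<^sub>R x + y) | a g. smooth g}"
    using smooth_partial[OF g] by blast
next
  show "(\<lambda>x. f (c *\<^sub>R x + y)) \<in> {\<lambda>x. a * g (c *\<^sub>R x + y) | a g. smooth g}"
    using assms by (auto intro!: exI[of _ 1])
qed

lemma partial_deriv_cnj:
  assumes "smooth f"
  shows "pd i (\<lambda>x. cnj (f x)) x = cnj (pd i f x)"
proof -
  obtain D where D: "(f has_derivative D) (at x)"
    using smooth_differentiable[OF assms] by (auto simp: differentiable_def)
  have "((\<lambda>x. cnj (f x)) has_derivative (\<lambda>h. cnj (D h))) (at x)"
    by (rule bounded_linear.has_derivative[OF bounded_linear_cnj D])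
  from partial_deriv_eq[OF this, of i] partial_deriv_eq[OF D, of i] show ?thesis by simp
qed

lemma smooth_cnj: assumes "smooth f" shows "smooth (\<lambda>x. cnj (f x))"
proof (rule smooth_coinduct[where P = "{\<lambda>x. cnj (g x) | g. smooth g}"])
  fix h assume "h \<in> {\<lambda>x. cnj (g x) | g. smooth g}"
  then obtain g where h: "h = (\<lambda>x. cnj (g x))" and g: "smooth g" by auto
  show "h differentiable (at x)" for x
    unfolding h using smooth_differentiable[OF g, of x]
    by (auto simp: differentiable_def dest: bounded_linear.has_derivative[OF bounded_linear_cnj])
  show "pd i h \<in> {\<lambda>x. cnj (g x) | g. smooth g}" for i
    unfolding h using smooth_partial[OF g] partial_deriv_cnj[OF g] by blast
qed (use assms in auto)

section \<open>Mean value and Taylor estimates\<close>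

lemma sum_axis: "(\<Sum>i\<in>UNIV. (h $ i) *\<^sub>R axis i 1) = (h :: R3)"
  by (simp add: vec_eq_iff axis_def if_distrib cong: if_cong)

lemma smooth_has_derivative:
  assumes "smooth f"
  shows "(f has_derivative (\<lambda>h. \<Sum>i\<in>UNIV. of_real (h $ i) * pd i f x)) (at x)"
proof -
  obtain D where D: "(f has_derivative D) (at x)"
    using smooth_differentiable[OF assms] by (auto simp: differentiable_def)
  have "D h = (\<Sum>i\<in>UNIV. of_real (h $ i) * pd i f x)" for h
  proof -
    have "D h = D (\<Sum>i\<in>UNIV. (h $ i) *\<^sub>R axis i 1)" by (simp add: sum_axis)
    also have "\<dots> = (\<Sum>i\<in>UNIV. (h $ i) *\<^sub>R D (axis i 1))"
      using has_derivative_linear[OF D] by (simp add: linear_sum linear_scale)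
    finally show ?thesis by (simp add: partial_deriv_eq[OF D] scaleR_conv_of_real)
  qed
  then have "D = (\<lambda>h. \<Sum>i\<in>UNIV. of_real (h $ i) * pd i f x)" by (rule ext)
  then show ?thesis using D by simp
qed

lemma onorm_sum_partials:
  fixes a :: "3 \<Rightarrow> complex"
  assumes "\<And>i. cmod (a i) \<le> B"
  shows "onorm (\<lambda>h :: R3. \<Sum>i\<in>UNIV. of_real (h $ i) * a i) \<le> 3 * B"
proof (rule onorm_le)
  fix h :: R3
  have "cmod (\<Sum>i\<in>UNIV. of_real (h $ i) * a i) \<le> (\<Sum>i\<in>(UNIV :: 3 set). norm h * B)"
  proof (rule sum_norm_le)
    fix i :: 3
    show "cmod (of_real (h $ i) * a i) \<le> norm h * B"
      unfolding norm_mult using component_le_norm_cart[of h i] assms[of i]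
      by (intro mult_mono) auto
  qed
  then show "cmod (\<Sum>i\<in>UNIV. of_real (h $ i) * a i) \<le> 3 * B * norm h" by (simp add: algebra_simps)
qed

lemma smooth_lipschitz:
  assumes "smooth f" "\<And>i x. cmod (pd i f x) \<le> B"
  shows "cmod (f y - f x) \<le> 3 * B * norm (y - x)"
proof (rule differentiable_bound[OF convex_UNIV])
  show "(f has_derivative (\<lambda>h. \<Sum>i\<in>UNIV. of_real (h $ i) * pd i f x)) (at x within UNIV)" for x
    using smooth_has_derivative[OF assms(1)] by simp
  show "onorm (\<lambda>h. \<Sum>i\<in>UNIV. of_real (h $ i) * pd i f x) \<le> 3 * B" for x
    by (rule onorm_sum_partials[OF assms(2)])
qed auto

text \<open>Mean value inequality for \<open>f\<close> minus its linearisation: on the ball each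
  first partial varies by at most \<open>3 * B * norm h\<close>, and passing to the full derivative
  costs another factor 3, one for each coordinate.\<close>

lemma smooth_taylor:
  assumes "smooth f" "\<And>i j x. cmod (pd i (pd j f) x) \<le> B"
  shows "cmod (f (x + h) - f x - (\<Sum>i\<in>UNIV. of_real (h $ i) * pd i f x))
           \<le> 9 * B * (norm h)\<^sup>2"
proof -
  let ?D = "\<lambda>y (h :: R3). \<Sum>i\<in>UNIV. of_real (h $ i) * pd i f y"
  have B: "B \<ge> 0" using order_trans[OF norm_ge_zero assms(2)] .
  have "norm (f (x + h) - f x - ?D x (x + h - x)) \<le> norm (x + h - x) * (3 * (3 * B * norm h))"
  proof (rule differentiable_bound_linearization[where S = "cball x (norm h)"])
    show "(f has_derivative ?D y) (at y within cball x (norm h))" for y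
      using smooth_has_derivative[OF assms(1)] by (rule has_derivative_at_withinI)
    fix y assume y: "y \<in> cball x (norm h)"
    have *: "?D y - ?D x
      = (\<lambda>v. \<Sum>i\<in>UNIV. of_real (v $ i) * (pd i f y - pd i f x))"
      by (rule ext) (simp add: algebra_simps sum_subtractf)
    show "onorm (?D y - ?D x) \<le> 3 * (3 * B * norm h)"
      unfolding *
    proof (rule onorm_sum_partials)
      fix i
      have "cmod (pd i f y - pd i f x) \<le> 3 * B * norm (y - x)"
        by (rule smooth_lipschitz[OF smooth_partial[OF assms(1)] assms(2)])
      also have "\<dots> \<le> 3 * B * norm h"
        using y B by (intro mult_left_mono) (auto simp: dist_norm norm_minus_commute)
      finally show "cmod (pd i f y - pd i f x) \<le> 3 * B * norm h" .
    qed
  qed (auto simp: dist_norm mult_left_le_one_le)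
  then show ?thesis by (simp add: power2_eq_square mult_ac)
qed


section \<open>Test functions\<close>

lemma test_function_iff: "test_function f \<longleftrightarrow> smooth f \<and> bounded {x. f x \<noteq> 0}"
  by (simp add: test_function_def smooth_def compact_closure)

lemma test_function_smooth: "test_function f \<Longrightarrow> smooth f"
  by (simp add: test_function_iff)

text \<open>Off the closed support \<open>f\<close> vanishes on a neighbourhood, so its derivative
  vanishes there too; the closure of a bounded set is still bounded.\<close>

lemma test_function_partial:
  assumes "test_function f" shows "test_function (pd i f)"
proof -
  have "pd i f x = 0" if "x \<notin> closure {x. f x \<noteq> 0}" for x
  proof -
    have "(f has_derivative (\<lambda>h. 0)) (at x)"
      by (rule has_derivative_transform_within_open[OF has_derivative_const[where c = 0], where s = "- closure {x. f x \<noteq> 0}"])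
        (use that closure_subset[of "{x. f x \<noteq> 0}"] in auto)
    from partial_deriv_eq[OF this] show ?thesis by simp
  qed
  then have "{x. pd i f x \<noteq> 0} \<subseteq> closure {x. f x \<noteq> 0}" by auto
  then show ?thesis
    using assms bounded_subset[OF bounded_closure] smooth_partial by (auto simp: test_function_iff)
qed

lemma test_function_iter_partial: "test_function f \<Longrightarrow> test_function (iter_partial is f)"
  by (induction "is") (auto intro: test_function_partial)

lemma test_function_add: "test_function f \<Longrightarrow> test_function g \<Longrightarrow> test_function (\<lambda>x. f x + g x)"
  unfolding test_function_iff
  by (auto intro!: smooth_add intro: bounded_subset[where T = "{x. f x \<noteq> 0} \<union> {x. g x \<noteq> 0}"])

lemma test_function_mult_left:
  "test_function f \<Longrightarrow> smooth g \<Longrightarrow> test_function (\<lambda>x. g x * f x)"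
  and test_function_mult_right:
  "test_function f \<Longrightarrow> smooth g \<Longrightarrow> test_function (\<lambda>x. f x * g x)"
  unfolding test_function_iff
  by (auto intro!: smooth_mult intro: bounded_subset[where T = "{x. f x \<noteq> 0}"])

lemma test_function_cmult: "test_function f \<Longrightarrow> test_function (\<lambda>x. c * f x)"
  by (rule test_function_mult_left[OF _ smooth_const])

lemma test_function_diff: "test_function f \<Longrightarrow> test_function g \<Longrightarrow> test_function (\<lambda>x. f x - g x)"
  using test_function_add[of f "\<lambda>x. (- 1) * g x"] test_function_cmult[of g "- 1"] by simp

lemma test_function_0: "test_function (\<lambda>x. 0)"
  by (simp add: test_function_iff smooth_const)

lemma test_function_sum:
  "(\<And>a. a \<in> A \<Longrightarrow> test_function (f a)) \<Longrightarrow> test_function (\<lambda>x. \<Sum>a\<in>A. f a x)"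
  by (induction A rule: infinite_finite_induct) (auto intro: test_function_0 test_function_add)

lemma test_function_affine:
  assumes "test_function f" "c \<noteq> 0" shows "test_function (\<lambda>x. f (c *\<^sub>R x + y))"
proof -
  obtain r where r: "norm x \<le> r" if "f x \<noteq> 0" for x
    using assms(1) by (auto simp: test_function_iff bounded_iff)
  have "norm x \<le> (r + norm y) / \<bar>c\<bar>" if "f (c *\<^sub>R x + y) \<noteq> 0" for x
  proof -
    have "\<bar>c\<bar> * norm x \<le> norm (c *\<^sub>R x + y) + norm y"
      using norm_triangle_ineq4[of "c *\<^sub>R x + y" y] by simp
    with r[OF that] assms(2) show ?thesis by (simp add: field_simps)
  qed
  then show ?thesis using assms(1) by (auto simp: test_function_iff smooth_affine bounded_iff)
qed

lemma test_function_support: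
  assumes "test_function f"
  obtains r where "r > 0" "\<And>x. f x \<noteq> 0 \<Longrightarrow> norm x \<le> r"
proof -
  obtain r where r: "norm x \<le> r" if "f x \<noteq> 0" for x
    using assms(1) by (auto simp: test_function_iff bounded_iff)
  show ?thesis by (rule that[of "max r 1"]) (use r in \<open>auto simp: le_max_iff_disj\<close>)
qed

lemma test_function_bounded:
  assumes "test_function f"
  obtains B where "B > 0" "\<And>x. cmod (f x) \<le> B"
proof -
  let ?K = "closure {x. f x \<noteq> 0}"
  have "compact (f ` ?K)"
    using assms by (intro compact_continuous_image)
      (auto simp: test_function_iff compact_closure intro: smooth_continuous_on)
  then obtain B where B: "\<forall>y\<in>f ` ?K. cmod y \<le> B"
    by (metis compact_imp_bounded bounded_iff)
  have "cmod (f x) \<le> max B 1" for x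
  proof (cases "f x = 0")
    case False
    then have "x \<in> ?K" by (intro subsetD[OF closure_subset]) simp
    with B have "cmod (f x) \<le> B" by blast
    then show ?thesis by simp
  qed simp
  then show ?thesis by (intro that[of "max B 1"]) auto
qed

text \<open>There are only finitely many index lists of bounded length, so the sum of their
  individual bounds is a common one.\<close>

lemma test_function_partials_bounded:
  assumes "test_function f"
  obtains B where "B > 0" "\<And>is x. length is \<le> n \<Longrightarrow> cmod (iter_partial is f x) \<le> B"
proof -
  have "\<exists>B>0. \<forall>x. cmod (iter_partial is f x) \<le> B" for "is"
    using test_function_bounded[OF test_function_iter_partial[OF assms]] by metis
  then obtain B where B: "\<And>is. B is > 0" "\<And>is x. cmod (iter_partial is f x) \<le> B is" by metis
  have fin: "finite {is :: 3 list. length is \<le> n}"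
    using finite_lists_length_le[of "UNIV :: 3 set" n] by simp
  show ?thesis
  proof (rule that[of "\<Sum>is | length is \<le> n. B is"])
    show "0 < (\<Sum>is | length is \<le> n. B is)"
      by (rule sum_pos) (use fin B in \<open>auto intro!: exI[of _ "[]"]\<close>)
    show "cmod (iter_partial is f x) \<le> (\<Sum>is | length is \<le> n. B is)" if "length is \<le> n" for "is" x
    proof -
      have "B is \<le> (\<Sum>is | length is \<le> n. B is)"
        by (rule member_le_sum) (use that fin B in \<open>auto intro: less_imp_le\<close>)
      with B(2)[of "is" x] show ?thesis by linarith
    qed
  qed
qed

lemma test_function_taylor:
  assumes "test_function f"
  obtains L where "L > 0"
    "\<And>x h. cmod (f (x + h) - f x - (\<Sum>i\<in>UNIV. of_real (h $ i) * pd i f x)) \<le> L * (norm h)\<^sup>2"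
proof -
  obtain B where B: "B > 0" "\<And>is x. length is \<le> 2 \<Longrightarrow> cmod (iter_partial is f x) \<le> B"
    using test_function_partials_bounded[OF assms, where n = 2] by auto
  have "cmod (pd i (pd j f) x) \<le> B" for i j x using B(2)[of "[i, j]" x] by simp
  from smooth_taylor[OF test_function_smooth[OF assms] this] show ?thesis
    using B by (intro that[of "9 * B"]) auto
qed

lemma sum_scale_axis:
  fixes g :: "3 \<Rightarrow> complex"
  shows "(\<Sum>i\<in>UNIV. of_real ((t *\<^sub>R axis j 1 :: R3) $ i) * g i) = of_real t * g j"
  by (simp add: axis_def if_distrib if_distribR cong: if_cong)

text \<open>Both mixed partials are the limit of the same second difference quotient.\<close>

lemma partial_deriv_commute:
  assumes "test_function f"
  shows "pd i (pd j f) x = pd j (pd i f) x"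
proof -
  define e :: "3 \<Rightarrow> R3" where "e i = axis i 1" for i
  obtain B where B: "B > 0" "\<And>is x. length is \<le> 3 \<Longrightarrow> cmod (iter_partial is f x) \<le> B"
    using test_function_partials_bounded[OF assms, where n = 3] by auto
  have est: "cmod (f (x + t *\<^sub>R e i + t *\<^sub>R e j) - f (x + t *\<^sub>R e i) - f (x + t *\<^sub>R e j) + f x
        - of_real (t\<^sup>2) * pd j (pd i f) x) \<le> 36 * B * \<bar>t\<bar> ^ 3" for t i j
  proof -
    \<comment> \<open>The difference in direction \<open>j\<close> is taken first. As the third
      partials of \<open>f\<close> are bounded, the second partials of \<open>g\<close> are O(t), so
      both Taylor remainders below are cubic in \<open>t\<close>; their constants 27 and 9 add up to
      36.\<close>
    define g where "g x = f (1 *\<^sub>R x + t *\<^sub>R e j) - f x" for x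
    have ts: "test_function (\<lambda>x. h (1 *\<^sub>R x + t *\<^sub>R e j))" if "test_function h" for h
      by (rule test_function_affine) (use that in auto)
    have pg: "pd a g = (\<lambda>x. pd a f (1 *\<^sub>R x + t *\<^sub>R e j) - pd a f x)" for a
      unfolding g_def
      by (rule ext, subst partial_deriv_diff)
        (use ts[OF assms] assms in \<open>simp_all add: test_function_smooth partial_deriv_affine[where c = 1, simplified]\<close>)
    have pg2: "pd b (pd a g) x
      = pd b (pd a f) (1 *\<^sub>R x + t *\<^sub>R e j) - pd b (pd a f) x" for a b x
      unfolding pg
      by (subst partial_deriv_diff)
        (use ts[OF test_function_partial[OF assms, of a]] test_function_partial[OF assms, of a] in
          \<open>simp_all add: test_function_smooth partial_deriv_affine[where c = 1, simplified]\<close>)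
    have ne: "norm (t *\<^sub>R e i) = \<bar>t\<bar>" for i unfolding e_def by simp
    have g2: "cmod (pd b (pd a g) x) \<le> 3 * B * \<bar>t\<bar>" for a b x
    proof -
      have "cmod (pd b (pd a f) (x + t *\<^sub>R e j) - pd b (pd a f) x)
         \<le> 3 * B * norm (x + t *\<^sub>R e j - x)"
      proof (rule smooth_lipschitz)
        show "smooth (pd b (pd a f))"
          using assms by (intro smooth_partial test_function_smooth)
        show "cmod (pd c (pd b (pd a f)) x) \<le> B" for c x
          using B(2)[of "[c, b, a]" x] by simp
      qed
      then show ?thesis by (simp add: pg2 ne del: norm_scaleR)
    qed
    have "smooth g"
      unfolding g_def using ts[OF assms] assms by (intro smooth_diff) (auto intro: test_function_smooth)
    from smooth_taylor[OF this g2, of x "t *\<^sub>R e i"]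
    have 1: "cmod (g (x + t *\<^sub>R e i) - g x - of_real t * pd i g x) \<le> 9 * (3 * B * \<bar>t\<bar>) * \<bar>t\<bar>\<^sup>2"
      unfolding e_def sum_scale_axis using ne[of i] by (simp add: e_def)
    have f3: "cmod (pd b (pd a (pd i f)) x) \<le> B" for a b x
      using B(2)[of "[b, a, i]" x] by simp
    from smooth_taylor[OF smooth_partial[OF test_function_smooth[OF assms]] f3, of x "t *\<^sub>R e j"]
    have "cmod (pd i g x - of_real t * pd j (pd i f) x) \<le> 9 * B * \<bar>t\<bar>\<^sup>2"
      unfolding e_def sum_scale_axis pg using ne[of j] by (simp add: e_def)
    then have 2: "cmod (of_real t * (pd i g x - of_real t * pd j (pd i f) x))
      \<le> \<bar>t\<bar> * (9 * B * \<bar>t\<bar>\<^sup>2)"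
      unfolding norm_mult by (intro mult_mono) auto
    have "cmod ((g (x + t *\<^sub>R e i) - g x - of_real t * pd i g x)
        + of_real t * (pd i g x - of_real t * pd j (pd i f) x))
        \<le> 9 * (3 * B * \<bar>t\<bar>) * \<bar>t\<bar>\<^sup>2 + \<bar>t\<bar> * (9 * B * \<bar>t\<bar>\<^sup>2)"
      by (rule norm_triangle_le) (use 1 2 in linarith)
    then show ?thesis
      by (simp add: g_def algebra_simps power2_eq_square power3_eq_cube)
  qed
  define d where "d = pd j (pd i f) x - pd i (pd j f) x"
  have dt: "cmod d \<le> 72 * B * t" if t: "t > 0" for t
  proof -
    let ?S = "f (x + t *\<^sub>R e i + t *\<^sub>R e j) - f (x + t *\<^sub>R e i) - f (x + t *\<^sub>R e j) + f x"
    have a: "cmod (?S - of_real (t\<^sup>2) * pd j (pd i f) x) \<le> 36 * B * \<bar>t\<bar> ^ 3"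
      by (rule est)
    have b: "cmod (?S - of_real (t\<^sup>2) * pd i (pd j f) x) \<le> 36 * B * \<bar>t\<bar> ^ 3"
      using est[where i = j and j = i and t = t] by (simp add: algebra_simps)
    have "cmod (of_real (t\<^sup>2) * d) \<le> 36 * B * \<bar>t\<bar> ^ 3 + 36 * B * \<bar>t\<bar> ^ 3"
      using norm_triangle_ineq4[of "?S - of_real (t\<^sup>2) * pd i (pd j f) x"
          "?S - of_real (t\<^sup>2) * pd j (pd i f) x"] a b
      by (simp add: d_def algebra_simps)
    then have "t\<^sup>2 * cmod d \<le> t\<^sup>2 * (72 * B * t)"
      using t by (simp add: norm_mult power2_eq_square power3_eq_cube algebra_simps)
    then show ?thesis using t by simp
  qed
  have "cmod d = 0"
  proof (rule ccontr)
    assume "cmod d \<noteq> 0"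
    then have "cmod d > 0" by simp
    \<comment> \<open>For this \<open>t\<close> the bound \<open>72 * B * t\<close> is half of
      \<open>cmod d\<close>.\<close>
    with dt[of "cmod d / (144 * B)"] B show False by (simp add: field_simps)
  qed
  then show ?thesis by (simp add: d_def)
qed

section \<open>Integration of test functions\<close>

lemma integrable_bounded_support:
  fixes f :: "R3 \<Rightarrow> complex"
  assumes [measurable]: "f \<in> borel_measurable borel"
    and "\<And>x. cmod (f x) \<le> B" "\<And>x. f x \<noteq> 0 \<Longrightarrow> norm x \<le> r"
  shows "integrable lborel f"
proof (rule Bochner_Integration.integrable_bound)
  show "integrable lborel (\<lambda>x. B * indicator (cball 0 r) x :: real)"
    by (intro integrable_mult_right integrable_real_indicator emeasure_lborel_cball_finite) simp
  have B: "B \<ge> 0" using order_trans[OF norm_ge_zero assms(2)] .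
  show "AE x in lborel. norm (f x) \<le> norm (B * indicator (cball 0 r) x :: real)"
    using assms(2,3) B by (intro AE_I2) (auto simp: indicator_def)
qed simp

lemma test_function_integrable:
  assumes "test_function f" shows "integrable lborel f"
proof -
  from test_function_bounded[OF assms] obtain B where "\<And>x. cmod (f x) \<le> B" by metis
  moreover from test_function_support[OF assms] obtain r where "\<And>x. f x \<noteq> 0 \<Longrightarrow> norm x \<le> r" by metis
  ultimately show ?thesis
    using smooth_measurable[OF test_function_smooth[OF assms]] by (rule integrable_bounded_support[rotated])
qed

lemma test_function_square_integrable:
  assumes "test_function f" shows "square_integrable f"
proof -
  have "integrable lborel (\<lambda>x. f x * cnj (f x))"
    by (intro test_function_integrable test_function_mult_right assms smooth_cnj test_function_smooth)
  then have "integrable lborel (\<lambda>x. cmod (f x * cnj (f x)))" by (rule integrable_norm)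
  then show ?thesis
    using smooth_measurable[OF test_function_smooth[OF assms]]
    by (simp add: square_integrable_def norm_mult power2_eq_square)
qed

lemma integral_translate:
  fixes f :: "R3 \<Rightarrow> 'a :: {banach, second_countable_topology}"
  assumes "f \<in> borel_measurable borel"
  shows "(LINT x|lborel. f (x + a)) = (LINT x|lborel. f x)"
proof -
  have "(LINT x|lborel. f x) = (LINT x|distr lborel borel ((+) a). f x)"
    by (simp add: lborel_distr_plus)
  also have "\<dots> = (LINT x|lborel. f (a + x))"
    by (rule integral_distr) (use assms in auto)
  finally show ?thesis by (simp add: add.commute)
qed

text \<open>By translation invariance a difference of \<open>f\<close> and its translate integrates
  to 0. The Taylor remainder is O(t^2) uniformly and supported in a fixed ball, so dividing by t and
  letting t tend to 0 leaves the integral of the partial derivative.\<close>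

lemma integral_partial_test_function:
  assumes "test_function f" shows "(LINT x|lborel. pd i f x) = 0"
proof -
  obtain L where L: "L > 0"
    "\<And>x h. cmod (f (x + h) - f x - (\<Sum>i\<in>UNIV. of_real (h $ i) * pd i f x)) \<le> L * (norm h)\<^sup>2"
    using test_function_taylor[OF assms] by blast
  obtain r0 where r0: "r0 > 0" "\<And>x. f x \<noteq> 0 \<Longrightarrow> norm x \<le> r0"
    using test_function_support[OF assms] by blast
  obtain r1 where r1: "r1 > 0" "\<And>x. pd i f x \<noteq> 0 \<Longrightarrow> norm x \<le> r1"
    using test_function_support[OF test_function_partial[OF assms]] by blast
  \<comment> \<open>The extra 1 makes room for translates by \<open>t \<le> 1\<close>.\<close>
  define r where "r = max r0 r1 + 1"
  define M where "M = measure lborel (cball (0 :: R3) r)"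
  let ?D = "LINT x|lborel. pd i f x"
  have *: "cmod ?D \<le> L * M * t" if t: "0 < t" "t \<le> 1" for t
  proof -
    let ?e = "t *\<^sub>R axis i 1 :: R3"
    have ne: "norm ?e = t" using t by (simp add: norm_axis_1)
    let ?g = "\<lambda>x. f (x + ?e) - f x - of_real t * pd i f x"
    have if1: "integrable lborel (\<lambda>x. f (x + ?e))"
      using test_function_integrable[OF test_function_affine[OF assms, of 1 ?e]] by simp
    note if2 = test_function_integrable[OF assms] test_function_integrable[OF test_function_partial[OF assms]]
    have "(LINT x|lborel. ?g x) = - of_real t * ?D"
      using if1 if2 by (simp add: integral_translate smooth_measurable test_function_smooth assms)
    then have "t * cmod ?D = cmod (LINT x|lborel. ?g x)" using t by (simp add: norm_mult)
    also have "\<dots> \<le> (LINT x|lborel. L * t\<^sup>2 * indicator (cball (0 :: R3) r) x)"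
    proof (rule order_trans[OF integral_norm_bound integral_mono])
      show "integrable lborel (\<lambda>x. cmod (?g x))" using if1 if2 by simp
      show "integrable lborel (\<lambda>x :: R3. L * t\<^sup>2 * indicator (cball 0 r) x)"
        by (intro integrable_mult_right integrable_real_indicator emeasure_lborel_cball_finite) simp
      fix x
      show "cmod (?g x) \<le> L * t\<^sup>2 * indicator (cball 0 r) x"
      proof (cases "norm x \<le> r")
        case True
        then show ?thesis using L(2)[of x ?e, unfolded sum_scale_axis ne] by simp
      next
        case False
        then have "norm (x + ?e) > max r0 r1" "norm x > max r0 r1"
          using norm_triangle_ineq4[of "x + ?e" ?e] t by (auto simp: r_def ne)
        then show ?thesis using r0(2)[of x] r0(2)[of "x + ?e"] r1(2)[of x] L by fastforce
      qed
    qed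
    also have "\<dots> = t * (L * M * t)" by (simp add: M_def power2_eq_square)
    finally show ?thesis using t by simp
  qed
  have "M \<ge> 0" by (simp add: M_def)
  have "cmod ?D = 0"
  proof (rule ccontr)
    assume D: "cmod ?D \<noteq> 0"
    \<comment> \<open>Chosen to push the bound below half of \<open>cmod ?D\<close>; the
      \<open>+ 1\<close> guards against a zero denominator.\<close>
    define t where "t = min 1 (cmod ?D / (2 * (L * M + 1)))"
    have LM: "L * M \<ge> 0" using L \<open>M \<ge> 0\<close> by simp
    have t: "0 < t" "t \<le> 1" "t \<le> cmod ?D / (2 * (L * M + 1))"
      using D LM by (auto simp: t_def)
    have "cmod ?D \<le> L * M * t" using * t by simp
    also have "\<dots> \<le> (L * M + 1) * (cmod ?D / (2 * (L * M + 1)))"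
      using t LM by (intro mult_mono) auto
    also have "\<dots> = cmod ?D / 2" using LM by (simp add: field_simps)
    finally show False using D by simp
  qed
  then show ?thesis by simp
qed


section \<open>Flat bumps and dominated convergence in the Hilbert space\<close>

text \<open>The family \<open>e\<^bsup>-1/t\<^esup> / t\<^sup>k\<close> is closed under differentiation up to linear combinations.\<close>

definition flat :: "nat \<Rightarrow> real \<Rightarrow> real" where
  "flat k t = (if t > 0 then (1 / t) ^ k * exp (- (1 / t)) else 0)"

text \<open>In the variable \<open>1 / t\<close> this is the decay of a power divided by the
  exponential; to the left of 0 the function is zero.\<close>

lemma flat_tendsto_0: "(flat k \<longlongrightarrow> 0) (at 0)"
proof -
  have 1: "(flat k \<longlongrightarrow> 0) (at_left 0)"
    by (rule tendsto_eventually) (auto simp: eventually_at_filter flat_def)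
  have "((\<lambda>t. inverse t ^ k / exp (inverse t)) \<longlongrightarrow> (0 :: real)) (at_right 0)"
    by (rule filterlim_compose[OF tendsto_power_div_exp_0 filterlim_inverse_at_top_right])
  then have 2: "(flat k \<longlongrightarrow> 0) (at_right 0)"
    by (rule tendsto_cong[THEN iffD1, rotated])
      (auto simp: eventually_at_filter flat_def exp_minus divide_simps)
  show ?thesis using 1 2 by (rule filterlim_split_at)
qed

lemma has_derivative_flat:
  "(flat k has_real_derivative - real k * flat (Suc k) t + flat (k + 2) t) (at t)"
proof -
  consider "t < 0" | "t = 0" | "t > 0" by linarith
  then show ?thesis
  proof cases
    case 1
    have "(flat k has_real_derivative 0) (at t)"
      by (rule has_field_derivative_transform_within_open[where f = "\<lambda>x. 0" and S = "{..<0}"])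
        (use 1 in \<open>auto simp: flat_def\<close>)
    with 1 show ?thesis by (simp add: flat_def)
  next
    case 2
    \<comment> \<open>At 0 the difference quotient of \<open>flat k\<close> is
      \<open>flat (Suc k)\<close> itself, whose limit is already known.\<close>
    have "((\<lambda>h. (flat k (0 + h) - flat k 0) / h) \<longlongrightarrow> 0) (at 0)"
      by (rule tendsto_cong[THEN iffD1, OF _ flat_tendsto_0[of "Suc k"]])
        (auto simp: eventually_at_filter flat_def)
    then have "(flat k has_real_derivative 0) (at 0)" by (simp add: DERIV_def)
    with 2 show ?thesis by (simp add: flat_def)
  next
    case 3
    have "((\<lambda>t. (1 / t) ^ k * exp (- (1 / t))) has_real_derivative
       - real k * flat (Suc k) t + flat (k + 2) t) (at t)"
    proof -
      have "((\<lambda>s. s ^ k * exp (- s)) has_real_derivative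
          (real k * s ^ (k - 1) - s ^ k) * exp (- s)) (at s)" for s :: real
        by (auto intro!: derivative_eq_intros simp: algebra_simps)
      moreover have "((\<lambda>t. 1 / t) has_real_derivative - ((1 / t) ^ 2)) (at t)"
        using 3 by (auto intro!: derivative_eq_intros simp: power2_eq_square)
      ultimately have "((\<lambda>t. (1 / t) ^ k * exp (- (1 / t))) has_real_derivative
          (real k * (1 / t) ^ (k - 1) - (1 / t) ^ k) * exp (- (1 / t)) * - ((1 / t) ^ 2)) (at t)"
        by (rule DERIV_chain2)
      moreover have "(real k * s ^ (k - 1) - s ^ k) * e * - (s ^ 2)
          = - real k * (s ^ Suc k * e) + s ^ (k + 2) * e" for s e :: real
        by (cases k) (auto simp: algebra_simps power2_eq_square)
      ultimately show ?thesis using 3 by (simp add: flat_def)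
    qed
    then show ?thesis
      by (rule has_field_derivative_transform_within_open[where S = "{0<..}"])
        (use 3 in \<open>auto simp: flat_def\<close>)
  qed
qed

lemma flat_0_bounds: "0 \<le> flat 0 t" "flat 0 t \<le> 1"
  by (auto simp: flat_def)

lemma flat_0_tendsto_1:
  assumes "c > 0" shows "(\<lambda>n. flat 0 (real (Suc n) * c)) \<longlonglongrightarrow> 1"
proof -
  have "(\<lambda>n. exp (- (1 / c * inverse (real (Suc n))))) \<longlonglongrightarrow> exp (- (1 / c * 0))"
    by (intro tendsto_intros LIMSEQ_inverse_real_of_nat)
  moreover have "flat 0 (real (Suc n) * c) = exp (- (1 / c * inverse (real (Suc n))))" for n
    using assms mult_pos_pos[OF of_nat_0_less_iff[THEN iffD2, of "Suc n"] assms] by (simp add: flat_def divide_inverse mult.commute)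
  ultimately show ?thesis by simp
qed

lemma smooth_flat: "smooth (\<lambda>x. of_real (flat k (c * x $ i + d)))"
proof (rule smooth_alg[where G = "{\<lambda>x :: R3. of_real (flat k (c * x $ i + d)) | k c d i. True}"])
  have hd: "((\<lambda>x :: R3. complex_of_real (flat k (c * x $ i + d))) has_derivative
     (\<lambda>h. of_real ((c * h $ i) * (- real k * flat (Suc k) (c * x $ i + d) + flat (k + 2) (c * x $ i + d))))) (at x)"
    for x k c d i
  proof -
    have "((\<lambda>x :: R3. c * x $ i + d) has_derivative (\<lambda>h. c * h $ i)) (at x)"
      by (rule has_derivative_eq_rhs, (rule derivative_intros bounded_linear.has_derivative[OF bounded_linear_vec_nth])+) simp
    from has_derivative_compose[OF this has_derivative_flat[of k "c * x $ i + d",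
        unfolded has_field_derivative_def]]
    have "((\<lambda>x :: R3. flat k (c * x $ i + d)) has_derivative
     (\<lambda>h. (c * h $ i) * (- real k * flat (Suc k) (c * x $ i + d) + flat (k + 2) (c * x $ i + d)))) (at x)"
      by (simp add: mult.commute)
    then show ?thesis by (rule has_derivative_of_real)
  qed
  fix g :: "R3 \<Rightarrow> complex" assume "g \<in> {\<lambda>x :: R3. of_real (flat k (c * x $ i + d)) | k c d i. True}"
  then obtain k c d i where g: "g = (\<lambda>x. of_real (flat k (c * x $ i + d)))" by blast
  show "g differentiable (at x)" for x unfolding g differentiable_def using hd by blast
  fix j
  have "pd j g = (\<lambda>x. (of_real (if i = j then c else 0)) *
     (of_real (- real k) * of_real (flat (Suc k) (c * x $ i + d)) + of_real (flat (k + 2) (c * x $ i + d))))"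
    unfolding g by (rule ext) (subst partial_deriv_eq[OF hd], simp add: axis_def)
  also have "\<dots> \<in> alg {\<lambda>x :: R3. of_real (flat k (c * x $ i + d)) | k c d i. True}"
    by (intro alg.mult alg.const alg.add) (rule alg.gen; blast)+
  finally show "pd j g \<in> alg {\<lambda>x :: R3. of_real (flat k (c * x $ i + d)) | k c d i. True}" .
qed (rule alg.gen, blast)

text \<open>A smooth approximation of the indicator of a box: six one-sided flat factors, one for
  each face, whose flanks become steeper as \<open>s\<close> grows.\<close>

definition bump :: "real \<Rightarrow> R3 \<Rightarrow> R3 \<Rightarrow> R3 \<Rightarrow> complex" where
  "bump s a b x = (\<Prod>i\<in>UNIV. of_real (flat 0 (s * (x $ i - a $ i))) * of_real (flat 0 (s * (b $ i - x $ i))))"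

lemma bump_eq_0: "s > 0 \<Longrightarrow> x \<notin> box a b \<Longrightarrow> bump s a b x = 0"
  by (auto simp: bump_def mem_box_cart flat_def zero_less_mult_iff)

lemma smooth_bump: "smooth (bump s a b)"
  using smooth_flat[of 0 s _ "- (s * a $ _)"] smooth_flat[of 0 "- s" _ "s * b $ _"]
  unfolding bump_def by (intro smooth_prod smooth_mult) (simp_all add: algebra_simps)

lemma test_function_bump: "s > 0 \<Longrightarrow> test_function (bump s a b)"
  unfolding test_function_iff
  by (auto simp: smooth_bump intro!: bounded_subset[OF bounded_box] intro: bump_eq_0)

lemma cmod_bump_le: "s > 0 \<Longrightarrow> cmod (bump s a b x) \<le> indicator (box a b) x"
proof (cases "x \<in> box a b")
  case True
  have "cmod (bump s a b x) \<le> (\<Prod>i\<in>(UNIV :: 3 set). 1)"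
    unfolding bump_def prod_norm[symmetric] norm_mult
    by (rule prod_mono) (use flat_0_bounds in \<open>auto intro!: mult_le_one\<close>)
  with True show ?thesis by simp
qed (simp add: bump_eq_0)

lemma bump_tendsto: "(\<lambda>n. bump (real (Suc n)) a b x) \<longlonglongrightarrow> indicator (box a b) x"
proof (cases "x \<in> box a b")
  case True
  have "(\<lambda>n. bump (real (Suc n)) a b x) \<longlonglongrightarrow> (\<Prod>i\<in>(UNIV :: 3 set). of_real 1 * of_real 1)"
    unfolding bump_def
    by (intro tendsto_prod tendsto_mult tendsto_of_real flat_0_tendsto_1)
      (use True in \<open>auto simp: mem_box_cart\<close>)
  with True show ?thesis by simp
qed (simp add: bump_eq_0)

section \<open>Calculus with classes of square integrable functions\<close>

lemma abs_l2_cases: obtains f where "square_integrable f" "u = abs_l2 f"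
proof -
  have "\<exists>f. square_integrable f \<and> u = abs_l2 f"
    by (induction u rule: l2.abs_induct) (auto simp: l2_rel_def)
  then show ?thesis using that by blast
qed

lemma l2_rel_refl: "square_integrable f \<Longrightarrow> l2_rel f f"
  by (simp add: l2_rel_def)

lemmas abs_l2_add = plus_l2.abs_eq[OF l2_rel_refl l2_rel_refl]
lemmas abs_l2_diff = minus_l2.abs_eq[OF l2_rel_refl l2_rel_refl]
lemmas abs_l2_scaleC = scaleC.abs_eq[OF l2_rel_refl]
lemmas abs_l2_zero = zero_l2.abs_eq
lemmas norm_abs_l2 = norm_l2.abs_eq[OF l2_rel_refl]

lemma abs_l2_sum:
  assumes "\<And>a. a \<in> A \<Longrightarrow> square_integrable (f a)"
  shows "square_integrable (\<lambda>x. \<Sum>a\<in>A. f a x)" "abs_l2 (\<lambda>x. \<Sum>a\<in>A. f a x) = (\<Sum>a\<in>A. abs_l2 (f a))"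
  using assms
  by (induction A rule: infinite_finite_induct)
    (auto simp: abs_l2_zero[symmetric] abs_l2_add[symmetric] intro: square_integrable_0 square_integrable_add)

lemma scaleC_simps:
  "c *\<^sub>C (u + v) = c *\<^sub>C u + c *\<^sub>C v" "c *\<^sub>C (u - v) = c *\<^sub>C u - c *\<^sub>C v"
  "(c + d) *\<^sub>C u = c *\<^sub>C u + d *\<^sub>C u" "(c - d) *\<^sub>C u = c *\<^sub>C u - d *\<^sub>C u"
  "c *\<^sub>C d *\<^sub>C u = (c * d) *\<^sub>C u" "1 *\<^sub>C u = u" "0 *\<^sub>C u = 0" "c *\<^sub>C 0 = 0"
  by (transfer; auto simp: l2_rel_def algebra_simps
      intro!: square_integrable_add square_integrable_diff square_integrable_mult square_integrable_0)+

lemma scaleC_minus: "c *\<^sub>C (- u) = - (c *\<^sub>C u)" "(- c) *\<^sub>C u = - (c *\<^sub>C u)"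
  using scaleC_simps(2)[of c 0 u] scaleC_simps(4)[of 0 c u] by (simp_all add: scaleC_simps)

lemma scaleR_eq_scaleC: "r *\<^sub>R u = of_real r *\<^sub>C u"
  by transfer (auto simp: l2_rel_def scaleR_conv_of_real intro: square_integrable_mult)

lemma norm_scaleC: "norm (c *\<^sub>C u) = cmod c * norm u"
  by transfer (simp add: norm_mult power_mult_distrib real_sqrt_mult)

lemma norm_abs_l2_sq: "square_integrable f \<Longrightarrow> (norm (abs_l2 f))\<^sup>2 = (LINT x|lborel. (cmod (f x))\<^sup>2)"
  by (simp add: norm_abs_l2)

lemma norm_abs_l2_nn:
  "square_integrable f \<Longrightarrow> ennreal ((norm (abs_l2 f))\<^sup>2) = (\<integral>\<^sup>+x. ennreal ((cmod (f x))\<^sup>2) \<partial>lborel)"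
  by (simp add: norm_abs_l2_sq nn_integral_eq_integral square_integrable_def)

lemma square_integrable_nn:
  assumes "f \<in> borel_measurable borel" "(\<integral>\<^sup>+x. ennreal ((cmod (f x))\<^sup>2) \<partial>lborel) < \<infinity>"
  shows "square_integrable f"
  using assms by (auto simp: square_integrable_def intro!: integrableI_nonneg)

text \<open>Ordinary dominated convergence for the squared distance, with majorant
  \<open>4 * g^2\<close>. All approximations in L^2 below rest on it: boxes by bumps, truncations,
  translates and cutoffs.\<close>

lemma l2_dominated_convergence:
  assumes f: "\<And>n. f n \<in> borel_measurable borel" "h \<in> borel_measurable borel"
    and g: "integrable lborel (\<lambda>x. (g x)\<^sup>2)"
    and b: "\<And>n x. cmod (f n x) \<le> g x"
    and l: "AE x in lborel. (\<lambda>n. f n x) \<longlonglongrightarrow> h x"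
  shows "\<And>n. square_integrable (f n)" "square_integrable h" "(\<lambda>n. abs_l2 (f n)) \<longlonglongrightarrow> abs_l2 h"
proof -
  have b2: "(cmod (f n x))\<^sup>2 \<le> (g x)\<^sup>2" for n x using b by (intro power_mono) auto
  show sf: "square_integrable (f n)" for n
    unfolding square_integrable_def
    using f by (auto intro!: Bochner_Integration.integrable_bound[OF g] simp: b2)
  have hb: "AE x in lborel. cmod (h x) \<le> g x"
    using l
  proof eventually_elim
    case (elim x)
    show ?case by (rule tendsto_upperbound[OF tendsto_norm[OF elim]]) (use b in auto)
  qed
  then have hb2: "AE x in lborel. (cmod (h x))\<^sup>2 \<le> (g x)\<^sup>2"
    by eventually_elim (auto intro: power_mono)
  show sh: "square_integrable h"
    unfolding square_integrable_def
    using f hb2 by (auto intro!: Bochner_Integration.integrable_bound[OF g])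
  have "(\<lambda>n. LINT x|lborel. (cmod (f n x - h x))\<^sup>2) \<longlonglongrightarrow> (LINT x|(lborel :: R3 measure). 0 :: real)"
  proof (rule integral_dominated_convergence[where w = "\<lambda>x. 4 * (g x)\<^sup>2"])
    show "AE x in lborel. (\<lambda>n. (cmod (f n x - h x))\<^sup>2) \<longlonglongrightarrow> 0"
      using l
    proof eventually_elim
      case (elim x)
      have "(\<lambda>n. (cmod (f n x - h x))\<^sup>2) \<longlonglongrightarrow> (cmod (h x - h x))\<^sup>2"
        by (intro tendsto_intros elim)
      then show ?case by simp
    qed
    show "AE x in lborel. norm ((cmod (f n x - h x))\<^sup>2) \<le> 4 * (g x)\<^sup>2" for n
      using hb
    proof eventually_elim
      case (elim x)
      have "cmod (f n x - h x) \<le> 2 * g x"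
        using norm_triangle_ineq4[of "f n x" "h x"] b[of n x] elim by linarith
      then have "(cmod (f n x - h x))\<^sup>2 \<le> (2 * g x)\<^sup>2" by (intro power_mono) auto
      then show ?case by (simp add: power_mult_distrib)
    qed
  qed (use f g in auto)
  then have "(\<lambda>n. norm (abs_l2 (f n) - abs_l2 h)) \<longlonglongrightarrow> sqrt 0"
    unfolding abs_l2_diff[OF sf sh] norm_abs_l2[OF square_integrable_diff[OF sf sh]]
    by (intro tendsto_real_sqrt) simp
  then show "(\<lambda>n. abs_l2 (f n)) \<longlonglongrightarrow> abs_l2 h" by (simp add: LIM_zero_iff tendsto_norm_zero_iff)
qed


section \<open>Density of test functions and completeness\<close>

definition test_l2 :: "l2 set" where "test_l2 = abs_l2 ` {f. test_function f}"

lemma test_l2_closure_add: "u \<in> closure test_l2 \<Longrightarrow> v \<in> closure test_l2 \<Longrightarrow> u + v \<in> closure test_l2"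
proof -
  assume "u \<in> closure test_l2" "v \<in> closure test_l2"
  then obtain X Y where X: "\<forall>n. X n \<in> test_l2" "X \<longlonglongrightarrow> u" and Y: "\<forall>n. Y n \<in> test_l2" "Y \<longlonglongrightarrow> v"
    unfolding closure_sequential by blast
  have "X n + Y n \<in> test_l2" for n
    using X(1)[rule_format, of n] Y(1)[rule_format, of n]
    by (auto simp: test_l2_def abs_l2_add test_function_square_integrable intro: test_function_add)
  with tendsto_add[OF X(2) Y(2)] show ?thesis
    unfolding closure_sequential by (intro exI[of _ "\<lambda>n. X n + Y n"]) simp
qed

lemma tendsto_scaleC: "(X \<longlongrightarrow> u) F \<Longrightarrow> ((\<lambda>n. c *\<^sub>C X n) \<longlongrightarrow> c *\<^sub>C u) F"
proof (rule bounded_linear.tendsto[of "\<lambda>u. c *\<^sub>C u"])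
  show "bounded_linear (\<lambda>u. c *\<^sub>C u)"
    by (rule bounded_linear_intro[where K = "cmod c"])
      (auto simp: scaleC_simps scaleR_eq_scaleC norm_scaleC mult.commute)
qed

lemma test_l2_closure_scaleC: "u \<in> closure test_l2 \<Longrightarrow> c *\<^sub>C u \<in> closure test_l2"
proof -
  assume "u \<in> closure test_l2"
  then obtain X where X: "\<forall>n. X n \<in> test_l2" "X \<longlonglongrightarrow> u"
    unfolding closure_sequential by blast
  have "c *\<^sub>C X n \<in> test_l2" for n
    using X(1)[rule_format, of n]
    by (auto simp: test_l2_def abs_l2_scaleC test_function_square_integrable intro: test_function_cmult)
  with tendsto_scaleC[OF X(2)] show ?thesis
    unfolding closure_sequential by (intro exI[of _ "\<lambda>n. c *\<^sub>C X n"]) simp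
qed

lemma closure_test_l2_limit:
  "(\<And>n. X n \<in> closure test_l2) \<Longrightarrow> X \<longlonglongrightarrow> u \<Longrightarrow> u \<in> closure test_l2"
  using closed_sequentially[OF closed_closure] by blast

lemma zero_closure_test_l2: "abs_l2 (\<lambda>x. 0) \<in> closure test_l2"
  using closure_subset[of test_l2] test_function_0 by (auto simp: test_l2_def)

lemma test_l2_closure_sum: "(\<And>a. a \<in> A \<Longrightarrow> u a \<in> closure test_l2) \<Longrightarrow> (\<Sum>a\<in>A. u a) \<in> closure test_l2"
  using zero_closure_test_l2
  by (induction A rule: infinite_finite_induct) (auto simp: abs_l2_zero intro: test_l2_closure_add)

lemma integrable_indicator_box_sq: "integrable lborel (\<lambda>x. (indicator (box a b :: R3 set) x :: real)\<^sup>2)"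
proof -
  have "integrable lborel (indicator (box a b :: R3 set) :: R3 \<Rightarrow> real)"
    by (rule integrable_real_indicator) (auto simp: emeasure_lborel_box_eq)
  moreover have "(\<lambda>x. (indicator (box a b :: R3 set) x :: real)\<^sup>2) = indicator (box a b)"
    by (auto simp: indicator_def)
  ultimately show ?thesis by simp
qed

lemma box_in_closure: "abs_l2 (indicator (box a b)) \<in> closure test_l2"
proof (rule closure_test_l2_limit)
  show "(\<lambda>n. abs_l2 (bump (real (Suc n)) a b)) \<longlonglongrightarrow> abs_l2 (indicator (box a b))"
  proof (rule l2_dominated_convergence(3)[where g = "indicator (box a b)"])
    show "bump (real (Suc n)) a b \<in> borel_measurable borel" for n
      by (rule smooth_measurable[OF smooth_bump])
    show "cmod (bump (real (Suc n)) a b x) \<le> indicator (box a b) x" for n x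
      by (rule cmod_bump_le) simp
    show "AE x in lborel. (\<lambda>n. bump (real (Suc n)) a b x) \<longlonglongrightarrow> indicator (box a b) x"
      by (intro AE_I2 bump_tendsto)
  qed (use integrable_indicator_box_sq in auto)
  show "abs_l2 (bump (real (Suc n)) a b) \<in> closure test_l2" for n
    using closure_subset[of test_l2] test_function_bump[of "real (Suc n)"] by (auto simp: test_l2_def)
qed

lemma square_integrable_indicator:
  assumes "A \<in> sets borel" "A \<subseteq> box a b"
  shows "square_integrable (indicator A)"
  unfolding square_integrable_def
proof
  show "integrable lborel (\<lambda>x. (cmod (indicator A x))\<^sup>2)"
    by (rule Bochner_Integration.integrable_bound[OF integrable_indicator_box_sq[of a b]])
      (use assms in \<open>auto simp: indicator_def\<close>)
qed (use assms in auto)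

text \<open>A pi-lambda argument: open boxes are stable under intersection and generate the Borel
  sets. Intersecting with a fixed box keeps complements and countable unions square
  integrable.\<close>

lemma borel_in_closure:
  assumes "A \<in> sets borel"
  shows "abs_l2 (indicator (A \<inter> box a b)) \<in> closure test_l2"
proof -
  let ?G = "range (\<lambda>(a, b). box a b :: R3 set)"
  have bb: "\<exists>e f. box a b \<inter> box c d = box e f" for a b c d :: R3
    using box_Int_box[of a b c d] by blast
  have "Int_stable ?G"
  proof (rule Int_stableI)
    fix A B assume "A \<in> ?G" "B \<in> ?G"
    then obtain a b c d where "A = box a b" "B = box c d" by auto
    with bb[of a b c d] show "A \<inter> B \<in> ?G" by auto
  qed
  moreover have "?G \<subseteq> Pow UNIV" by auto
  moreover have "A \<in> sigma_sets UNIV ?G"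
    using assms by (simp add: borel_eq_box)
  ultimately show ?thesis
  proof (induction rule: sigma_sets_induct_disjoint[where G = ?G and \<Omega> = UNIV, consumes 3])
    case (basic A)
    then obtain c d where "A \<inter> box a b = box c d" using bb by fastforce
    then show ?case by (simp add: box_in_closure)
  next
    case empty
    show ?case using zero_closure_test_l2 by (simp add: indicator_def)
  next
    case (compl A)
    then have A: "A \<in> sets borel" by (simp add: borel_eq_box)
    have s1: "square_integrable (indicator (box a b))" "square_integrable (indicator (A \<inter> box a b))"
      by (rule square_integrable_indicator[of _ a b]; use A in simp)+
    have "abs_l2 (indicator ((UNIV - A) \<inter> box a b)) = abs_l2 (\<lambda>x. indicator (box a b) x - indicator (A \<inter> box a b) x)"
      by (rule arg_cong[where f = abs_l2]) (auto simp: indicator_def)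
    also have "\<dots> = abs_l2 (indicator (box a b)) + (- 1) *\<^sub>C abs_l2 (indicator (A \<inter> box a b))"
      using s1 by (simp add: abs_l2_diff[symmetric] scaleC_minus scaleC_simps)
    finally show ?case
      using box_in_closure compl by (simp add: test_l2_closure_add test_l2_closure_scaleC)
  next
    case (union A)
    then have A: "A i \<in> sets borel" for i by (auto simp: borel_eq_box)
    define U where "U n = (\<Union>i<n. A i)" for n
    have U: "U n \<in> sets borel" for n using A by (auto simp: U_def)
    have sq: "square_integrable (indicator (B \<inter> box a b))" if "B \<in> sets borel" for B
      by (rule square_integrable_indicator[of _ a b]) (use that in auto)
    have Un: "abs_l2 (indicator (U n \<inter> box a b)) \<in> closure test_l2" for n
    proof (induction n)
      case 0
      show ?case using zero_closure_test_l2 by (simp add: U_def indicator_def)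
    next
      case (Suc n)
      have "U n \<inter> A n = {}"
      proof -
        have "A i \<inter> A n = {}" if "i < n" for i
          using union.hyps(1) that by (intro disjoint_family_onD) auto
        then show ?thesis unfolding U_def by blast
      qed
      then have "indicator (U (Suc n) \<inter> box a b) = (\<lambda>x. indicator (U n \<inter> box a b) x + indicator (A n \<inter> box a b) x :: complex)"
        by (auto simp: U_def lessThan_Suc indicator_def fun_eq_iff)
      then have "abs_l2 (indicator (U (Suc n) \<inter> box a b))
          = abs_l2 (indicator (U n \<inter> box a b)) + abs_l2 (indicator (A n \<inter> box a b))"
        by (simp add: abs_l2_add sq U A)
      with Suc union show ?case by (simp add: test_l2_closure_add)
    qed
    have "(\<lambda>n. abs_l2 (indicator (U n \<inter> box a b))) \<longlonglongrightarrow> abs_l2 (indicator ((\<Union>i. A i) \<inter> box a b))"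
    proof (rule l2_dominated_convergence(3)[where g = "indicator (box a b)"])
      show "integrable lborel (\<lambda>x. (indicator (box a b) x :: real)\<^sup>2)"
        by (rule integrable_indicator_box_sq)
      show "AE x in lborel. (\<lambda>n. indicator (U n \<inter> box a b) x :: complex) \<longlonglongrightarrow> indicator ((\<Union>i. A i) \<inter> box a b) x"
      proof (rule AE_I2)
        fix x
        show "(\<lambda>n. indicator (U n \<inter> box a b) x :: complex) \<longlonglongrightarrow> indicator ((\<Union>i. A i) \<inter> box a b) x"
        proof (cases "x \<in> (\<Union>i. A i) \<inter> box a b")
          case True
          then obtain i where i: "x \<in> A i" by auto
          show ?thesis
            by (rule tendsto_eventually) (use True i in \<open>auto simp: eventually_sequentially U_def indicator_def intro!: exI[of _ "Suc i"]\<close>)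
        qed (auto simp: U_def indicator_def)
      qed
    qed (use U A in \<open>auto simp: indicator_def\<close>)
    with Un show ?case by (rule closure_test_l2_limit)
  qed
qed

theorem test_l2_dense: "closure test_l2 = UNIV"
proof -
  have "u \<in> closure test_l2" for u
  proof -
    obtain f where f: "square_integrable f" "u = abs_l2 f" by (rule abs_l2_cases)
    then have fm: "f \<in> borel_measurable lborel" by (simp add: square_integrable_def)
    from borel_measurable_implies_sequence_metric[OF fm, of 0] obtain s where
      s: "\<And>i. simple_function lborel (s i)" "\<And>x. (\<lambda>i. s i x) \<longlonglongrightarrow> f x"
      and sb: "\<And>i x. cmod (s i x) \<le> 2 * cmod (f x)"
      by (simp add: dist_norm) metis
    \<comment> \<open>Cubes exhausting the space. They confine the level sets of the simple
      functions to boxes, which is the form that \<open>borel_in_closure\<close> handles.\<close>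
    define Q where "Q n = (box (- (\<chi> i. real n)) (\<chi> i. real n) :: R3 set)" for n
    have sm: "s i \<in> borel_measurable borel" for i
      using borel_measurable_simple_function[OF s(1)] by simp
    define g where "g n x = s n x * indicator (Q n) x" for n x
    have Qsets [measurable]: "Q n \<in> sets borel" for n by (simp add: Q_def)
    have "(\<lambda>n. abs_l2 (g n)) \<longlonglongrightarrow> abs_l2 f"
    proof (rule l2_dominated_convergence(3)[where g = "\<lambda>x. 2 * cmod (f x)"])
      show "g n \<in> borel_measurable borel" for n
        unfolding g_def using sm[of n] by simp
      show "integrable lborel (\<lambda>x. (2 * cmod (f x))\<^sup>2)"
        using f by (simp add: power_mult_distrib square_integrable_def)
      show "cmod (g n x) \<le> 2 * cmod (f x)" for n x
        using sb[of n x] by (auto simp: g_def indicator_def)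
      show "AE x in lborel. (\<lambda>n. g n x) \<longlonglongrightarrow> f x"
      proof (rule AE_I2)
        fix x
        have "\<forall>\<^sub>F n in sequentially. x \<in> Q n"
        proof -
          have "\<forall>\<^sub>F n in sequentially. real n > norm x"
            using filterlim_real_sequentially by (simp add: filterlim_at_top_dense)
          then show ?thesis
          proof eventually_elim
            case (elim n)
            have "- real n < x $ i \<and> x $ i < real n" for i
              using component_le_norm_cart[of x i] elim by linarith
            then show ?case by (simp add: Q_def mem_box_cart)
          qed
        qed
        then have "\<forall>\<^sub>F n in sequentially. s n x = g n x"
          by eventually_elim (simp add: g_def)
        then show "(\<lambda>n. g n x) \<longlonglongrightarrow> f x"
          using s(2) tendsto_cong by fast
      qed
    qed (use fm in simp)
    moreover have "abs_l2 (g n) \<in> closure test_l2" for n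
    proof -
      define A where "A y = s n -` {y}" for y
      have A: "A y \<in> sets borel" for y
        unfolding A_def using measurable_sets[OF sm[of n], of "{y}"] by simp
      have sqA: "square_integrable (\<lambda>x. c * indicator (A y \<inter> Q n) x)" for c y
        using A Qsets by (intro square_integrable_mult square_integrable_indicator) (auto simp: Q_def)
      have fin: "finite (range (s n))" using simple_functionD(1)[OF s(1)[of n]] by simp
      have gx: "g n x = (\<Sum>y\<in>range (s n). y * indicator (A y \<inter> Q n) x)" for x
      proof -
        have "(\<Sum>y\<in>range (s n). y * indicator (A y \<inter> Q n) x)
          = (\<Sum>y\<in>range (s n). if y = s n x then y * indicator (Q n) x else 0)"
          by (rule sum.cong) (auto simp: A_def indicator_def)
        also have "\<dots> = g n x" using fin by (simp add: g_def)
        finally show ?thesis by simp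
      qed
      have "abs_l2 (g n) = (\<Sum>y\<in>range (s n). y *\<^sub>C abs_l2 (indicator (A y \<inter> Q n)))"
        unfolding gx[abs_def] using sqA[of 1] by (simp add: abs_l2_sum(2) sqA abs_l2_scaleC)
      then show ?thesis
        using borel_in_closure[OF A] by (simp add: Q_def test_l2_closure_sum test_l2_closure_scaleC)
    qed
    ultimately show ?thesis unfolding f(2) by (rule closure_test_l2_limit[rotated])
  qed
  then show ?thesis by blast
qed

lemma test_l2_approx:
  obtains f where "\<And>n :: nat. test_function (f n)" "(\<lambda>n. abs_l2 (f n)) \<longlonglongrightarrow> u"
proof -
  have "u \<in> closure test_l2" by (simp add: test_l2_dense)
  then obtain X where X: "\<forall>n. X n \<in> test_l2" "X \<longlonglongrightarrow> u" unfolding closure_sequential by blast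
  then have "\<forall>n. \<exists>f. test_function f \<and> X n = abs_l2 f" by (auto simp: test_l2_def)
  then obtain f where "\<forall>n. test_function (f n) \<and> X n = abs_l2 (f n)" by metis
  moreover from this have "X = (\<lambda>n. abs_l2 (f n))" by auto
  ultimately show ?thesis using X by (intro that[of f]) auto
qed

text \<open>The Riesz-Fischer theorem: a rapidly converging subsequence converges almost everywhere,
  and Fatou's lemma shows that the pointwise limit is the limit in norm. Completeness later produces
  the weak derivatives of a convolution as limits of Cauchy sequences.\<close>

instance l2 :: banach
proof
  fix X :: "nat \<Rightarrow> l2" assume "Cauchy X"
  have "\<forall>n. \<exists>f. square_integrable f \<and> X n = abs_l2 f" by (meson abs_l2_cases)
  then obtain f where f: "\<And>n. square_integrable (f n)" "\<And>n. X n = abs_l2 (f n)" by metis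
  have "\<forall>k. \<exists>N. \<forall>m\<ge>N. \<forall>n\<ge>N. norm (X m - X n) < (1 / 4) ^ k"
    using \<open>Cauchy X\<close> unfolding Cauchy_iff by simp
  then obtain N where N: "\<And>k m n. m \<ge> N k \<Longrightarrow> n \<ge> N k \<Longrightarrow> norm (X m - X n) < (1 / 4) ^ k" by metis
  \<comment> \<open>The sum exceeds every threshold \<open>N j\<close> with
    \<open>j \<le> k\<close>, so consecutive increments are controlled.\<close>
  define r where "r k = (\<Sum>j\<le>k. N j)" for k
  have rN: "r j \<ge> N k" if "k \<le> j" for j k
    unfolding r_def using that by (intro member_le_sum) auto
  define d where "d k x = f (r (Suc k)) x - f (r k) x" for k x
  have fm [measurable]: "f n \<in> borel_measurable borel" for n using f(1)[of n] by (simp add: square_integrable_def)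
  have sqd: "square_integrable (\<lambda>x. f m x - f n x)" for m n
    by (intro square_integrable_diff f)
  have nn: "(\<integral>\<^sup>+x. ennreal ((cmod (f (r j) x - f (r k) x))\<^sup>2) \<partial>lborel) \<le> ennreal (((1 / 4) ^ k)\<^sup>2)"
    if "k \<le> j" for j k
  proof -
    have "norm (X (r j) - X (r k)) \<le> (1 / 4) ^ k"
      using N[OF rN[OF that] rN[of k k]] by simp
    then have "(norm (abs_l2 (\<lambda>x. f (r j) x - f (r k) x)))\<^sup>2 \<le> ((1 / 4) ^ k)\<^sup>2"
      using f by (intro power_mono) (auto simp: abs_l2_diff)
    then show ?thesis
      using norm_abs_l2_nn[OF sqd[of "r j" "r k"]] by (metis ennreal_leI)
  qed
  \<comment> \<open>The weight 2^k is harmless, as 2^k times 16^(-k) is 8^(-k), but it upgrades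
    square summability of the increments at a point to absolute summability.\<close>
  have "(\<integral>\<^sup>+x. (\<Sum>k. ennreal (2 ^ k * (cmod (d k x))\<^sup>2)) \<partial>lborel)
    = (\<Sum>k. \<integral>\<^sup>+x. ennreal (2 ^ k * (cmod (d k x))\<^sup>2) \<partial>lborel)"
    unfolding d_def by (intro nn_integral_suminf) simp
  also have "\<dots> \<le> (\<Sum>k. ennreal ((1 / 8) ^ k))"
  proof (rule suminf_le)
    fix k
    have "(\<integral>\<^sup>+x. ennreal (2 ^ k * (cmod (d k x))\<^sup>2) \<partial>lborel)
      = ennreal (2 ^ k) * (\<integral>\<^sup>+x. ennreal ((cmod (d k x))\<^sup>2) \<partial>lborel)"
      unfolding d_def by (subst nn_integral_cmult[symmetric]) (auto simp: ennreal_mult)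
    also have "\<dots> \<le> ennreal (2 ^ k) * ennreal (((1 / 4) ^ k)\<^sup>2)"
      unfolding d_def by (intro mult_left_mono nn) auto
    also have "\<dots> = ennreal ((1 / 8) ^ k)"
      by (simp add: ennreal_mult[symmetric] power2_eq_square power_mult_distrib[symmetric])
    finally show "(\<integral>\<^sup>+x. ennreal (2 ^ k * (cmod (d k x))\<^sup>2) \<partial>lborel) \<le> ennreal ((1 / 8) ^ k)" .
  qed auto
  also have "\<dots> < \<infinity>"
    by (subst suminf_ennreal2) (auto intro: summable_geometric)
  finally have fin: "(\<integral>\<^sup>+x. (\<Sum>k. ennreal (2 ^ k * (cmod (d k x))\<^sup>2)) \<partial>lborel) < \<infinity>" .
  have "AE x in lborel. (\<Sum>k. ennreal (2 ^ k * (cmod (d k x))\<^sup>2)) \<noteq> \<infinity>"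
  proof (rule nn_integral_PInf_AE)
    show "(\<integral>\<^sup>+x. (\<Sum>k. ennreal (2 ^ k * (cmod (d k x))\<^sup>2)) \<partial>lborel) \<noteq> \<infinity>"
      using fin by (rule less_imp_neq)
  qed (simp add: d_def)
  then have conv: "AE x in lborel. convergent (\<lambda>k. f (r k) x)"
  proof eventually_elim
    case (elim x)
    then have "summable (\<lambda>k. 2 ^ k * (cmod (d k x))\<^sup>2)"
      by (intro summable_suminf_not_top) auto
    then have "summable (\<lambda>k. (1 / 2) ^ k + 2 ^ k * (cmod (d k x))\<^sup>2)"
      by (intro summable_add summable_geometric) auto
    \<comment> \<open>From 2a \<le> a^2 + 1 with a = 2^k |d|, divided by 2^k.\<close>
    moreover have "norm (d k x) \<le> (1 / 2) ^ k + 2 ^ k * (cmod (d k x))\<^sup>2" for k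
    proof -
      have "2 * (2 ^ k * cmod (d k x)) * 1 \<le> (2 ^ k * cmod (d k x))\<^sup>2 + 1\<^sup>2"
        by (rule sum_squares_bound)
      note sq = this
      have "2 ^ k * cmod (d k x) \<le> (2 ^ k * cmod (d k x))\<^sup>2 + 1"
      proof -
        have "0 \<le> 2 ^ k * cmod (d k x)" by simp
        with sq show ?thesis unfolding mult_1_right one_power2 by linarith
      qed
      then have "(1 / 2) ^ k * (2 ^ k * cmod (d k x)) \<le> (1 / 2) ^ k * ((2 ^ k * cmod (d k x))\<^sup>2 + 1)"
        by (intro mult_left_mono) auto
      then show ?thesis
        by (simp add: power2_eq_square algebra_simps power_divide)
    qed
    ultimately have "summable (\<lambda>k. d k x)" by (rule summable_comparison_test'[where N = 0])
    then have "convergent (\<lambda>n. \<Sum>k<n. d k x)" by (simp add: summable_iff_convergent)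
    then have "convergent (\<lambda>n. (\<Sum>k<n. d k x) + f (r 0) x)"
      by (intro convergent_add convergent_const)
    moreover have "(\<Sum>k<n. d k x) + f (r 0) x = f (r n) x" for n
      unfolding d_def by (subst sum_lessThan_telescope) simp
    ultimately show ?case by simp
  qed
  define g where "g x = lim (\<lambda>k. f (r k) x)" for x
  have gm [measurable]: "g \<in> borel_measurable borel" unfolding g_def by measurable
  have gl: "AE x in lborel. (\<lambda>k. f (r k) x) \<longlonglongrightarrow> g x"
    using conv by eventually_elim (simp add: g_def convergent_LIMSEQ_iff)
  have fatou: "(\<integral>\<^sup>+x. ennreal ((cmod (g x - f (r k) x))\<^sup>2) \<partial>lborel) \<le> ennreal (((1 / 4) ^ k)\<^sup>2)" for k
  proof -
    have "(\<integral>\<^sup>+x. ennreal ((cmod (g x - f (r k) x))\<^sup>2) \<partial>lborel)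
      = (\<integral>\<^sup>+x. liminf (\<lambda>j. ennreal ((cmod (f (r j) x - f (r k) x))\<^sup>2)) \<partial>lborel)"
    proof (rule nn_integral_cong_AE)
      show "AE x in lborel. ennreal ((cmod (g x - f (r k) x))\<^sup>2)
          = liminf (\<lambda>j. ennreal ((cmod (f (r j) x - f (r k) x))\<^sup>2))"
        using gl
      proof eventually_elim
        case (elim x)
        have "(\<lambda>j. ennreal ((cmod (f (r j) x - f (r k) x))\<^sup>2)) \<longlonglongrightarrow> ennreal ((cmod (g x - f (r k) x))\<^sup>2)"
          by (intro tendsto_ennrealI tendsto_intros elim)
        from lim_imp_Liminf[OF _ this] show ?case by simp
      qed
    qed
    also have "\<dots> \<le> liminf (\<lambda>j. \<integral>\<^sup>+x. ennreal ((cmod (f (r j) x - f (r k) x))\<^sup>2) \<partial>lborel)"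
      by (rule nn_integral_liminf) simp
    also have "\<dots> \<le> limsup (\<lambda>j. \<integral>\<^sup>+x. ennreal ((cmod (f (r j) x - f (r k) x))\<^sup>2) \<partial>lborel)"
      by (rule Liminf_le_Limsup) simp
    also have "\<dots> \<le> ennreal (((1 / 4) ^ k)\<^sup>2)"
      by (rule Limsup_bounded) (use nn in \<open>auto simp: eventually_sequentially\<close>)
    finally show ?thesis .
  qed
  have sqgf: "square_integrable (\<lambda>x. g x - f (r k) x)" for k
    by (rule square_integrable_nn) (use fatou[of k] in \<open>auto simp: le_less_trans\<close>)
  have sqg: "square_integrable g" using square_integrable_add[OF sqgf[of 0] f(1)[of "r 0"]] by simp
  have gX: "norm (abs_l2 g - X (r k)) \<le> (1 / 4) ^ k" for k
  proof -
    have "ennreal ((norm (abs_l2 g - X (r k)))\<^sup>2) \<le> ennreal (((1 / 4) ^ k)\<^sup>2)"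
      using norm_abs_l2_nn[OF sqgf[of k]] fatou[of k] by (simp add: f abs_l2_diff sqg)
    then have "(norm (abs_l2 g - X (r k)))\<^sup>2 \<le> ((1 / 4) ^ k)\<^sup>2" by (simp add: ennreal_le_iff)
    then show ?thesis by (rule power2_le_imp_le) simp
  qed
  have "X \<longlonglongrightarrow> abs_l2 g"
  proof (rule LIMSEQ_I)
    fix e :: real assume e: "e > 0"
    then obtain k where k: "(1 / 4) ^ k < e / 2" using real_arch_pow_inv[of "e / 2" "1 / 4"] by auto
    have "norm (X n - abs_l2 g) < e" if "n \<ge> N k" for n
    proof -
      have "norm (X n - X (r k)) < (1 / 4) ^ k" using that rN[of k k] by (intro N) auto
      moreover have "norm (X n - abs_l2 g) \<le> norm (X n - X (r k)) + norm (abs_l2 g - X (r k))"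
        using norm_triangle_ineq4[of "X n - X (r k)" "abs_l2 g - X (r k)"] by simp
      ultimately show ?thesis using gX[of k] k by linarith
    qed
    then show "\<exists>no. \<forall>n\<ge>no. norm (X n - abs_l2 g) < e" by blast
  qed
  then show "convergent X" by (rule convergentI)
qed


section \<open>Bilinear pairing, translations and point values\<close>

lemma
  fixes f :: "R3 \<Rightarrow> 'a :: {banach, second_countable_topology}"
  assumes c: "c \<noteq> 0" and f [measurable]: "f \<in> borel_measurable borel"
  shows integral_affine: "(LINT x|lborel. f x) = \<bar>c\<bar> ^ 3 *\<^sub>R (LINT x|lborel. f (y + c *\<^sub>R x))"
    and integrable_affine_iff: "integrable lborel (\<lambda>x. f (y + c *\<^sub>R x)) \<longleftrightarrow> integrable lborel f"
proof -
  have m: "(\<lambda>x. y + c *\<^sub>R x) \<in> measurable lborel borel" by simp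
  have d: "lborel = density (distr lborel borel (\<lambda>x. y + c *\<^sub>R x)) (\<lambda>_. ennreal (\<bar>c\<bar> ^ 3))"
    using lborel_affine[OF c, of y] by (simp add: ennreal_power)
  have "(LINT x|lborel. f x) = (LINT x|density (distr lborel borel (\<lambda>x. y + c *\<^sub>R x)) (\<lambda>_. ennreal (\<bar>c\<bar> ^ 3)). f x)"
    using d by simp
  also have "\<dots> = \<bar>c\<bar> ^ 3 *\<^sub>R (LINT x|distr lborel borel (\<lambda>x. y + c *\<^sub>R x). f x)"
    by (subst integral_density) auto
  also have "\<dots> = \<bar>c\<bar> ^ 3 *\<^sub>R (LINT x|lborel. f (y + c *\<^sub>R x))"
    by (subst integral_distr[OF m f]) simp
  finally show "(LINT x|lborel. f x) = \<bar>c\<bar> ^ 3 *\<^sub>R (LINT x|lborel. f (y + c *\<^sub>R x))" .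
  have "integrable lborel f \<longleftrightarrow>
      integrable (density (distr lborel borel (\<lambda>x. y + c *\<^sub>R x)) (\<lambda>_. ennreal (\<bar>c\<bar> ^ 3))) f"
    using d by simp
  also have "\<dots> \<longleftrightarrow> integrable (distr lborel borel (\<lambda>x. y + c *\<^sub>R x)) (\<lambda>x. \<bar>c\<bar> ^ 3 *\<^sub>R f x)"
    by (subst integrable_density) auto
  also have "\<dots> \<longleftrightarrow> integrable lborel (\<lambda>x. f (y + c *\<^sub>R x))"
  proof -
    have "integrable lborel (\<lambda>x. \<bar>c\<bar> ^ 3 *\<^sub>R f (y + c *\<^sub>R x)) \<Longrightarrow>
        integrable lborel (\<lambda>x. inverse (\<bar>c\<bar> ^ 3) *\<^sub>R \<bar>c\<bar> ^ 3 *\<^sub>R f (y + c *\<^sub>R x))"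
      by (rule integrable_scaleR_right)
    then show ?thesis using c by (auto simp: integrable_distr_eq[OF m])
  qed
  finally show "integrable lborel (\<lambda>x. f (y + c *\<^sub>R x)) \<longleftrightarrow> integrable lborel f" by simp
qed

lemma AE_affine:
  assumes "c \<noteq> 0" "AE x in lborel. P x"
  shows "AE x in lborel. P (y + c *\<^sub>R x :: R3)"
proof -
  obtain N where N: "{x. \<not> P x} \<subseteq> N" "N \<in> sets lborel" "emeasure lborel N = 0"
    using assms(2) by (auto elim: AE_E)
  have m: "(\<lambda>x. y + c *\<^sub>R x) \<in> measurable lborel borel" by simp
  have "AE x in density (distr lborel borel (\<lambda>x. y + c *\<^sub>R x)) (\<lambda>_. \<bar>c\<bar> ^ DIM(R3)). x \<notin> N"
    by (subst lborel_affine[OF assms(1), of y, symmetric])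
      (use AE_not_in[of N lborel] N in \<open>auto simp: null_sets_def\<close>)
  then have "AE x in distr lborel borel (\<lambda>x. y + c *\<^sub>R x). x \<notin> N"
    using assms(1) by (simp add: AE_density)
  then have "AE x in lborel. y + c *\<^sub>R x \<notin> N"
    using N(2) by (subst (asm) AE_distr_iff[OF m]) auto
  then show ?thesis by eventually_elim (use N in auto)
qed

lemma square_integrable_affine:
  assumes "c \<noteq> 0" "square_integrable f"
  shows "square_integrable (\<lambda>x. f (y + c *\<^sub>R x))"
  using assms integrable_affine_iff[OF assms(1), of "\<lambda>x. (cmod (f x))\<^sup>2" y]
  unfolding square_integrable_def by auto

lemma square_integrable_translate: "square_integrable f \<Longrightarrow> square_integrable (\<lambda>x. f (x - a))"
  using square_integrable_affine[of 1 f "- a"] by simp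

lemma integrable_mult_square_integrable:
  assumes "square_integrable f" "square_integrable g"
  shows "integrable lborel (\<lambda>x. f x * g x)"
proof (rule Bochner_Integration.integrable_bound)
  show "integrable lborel (\<lambda>x. (cmod (f x))\<^sup>2 + (cmod (g x))\<^sup>2)"
    using assms by (simp add: square_integrable_def)
  show "AE x in lborel. norm (f x * g x) \<le> norm ((cmod (f x))\<^sup>2 + (cmod (g x))\<^sup>2)"
  proof (intro AE_I2)
    fix x
    have "2 * cmod (f x) * cmod (g x) \<le> (cmod (f x))\<^sup>2 + (cmod (g x))\<^sup>2"
      by (rule sum_squares_bound)
    moreover have "0 \<le> cmod (f x) * cmod (g x)" by simp
    ultimately have "cmod (f x) * cmod (g x) \<le> (cmod (f x))\<^sup>2 + (cmod (g x))\<^sup>2"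
      unfolding mult.assoc by linarith
    then show "norm (f x * g x) \<le> norm ((cmod (f x))\<^sup>2 + (cmod (g x))\<^sup>2)"
      by (simp add: norm_mult)
  qed
qed (use assms in \<open>auto simp: square_integrable_def\<close>)

text \<open>Bilinear instead of sesquilinear, to match weak derivatives, which test without
  conjugation; it is also complex linear in both arguments, whereas the inner product of the type is
  only its real counterpart.\<close>

lift_definition pair :: "l2 \<Rightarrow> l2 \<Rightarrow> complex" is "\<lambda>f g. LINT x|lborel. f x * g x"
  by (rule integral_cong_AE) (auto simp: l2_rel_def square_integrable_def elim: AE_mp)

lemmas pair_abs_l2 = pair.abs_eq[OF l2_rel_refl l2_rel_refl]

lemma pair_simps:
  "pair (u + v) w = pair u w + pair v w" "pair u (v + w) = pair u v + pair u w"
  "pair (u - v) w = pair u w - pair v w" "pair u (v - w) = pair u v - pair u w"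
  by (transfer; simp add: l2_rel_def distrib_left distrib_right left_diff_distrib right_diff_distrib
      integrable_mult_square_integrable)+

lemma pair_commute: "pair u v = pair v u"
  by transfer (simp add: mult.commute)

lemma pair_scaleC: "pair (c *\<^sub>C u) w = c * pair u w" "pair w (c *\<^sub>C u) = c * pair w u"
proof -
  show "pair (c *\<^sub>C u) w = c * pair u w" by transfer (simp only: mult.assoc integral_mult_right_zero)
  then show "pair w (c *\<^sub>C u) = c * pair w u" by (simp only: pair_commute[of w])
qed

text \<open>The Cauchy-Schwarz inequality of the real inner product is applied to the moduli of both
  functions, where pairing and inner product coincide.\<close>

lemma cmod_pair_le: "cmod (pair u v) \<le> norm u * norm v"
proof -
  obtain f g where f: "square_integrable f" "u = abs_l2 f" and g: "square_integrable g" "v = abs_l2 g"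
    by (metis abs_l2_cases)
  let ?f = "\<lambda>x. complex_of_real (cmod (f x))" and ?g = "\<lambda>x. complex_of_real (cmod (g x))"
  have f': "square_integrable ?f" and g': "square_integrable ?g"
    using f g by (auto simp: square_integrable_def)
  have "cmod (pair u v) \<le> (LINT x|lborel. cmod (f x * g x))"
    unfolding f g pair_abs_l2[OF f(1) g(1)] by (rule integral_norm_bound)
  also have "\<dots> = inner (abs_l2 ?f) (abs_l2 ?g)"
    by (simp add: inner_l2.abs_eq[OF l2_rel_refl[OF f'] l2_rel_refl[OF g']] norm_mult inner_complex_def)
  also have "\<dots> \<le> norm (abs_l2 ?f) * norm (abs_l2 ?g)" by (rule norm_cauchy_schwarz)
  also have "\<dots> = norm u * norm v" using f f' g g' by (simp add: norm_abs_l2)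
  finally show ?thesis .
qed

lemma bounded_bilinear_pair: "bounded_bilinear pair"
  by standard (auto simp: pair_simps pair_scaleC scaleR_eq_scaleC scaleR_conv_of_real cmod_pair_le intro!: exI[of _ 1])

lemmas tendsto_pair = bounded_bilinear.tendsto[OF bounded_bilinear_pair]

lemma weak_deriv_iff_pair:
  "weak_deriv is w v \<longleftrightarrow> (\<forall>f. test_function f \<longrightarrow>
     pair w (abs_l2 (iter_partial is f)) = (- 1) ^ length is * pair v (abs_l2 f))"
proof -
  obtain f g where f: "square_integrable f" "w = abs_l2 f" and g: "square_integrable g" "v = abs_l2 g"
    by (metis abs_l2_cases)
  have "pair w (abs_l2 (iter_partial is h)) = (LINT x|lborel. f x * iter_partial is h x)"
    "pair v (abs_l2 h) = (LINT x|lborel. g x * h x)" if "test_function h" for h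
    using f g that by (simp_all add: pair_abs_l2 test_function_square_integrable test_function_iter_partial)
  then show ?thesis
    using f g by (simp add: weak_deriv.abs_eq[OF l2_rel_refl l2_rel_refl])
qed

text \<open>Weak derivatives are closed operators because they are defined by pairings, which are
  continuous. This carries statements from test functions over to all of L^2.\<close>

lemma weak_deriv_limit:
  assumes "\<And>n :: nat. weak_deriv is (w n) (v n)" "w \<longlonglongrightarrow> w'" "v \<longlonglongrightarrow> v'"
  shows "weak_deriv is w' v'"
  unfolding weak_deriv_iff_pair
proof (intro allI impI)
  fix f assume f: "test_function f"
  have "(\<lambda>n. pair (w n) (abs_l2 (iter_partial is f))) \<longlonglongrightarrow> pair w' (abs_l2 (iter_partial is f))"
    by (intro tendsto_pair tendsto_const assms)
  moreover have "(\<lambda>n. (- 1) ^ length is * pair (v n) (abs_l2 f)) \<longlonglongrightarrow> (- 1) ^ length is * pair v' (abs_l2 f)"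
    by (intro tendsto_mult tendsto_pair tendsto_const assms)
  ultimately show "pair w' (abs_l2 (iter_partial is f)) = (- 1) ^ length is * pair v' (abs_l2 f)"
    using assms(1) f unfolding weak_deriv_iff_pair by (metis (no_types, lifting) LIMSEQ_unique ext)
qed

text \<open>By density \<open>u\<close> is annihilated by every class, in particular by its own
  conjugate, and that pairing is the squared norm.\<close>

lemma pair_test_eq_0:
  assumes "\<And>f. test_function f \<Longrightarrow> pair u (abs_l2 f) = 0"
  shows "u = 0"
proof -
  have 0: "pair u v = 0" for v
  proof -
    obtain f where f: "\<And>n :: nat. test_function (f n)" "(\<lambda>n. abs_l2 (f n)) \<longlonglongrightarrow> v"
      using test_l2_approx[of v] by blast
    have "(\<lambda>n. pair u (abs_l2 (f n))) \<longlonglongrightarrow> pair u v" by (intro tendsto_pair tendsto_const f)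
    then show ?thesis using f assms by (simp add: LIMSEQ_const_iff)
  qed
  obtain f where f: "square_integrable f" "u = abs_l2 f" by (rule abs_l2_cases)
  then have f': "square_integrable (\<lambda>x. cnj (f x))"
    using borel_measurable_continuous_onI[of cnj] measurable_compose[of f borel borel cnj borel]
    by (auto simp: square_integrable_def intro: continuous_intros)
  have "pair u (abs_l2 (\<lambda>x. cnj (f x))) = (LINT x|lborel. complex_of_real ((cmod (f x))\<^sup>2))"
    using f f' by (simp add: pair_abs_l2 complex_norm_square del: of_real_power)
  also have "\<dots> = of_real ((norm u)\<^sup>2)" using f by (simp add: norm_abs_l2_sq del: of_real_power)
  finally show ?thesis using 0 by simp
qed

section \<open>Translations in L^2\<close>

lift_definition shift :: "R3 \<Rightarrow> l2 \<Rightarrow> l2" is "\<lambda>a f x. f (x - a)"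
proof -
  fix a :: R3 and f g :: "R3 \<Rightarrow> complex" assume "l2_rel f g"
  then show "l2_rel (\<lambda>x. f (x - a)) (\<lambda>x. g (x - a))"
    using AE_affine[of 1 "\<lambda>x. f x = g x" "- a"]
    by (auto simp: l2_rel_def intro: square_integrable_translate)
qed

lemmas shift_abs_l2 = shift.abs_eq[OF l2_rel_refl]

lemma shift_diff: "shift a (u - v) = shift a u - shift a v"
  by transfer (auto simp: l2_rel_def intro!: square_integrable_diff square_integrable_translate)

lemma norm_shift [simp]: "norm (shift a u) = norm u"
proof -
  obtain f where f: "square_integrable f" "u = abs_l2 f" by (rule abs_l2_cases)
  then have "(LINT x|lborel. (cmod (f x))\<^sup>2) = \<bar>1\<bar> ^ 3 *\<^sub>R (LINT x|lborel. (cmod (f (- a + 1 *\<^sub>R x)))\<^sup>2)"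
    by (intro integral_affine) (auto simp: square_integrable_def)
  then show ?thesis
    using f by (simp add: shift_abs_l2 norm_abs_l2 square_integrable_translate)
qed

lemma integrable_indicator_cball: "integrable lborel (\<lambda>x. B * indicator (cball (0 :: R3) r) x :: real)"
  by (intro integrable_mult_right integrable_real_indicator emeasure_lborel_cball_finite) simp

text \<open>Translations are isometries, so approximating \<open>u\<close> by test functions is
  uniform in the shift, and for test functions dominated convergence applies. Two later facts rest
  on this: convolutions with the kernel are continuous, and the kernels of the two centers merge in
  L^2.\<close>

lemma continuous_on_shift: "continuous_on UNIV (\<lambda>a. shift a u)"
proof -
  have test: "continuous_on UNIV (\<lambda>a. shift a (abs_l2 f))" if f: "test_function f" for f
    unfolding continuous_on_eq_continuous_at[OF open_UNIV] continuous_at_sequentially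
  proof (intro ballI allI impI)
    fix b and a :: "nat \<Rightarrow> R3" assume a: "a \<longlonglongrightarrow> b"
    obtain B where B: "B > 0" "\<And>x. cmod (f x) \<le> B" using test_function_bounded[OF f] by blast
    obtain r where r: "r > 0" "\<And>x. f x \<noteq> 0 \<Longrightarrow> norm x \<le> r" using test_function_support[OF f] by blast
    \<comment> \<open>A convergent sequence of shifts is bounded, so all translates live in one ball
      and share a majorant.\<close>
    obtain s where s: "\<And>n. norm (a n) \<le> s"
      using convergent_imp_bounded[OF a] by (auto simp: bounded_iff)
    note sq = square_integrable_translate[OF test_function_square_integrable[OF f]]
    have "(\<lambda>n. abs_l2 (\<lambda>x. f (x - a n))) \<longlonglongrightarrow> abs_l2 (\<lambda>x. f (x - b))"
    proof (rule l2_dominated_convergence(3)[where g = "\<lambda>x. B * indicator (cball 0 (r + s)) x"])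
      show "integrable lborel (\<lambda>x :: R3. (B * indicator (cball 0 (r + s)) x)\<^sup>2)"
      proof -
        have "(\<lambda>x :: R3. (B * indicator (cball 0 (r + s)) x)\<^sup>2)
            = (\<lambda>x. B\<^sup>2 * indicator (cball 0 (r + s)) x)"
          by (auto simp: indicator_def)
        then show ?thesis using integrable_indicator_cball[of "B\<^sup>2" "r + s"] by simp
      qed
      show "cmod (f (x - a n)) \<le> B * indicator (cball 0 (r + s)) x" for n x
      proof (cases "f (x - a n) = 0")
        case False
        then have "norm x \<le> r + s"
          using r(2)[OF False] s[of n] norm_triangle_sub[of x "a n"] by linarith
        then show ?thesis using B by simp
      qed (use B in simp)
      show "AE x in lborel. (\<lambda>n. f (x - a n)) \<longlonglongrightarrow> f (x - b)"
      proof (rule AE_I2)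
        fix x
        have "isCont f (x - b)"
          using smooth_continuous_on[OF test_function_smooth[OF f], of UNIV]
          by (simp add: continuous_on_eq_continuous_at)
        then show "(\<lambda>n. f (x - a n)) \<longlonglongrightarrow> f (x - b)"
          by (rule isCont_tendsto_compose) (intro tendsto_intros a)
      qed
    qed (use sq in \<open>auto simp: square_integrable_def\<close>)
    then show "((\<lambda>a. shift a (abs_l2 f)) \<circ> a) \<longlonglongrightarrow> shift b (abs_l2 f)"
      by (simp add: o_def shift_abs_l2 test_function_square_integrable[OF f])
  qed
  obtain f where f: "\<And>n :: nat. test_function (f n)" "(\<lambda>n. abs_l2 (f n)) \<longlonglongrightarrow> u"
    using test_l2_approx[of u] by blast
  show ?thesis
  proof (rule uniform_limit_theorem[where F = sequentially and f = "\<lambda>n a. shift a (abs_l2 (f n))"])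
    show "\<forall>\<^sub>F n in sequentially. continuous_on UNIV (\<lambda>a. shift a (abs_l2 (f n)))"
      using test f by simp
    show "uniform_limit UNIV (\<lambda>n a. shift a (abs_l2 (f n))) (\<lambda>a. shift a u) sequentially"
      using f(2) unfolding uniform_limit_iff tendsto_iff by (simp add: dist_norm shift_diff[symmetric])
  qed simp
qed

text \<open>The set where they differ is open and null, hence empty. This makes point values of
  classes single-valued.\<close>

lemma continuous_AE_eq:
  fixes f g :: "R3 \<Rightarrow> complex"
  assumes "continuous_on UNIV f" "continuous_on UNIV g" "AE x in lborel. f x = g x"
  shows "f = g"
proof (rule ccontr)
  assume "f \<noteq> g"
  then have ne: "{x. f x \<noteq> g x} \<noteq> {}" by auto
  have op: "open {x. f x \<noteq> g x}" by (intro open_Collect_neq assms)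
  then have "{x. f x \<noteq> g x} \<in> sets lborel" by simp
  then have "{x. f x \<noteq> g x} \<in> null_sets lborel"
    using assms(3) AE_iff_null[of lborel "\<lambda>x. f x = g x"] by simp
  then have "negligible {x. f x \<noteq> g x}"
    by (simp add: negligible_iff_null_sets null_sets_completionI)
  with op ne show False using open_not_negligible by blast
qed

lemma has_value_at_unique:
  assumes "has_value_at w x c" "has_value_at w x d" shows "c = d"
proof -
  obtain h where h: "square_integrable h" "w = abs_l2 h" by (rule abs_l2_cases)
  obtain f g where f: "continuous_on UNIV f" "AE y in lborel. h y = f y" "f x = c"
    and g: "continuous_on UNIV g" "AE y in lborel. h y = g y" "g x = d"
    using assms h by (auto simp: has_value_at.abs_eq[OF l2_rel_refl])
  have "AE y in lborel. f y = g y" using f(2) g(2) by eventually_elim simp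
  with f g continuous_AE_eq show ?thesis by blast
qed

lemma has_value_at_abs_l2:
  "square_integrable f \<Longrightarrow> continuous_on UNIV f \<Longrightarrow> has_value_at (abs_l2 f) x (f x)"
  by (auto simp: has_value_at.abs_eq[OF l2_rel_refl])

lemma has_value_at_add:
  assumes "has_value_at u x c" "has_value_at v x d" shows "has_value_at (u + v) x (c + d)"
proof -
  obtain h k where h: "square_integrable h" "u = abs_l2 h" and k: "square_integrable k" "v = abs_l2 k"
    by (metis abs_l2_cases)
  obtain f g where f: "continuous_on UNIV f" "AE y in lborel. h y = f y" "f x = c"
    and g: "continuous_on UNIV g" "AE y in lborel. k y = g y" "g x = d"
    using assms h k by (auto simp: has_value_at.abs_eq[OF l2_rel_refl])
  have "AE y in lborel. h y + k y = f y + g y" using f(2) g(2) by eventually_elim simp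
  then show ?thesis
    using h k f g by (auto simp: abs_l2_add has_value_at.abs_eq[OF l2_rel_refl] square_integrable_add
        intro!: exI[of _ "\<lambda>x. f x + g x"] continuous_intros)
qed

lemma has_value_at_scaleC:
  assumes "has_value_at u x c" shows "has_value_at (a *\<^sub>C u) x (a * c)"
proof -
  obtain h where h: "square_integrable h" "u = abs_l2 h" by (rule abs_l2_cases)
  obtain f where f: "continuous_on UNIV f" "AE y in lborel. h y = f y" "f x = c"
    using assms h by (auto simp: has_value_at.abs_eq[OF l2_rel_refl])
  have "AE y in lborel. a * h y = a * f y" using f(2) by eventually_elim simp
  then show ?thesis
    using h f by (auto simp: abs_l2_scaleC has_value_at.abs_eq[OF l2_rel_refl] square_integrable_mult
        simp del: mult_cancel_left intro!: exI[of _ "\<lambda>x. a * f x"] continuous_intros)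
qed


section \<open>Integrability of the Yukawa kernel\<close>

text \<open>
  As \<open>|x| \<ge> |x\<^sub>i|\<close> for each \<open>i\<close>, a radial function that is \<open>O(|x|\<^sup>-\<^sup>2)\<close> at \<open>0\<close> and \<open>O(|x|\<^sup>-\<^sup>5)\<close> at
  infinity is dominated by a product of three one-dimensional integrable functions.
\<close>

definition powbound :: "real \<Rightarrow> real" where
  "powbound t = (if t = 0 then 0 else if \<bar>t\<bar> \<le> 1 then \<bar>t\<bar> powr (- 2 / 3) else \<bar>t\<bar> powr (- 5 / 3))"

lemma powbound_measurable [measurable]: "powbound \<in> borel_measurable borel"
  unfolding powbound_def by measurable

lemma powbound_nonneg: "powbound t \<ge> 0"
  by (simp add: powbound_def)

lemma integrable_on_powr_lborel:
  assumes "(\<lambda>x :: real. x powr a) integrable_on S" "S \<in> sets borel"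
  shows "integrable lborel (\<lambda>x. indicator S x * x powr a)"
proof -
  have "(\<lambda>x. x powr a) absolutely_integrable_on S"
    by (rule nonnegative_absolutely_integrable_1[OF assms(1)]) simp
  then have "integrable lebesgue (\<lambda>x. indicator S x * x powr a)"
    by (simp add: set_integrable_def)
  then show ?thesis using assms(2) by (subst (asm) integrable_completion) auto
qed

text \<open>The two exponents lie on either side of \<open>- 1\<close>: \<open>- 2 / 3\<close> is
  integrable at 0 and \<open>- 5 / 3\<close> at infinity. Over three coordinates they multiply up to
  \<open>- 2\<close> and \<open>- 5\<close>.\<close>

lemma integrable_powbound: "integrable lborel powbound"
proof -
  define F where "F t = indicator {0..1} t * t powr (- 2 / 3) + indicator {1..} t * t powr (- 5 / 3)" for t :: real
  have F: "integrable lborel F"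
    unfolding F_def
    by (intro Bochner_Integration.integrable_add integrable_on_powr_lborel)
      (use has_integral_powr_from_0[of "- 2 / 3" 1] has_integral_powr_to_inf[of "- 5 / 3" 1] in
        \<open>auto simp: integrable_on_def\<close>)
  have F': "integrable lborel (\<lambda>t. F (0 + (- 1) * t))"
    by (rule lborel_integrable_real_affine[OF F]) simp
  show ?thesis
  proof (rule Bochner_Integration.integrable_bound)
    show "integrable lborel (\<lambda>t. F t + F (0 + (- 1) * t))" using F F' by simp
    have F0: "F t \<ge> 0" for t by (simp add: F_def)
    have "powbound t \<le> F t + F (- t)" for t
      using F0[of t] F0[of "- t"] by (auto simp: powbound_def F_def indicator_def abs_if)
    then show "AE t in lborel. norm (powbound t) \<le> norm (F t + F (0 + (- 1) * t))"
      using F0 powbound_nonneg by (intro AE_I2) simp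
  qed simp
qed

lemma Basis_R3: "(Basis :: R3 set) = range (\<lambda>i. axis i 1)"
  by (auto simp: Basis_vec_def)

lemma integrable_prod_cart:
  fixes f :: "real \<Rightarrow> real"
  assumes f: "integrable lborel f" and nn: "\<And>t. f t \<ge> 0"
  shows "integrable lborel (\<lambda>x :: R3. \<Prod>i\<in>UNIV. f (x $ i))"
proof (rule integrableI_nonneg)
  have [measurable]: "f \<in> borel_measurable borel" using f by auto
  show "(\<lambda>x :: R3. \<Prod>i\<in>UNIV. f (x $ i)) \<in> borel_measurable lborel" by simp
  show "AE x :: R3 in lborel. 0 \<le> (\<Prod>i\<in>UNIV. f (x $ i))" using nn by (auto intro: prod_nonneg)
  have "(\<integral>\<^sup>+x. ennreal (\<Prod>i\<in>UNIV. f (x $ i)) \<partial>(lborel :: R3 measure))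
      = (\<integral>\<^sup>+x. (\<Prod>b\<in>Basis. ennreal (f (x \<bullet> b))) \<partial>(lborel :: R3 measure))"
    unfolding Basis_R3
    by (subst prod.reindex) (auto simp: inj_on_def axis_eq_axis inner_axis prod_ennreal nn)
  also have "\<dots> = (\<Prod>b\<in>(Basis :: R3 set). (\<integral>\<^sup>+t. ennreal (f t) \<partial>lborel))"
    by (rule nn_integral_lborel_prod) auto
  also have "\<dots> < \<infinity>"
    using f nn by (simp add: nn_integral_eq_integral ennreal_power ennreal_less_top)
  finally show "(\<integral>\<^sup>+x. ennreal (\<Prod>i\<in>UNIV. f (x $ i)) \<partial>(lborel :: R3 measure)) < \<infinity>" .
qed

text \<open>\<open>powbound\<close> is unbounded near 0 but has the value 0 there, so the
  comparisons below hold only off the coordinate planes.\<close>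

lemma AE_component_neq: "AE x :: R3 in lborel. x $ i \<noteq> 0"
proof -
  have "negligible {x :: R3. x $ i = 0}" by (rule negligible_standard_hyperplane_cart)
  then have "{x :: R3. x $ i = 0} \<in> null_sets lborel"
    by (simp add: negligible_iff_null_sets null_sets_completion_iff)
  then show ?thesis using AE_iff_null[of lborel "\<lambda>x :: R3. x $ i \<noteq> 0"] by simp
qed

lemma AE_components_neq: "AE x :: R3 in lborel. \<forall>i. x $ i \<noteq> 0"
  using AE_component_neq by (simp add: AE_all_countable)

lemma integrable_exp_norm_sq:
  assumes c: "c > 0"
  shows "integrable lborel (\<lambda>x :: R3. exp (- (c * norm x)) / (norm x)\<^sup>2)"
proof (rule Bochner_Integration.integrable_bound)
  \<comment> \<open>Large enough for both cases below: 1 covers small coordinates,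
    \<open>3 / c\<close> large ones.\<close>
  let ?K = "1 + 3 / c"
  show "integrable lborel (\<lambda>x :: R3. ?K ^ 3 * (\<Prod>i\<in>UNIV. powbound (x $ i)))"
    by (intro integrable_mult_right integrable_prod_cart integrable_powbound powbound_nonneg)
  show "AE x :: R3 in lborel. norm (exp (- (c * norm x)) / (norm x)\<^sup>2)
      \<le> norm (?K ^ 3 * (\<Prod>i\<in>UNIV. powbound (x $ i)))"
    using AE_components_neq
  proof eventually_elim
    case (elim x)
    define N where "N = norm x"
    have N: "N > 0" using elim by (auto simp: N_def)
    have xN: "\<bar>x $ i\<bar> \<le> N" for i unfolding N_def by (rule component_le_norm_cart)
    \<comment> \<open>Each coordinate receives a third of the exponent and of the power. Both
      factors decrease, so \<open>N\<close> may be replaced by the smaller \<open>t\<close>.\<close>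
    have one: "exp (- (c / 3 * N)) * N powr (- 2 / 3) \<le> ?K * powbound (x $ i)" for i
    proof -
      define t where "t = \<bar>x $ i\<bar>"
      have t: "t > 0" "t \<le> N" using elim xN[of i] by (auto simp: t_def)
      have "exp (- (c / 3 * N)) * N powr (- 2 / 3) \<le> exp (- (c / 3 * t)) * t powr (- 2 / 3)"
        using t c powr_mono2'[of "- 2 / 3" t N] by (intro mult_mono) simp_all
      also have "\<dots> \<le> ?K * powbound (x $ i)"
      proof (cases "t \<le> 1")
        case True
        have "exp (- (c / 3 * t)) * t powr (- 2 / 3) \<le> ?K * t powr (- 2 / 3)"
        proof (rule mult_right_mono)
          have "exp (- (c / 3 * t)) \<le> 1" "1 \<le> ?K" using t c by simp_all
          then show "exp (- (c / 3 * t)) \<le> ?K" by linarith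
        qed simp
        then show ?thesis using True t by (simp add: powbound_def t_def)
      next
        case False
        \<comment> \<open>Beyond 1 the exponential pays for one more power of \<open>t\<close>,
          which turns the exponent \<open>- 2 / 3\<close> into \<open>- 5 / 3\<close>.\<close>
        have "c / 3 * t \<le> exp (c / 3 * t)" using exp_ge_add_one_self[of "c / 3 * t"] by linarith
        then have "t * exp (- (c / 3 * t)) \<le> 3 / c"
          using c by (simp add: exp_minus field_simps)
        also have "\<dots> \<le> ?K" by simp
        finally have "t * exp (- (c / 3 * t)) * t powr (- 5 / 3) \<le> ?K * t powr (- 5 / 3)"
          by (intro mult_right_mono) auto
        moreover have "t * exp (- (c / 3 * t)) * t powr (- 5 / 3) = exp (- (c / 3 * t)) * (t * t powr (- 5 / 3))"
          by (simp only: mult_ac)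
        moreover have "t * t powr (- 5 / 3) = t powr (- 2 / 3)"
          using t by (simp add: powr_mult_base)
        ultimately have "exp (- (c / 3 * t)) * t powr (- 2 / 3) \<le> ?K * t powr (- 5 / 3)" by (simp only:)
        then show ?thesis using False t by (simp add: powbound_def t_def)
      qed
      finally show ?thesis .
    qed
    have "(N powr (- 2 / 3)) ^ 3 = N powr (- 2)" by (subst powr_power) (use N in auto)
    also have "\<dots> = 1 / N\<^sup>2" by (subst powr_minus_divide) (use N in simp)
    finally have "exp (- (c * N)) / N\<^sup>2 = (\<Prod>i\<in>(UNIV :: 3 set). exp (- (c / 3 * N)) * N powr (- 2 / 3))"
      by (simp add: power_mult_distrib exp_of_nat_mult[symmetric] del: exp_of_nat_mult)
    also have "\<dots> \<le> (\<Prod>i\<in>UNIV. ?K * powbound (x $ i))"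
      by (rule prod_mono) (use one in auto)
    also have "\<dots> = ?K ^ 3 * (\<Prod>i\<in>UNIV. powbound (x $ i))" by (simp add: prod.distrib)
    finally show ?case
      using c by (simp add: N_def prod_nonneg powbound_nonneg)
  qed
qed simp

section \<open>The regularised radius and the Yukawa kernel\<close>

definition rho :: "real \<Rightarrow> R3 \<Rightarrow> real" where "rho e x = sqrt ((norm x)\<^sup>2 + e\<^sup>2)"

lemma rho_pos: "e > 0 \<Longrightarrow> rho e x > 0"
  by (simp add: rho_def add_nonneg_pos)

lemma rho_ge: "norm x \<le> rho e x" "e > 0 \<Longrightarrow> e \<le> rho e x"
  by (auto simp: rho_def intro: real_le_rsqrt)

lemma rho_sq: "(rho e x)\<^sup>2 = (norm x)\<^sup>2 + e\<^sup>2"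
  by (simp add: rho_def)

lemma rho_scale: "e > 0 \<Longrightarrow> rho e (e *\<^sub>R x) = e * rho 1 x"
proof -
  assume "e > 0"
  then have "rho e (e *\<^sub>R x) = sqrt (e\<^sup>2 * ((norm x)\<^sup>2 + 1\<^sup>2))"
    unfolding rho_def by (simp add: power_mult_distrib distrib_left)
  also have "\<dots> = e * rho 1 x" using \<open>e > 0\<close> by (simp add: rho_def real_sqrt_mult)
  finally show ?thesis .
qed

lemma integrable_rho_5: "integrable lborel (\<lambda>x. 1 / rho 1 x ^ 5)"
proof (rule Bochner_Integration.integrable_bound)
  show "integrable lborel (\<lambda>x :: R3. \<Prod>i\<in>UNIV. powbound (x $ i))"
    by (intro integrable_prod_cart integrable_powbound powbound_nonneg)
  show "(\<lambda>x. 1 / rho 1 x ^ 5) \<in> borel_measurable lborel"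
    unfolding rho_def by measurable
  show "AE x :: R3 in lborel. norm (1 / rho 1 x ^ 5) \<le> norm (\<Prod>i\<in>UNIV. powbound (x $ i))"
    using AE_components_neq
  proof eventually_elim
    case (elim x)
    define N where "N = rho 1 x"
    have N: "N \<ge> 1" "N > 0" using rho_ge(2)[of 1 x] rho_pos[of 1 x] by (auto simp: N_def)
    have xN: "\<bar>x $ i\<bar> \<le> N" for i
      unfolding N_def using component_le_norm_cart[of x i] rho_ge(1)[of x 1] by linarith
    have one: "N powr (- 5 / 3) \<le> powbound (x $ i)" for i
    proof (cases "\<bar>x $ i\<bar> \<le> 1")
      case True
      have "N powr (- 5 / 3) \<le> 1 powr (- 5 / 3)" using N by (intro powr_mono2') auto
      also have "\<dots> = 1 powr (- 2 / 3)" by simp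
      also have "\<dots> \<le> \<bar>x $ i\<bar> powr (- 2 / 3)"
        using True elim by (intro powr_mono2') auto
      finally show ?thesis using True elim by (simp add: powbound_def)
    next
      case False
      then have "N powr (- 5 / 3) \<le> \<bar>x $ i\<bar> powr (- 5 / 3)" using xN[of i] by (intro powr_mono2') auto
      then show ?thesis using False by (auto simp: powbound_def)
    qed
    have "(N powr (- 5 / 3)) ^ 3 = N powr (- 5)" by (subst powr_power) (use N in auto)
    also have "\<dots> = 1 / N ^ 5" using powr_realpow[OF N(2), of 5] by (simp add: powr_minus_divide)
    finally have "1 / N ^ 5 = (\<Prod>i\<in>(UNIV :: 3 set). N powr (- 5 / 3))" by simp
    also have "\<dots> \<le> (\<Prod>i\<in>UNIV. powbound (x $ i))"
      by (rule prod_mono) (use one in auto)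
    finally show ?case
      using N by (simp add: N_def prod_nonneg powbound_nonneg)
  qed
qed

text \<open>At the origin \<^term>\<open>kern k\<close> has the junk value \<open>0\<close>, hence the exclusion of null sets below.\<close>

definition kern :: "complex \<Rightarrow> R3 \<Rightarrow> complex" where
  "kern k x = exp (- (k * of_real (norm x))) / of_real (norm x)"

lemma kern_measurable [measurable]: "kern k \<in> borel_measurable borel"
  unfolding kern_def by measurable

lemma cmod_kern: "cmod (kern k x) = exp (- (Re k * norm x)) / norm x"
  by (simp add: kern_def norm_divide)

lemma kern_uminus [simp]: "kern k (- x) = kern k x"
  by (simp add: kern_def)

lemma kern_square_integrable: "Re k > 0 \<Longrightarrow> square_integrable (kern k)"
  using integrable_exp_norm_sq[of "2 * Re k"]
  by (simp add: square_integrable_def cmod_kern power_divide power2_eq_square exp_add[symmetric] mult_ac)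

text \<open>Half of the exponential decay is spent on trading \<open>1 / norm x\<close> for the
  square of it, whose integrability is known.\<close>

lemma kern_integrable:
  assumes k: "Re k > 0" shows "integrable lborel (kern k)"
proof (rule Bochner_Integration.integrable_bound)
  let ?c = "Re k / 2"
  show "integrable lborel (\<lambda>x :: R3. (1 / ?c) * (exp (- (?c * norm x)) / (norm x)\<^sup>2))"
    using k by (intro integrable_mult_right integrable_exp_norm_sq) simp
  show "AE x :: R3 in lborel. norm (kern k x) \<le> norm ((1 / ?c) * (exp (- (?c * norm x)) / (norm x)\<^sup>2))"
    using AE_lborel_singleton[of "0 :: R3"]
  proof eventually_elim
    case (elim x)
    define N where "N = norm x"
    have N: "N > 0" using elim by (simp add: N_def)
    have "?c * N \<le> exp (?c * N)" using exp_ge_add_one_self[of "?c * N"] by linarith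
    then have "exp (- (?c * N)) \<le> 1 / (?c * N)" using k N by (simp add: exp_minus field_simps)
    then have "exp (- (?c * N)) * (exp (- (?c * N)) / N) \<le> 1 / (?c * N) * (exp (- (?c * N)) / N)"
      using N by (intro mult_right_mono) auto
    moreover have "exp (- (?c * N)) * exp (- (?c * N)) = exp (- (Re k * N))"
      by (simp add: exp_add[symmetric])
    ultimately show ?case
      using k N by (simp add: cmod_kern N_def[symmetric] power2_eq_square)
  qed
qed simp

lemma green_eq_kern: "green lam = kern (of_real (sqrt lam))"
  by (auto simp: green_def kern_def fun_eq_iff exp_of_real[symmetric])


section \<open>The fundamental solution\<close>

definition lap :: "(R3 \<Rightarrow> complex) \<Rightarrow> R3 \<Rightarrow> complex" where
  "lap f x = (\<Sum>i\<in>UNIV. pd i (pd i f) x)"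

lemma test_function_lap: "test_function f \<Longrightarrow> test_function (lap f)"
  unfolding lap_def[abs_def] by (intro test_function_sum test_function_partial)

lemma smooth_lap: "smooth f \<Longrightarrow> smooth (lap f)"
  unfolding lap_def[abs_def] by (intro smooth_sum smooth_partial)

lemma pd_mult: "smooth f \<Longrightarrow> smooth g \<Longrightarrow> pd i (\<lambda>x. f x * g x)
    = (\<lambda>x. pd i f x * g x + f x * pd i g x)"
  by (rule ext) (simp add: partial_deriv_mult smooth_differentiable)

lemma pd_add: "smooth f \<Longrightarrow> smooth g \<Longrightarrow> pd i (\<lambda>x. f x + g x)
    = (\<lambda>x. pd i f x + pd i g x)"
  by (rule ext) (simp add: partial_deriv_add smooth_differentiable)

lemma pd_cmult: "smooth f \<Longrightarrow> pd i (\<lambda>x. c * f x) = (\<lambda>x. c * pd i f x)"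
  by (rule ext) (simp add: partial_deriv_cmult smooth_differentiable)

lemma integral_by_parts_test:
  assumes u: "smooth u" and f: "test_function f"
  shows "(LINT x|lborel. pd i u x * f x) = - (LINT x|lborel. u x * pd i f x)"
proof -
  have "(LINT x|lborel. pd i (\<lambda>x. u x * f x) x) = 0"
    by (rule integral_partial_test_function[OF test_function_mult_left[OF f u]])
  moreover have "integrable lborel (\<lambda>x. pd i u x * f x)"
    "integrable lborel (\<lambda>x. u x * pd i f x)"
    by (intro test_function_integrable test_function_mult_left f u smooth_partial test_function_partial)+
  ultimately show ?thesis
    by (simp add: pd_mult u test_function_smooth[OF f] add_eq_0_iff2)
qed

lemma integral_lap_test:
  assumes u: "smooth u" and f: "test_function f"
  shows "(LINT x|lborel. lap u x * f x) = (LINT x|lborel. u x * lap f x)"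
proof -
  have i: "integrable lborel (\<lambda>x. pd i (pd i u) x * f x)"
    "integrable lborel (\<lambda>x. u x * pd i (pd i f) x)" for i
    by (intro test_function_integrable test_function_mult_left f u smooth_partial test_function_partial)+
  show ?thesis
    unfolding lap_def sum_distrib_left sum_distrib_right
    using u f i by (simp add: integral_by_parts_test smooth_partial test_function_partial)
qed

text \<open>
  Replacing \<open>|x|\<close> by \<open>\<rho> = (|x|\<^sup>2 + e\<^sup>2)\<^sup>1\<^sup>/\<^sup>2\<close> makes the kernel smooth; the right hand side of \<open>lap_rkern\<close>
  concentrates at the origin as \<open>e \<rightarrow> 0\<close>, its leading part being the rescaling of \<open>3 / (1 + |y|\<^sup>2)\<^sup>5\<^sup>/\<^sup>2\<close>.
\<close>

definition rkern :: "complex \<Rightarrow> real \<Rightarrow> R3 \<Rightarrow> complex" where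
  "rkern k e x = exp (- (k * of_real (rho e x))) / of_real (rho e x)"

context
  fixes k :: complex and e :: real
  assumes e: "e > 0"
begin

text \<open>Coordinates, the reciprocal radius and the exponential generate an algebra closed under
  differentiation, so smoothness is automatic and the Laplacian becomes a polynomial
  computation.\<close>

private definition X :: "3 \<Rightarrow> R3 \<Rightarrow> complex" where "X i x = of_real (x $ i)"
private definition J :: "R3 \<Rightarrow> complex" where "J x = of_real (1 / rho e x)"
private definition EE :: "R3 \<Rightarrow> complex" where "EE x = exp (- (k * of_real (rho e x)))"

private lemma rho_deriv: "(rho e has_derivative (\<lambda>h. (x \<bullet> h) / rho e x)) (at x)"
proof -
  have "0 < x \<bullet> x + e\<^sup>2" using e by (simp add: add_nonneg_pos)
  then have "((\<lambda>x. sqrt (x \<bullet> x + e\<^sup>2)) has_derivative (\<lambda>h. (x \<bullet> h) / rho e x)) (at x)"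
    by (auto intro!: derivative_eq_intros simp: rho_def power2_norm_eq_inner inner_commute field_simps)
  then show ?thesis by (simp add: rho_def[abs_def] power2_norm_eq_inner)
qed

private lemma X_deriv: "(X i has_derivative (\<lambda>h. of_real (h $ i))) (at x)"
  unfolding X_def[abs_def]
  by (intro has_derivative_of_real bounded_linear.has_derivative[OF bounded_linear_vec_nth] has_derivative_ident)

private lemma J_deriv: "(J has_derivative (\<lambda>h. - (of_real (x \<bullet> h) * J x ^ 3))) (at x)"
proof -
  have "((\<lambda>x. 1 / rho e x) has_derivative (\<lambda>h. - ((x \<bullet> h) / rho e x ^ 3))) (at x)"
    using rho_pos[OF e, of x]
    by (auto intro!: derivative_eq_intros rho_deriv simp: field_simps power3_eq_cube)
  from has_derivative_of_real[OF this, where 'a = complex]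
  show ?thesis by (simp add: J_def[abs_def] power_divide)
qed

private lemma Ex_deriv: "(EE has_derivative (\<lambda>h. - (k * of_real (x \<bullet> h) * J x * EE x))) (at x)"
proof -
  have "((\<lambda>x. complex_of_real (rho e x)) has_derivative (\<lambda>h. of_real ((x \<bullet> h) / rho e x))) (at x)"
    by (rule has_derivative_of_real[OF rho_deriv])
  then have "((\<lambda>x. - (k * of_real (rho e x))) has_derivative (\<lambda>h. - (k * of_real ((x \<bullet> h) / rho e x)))) (at x)"
    by (intro has_derivative_minus has_derivative_mult_right)
  from has_derivative_compose[OF this DERIV_exp[unfolded has_field_derivative_def]]
  show ?thesis by (simp add: EE_def[abs_def] J_def mult_ac)
qed

private lemma pd_X: "pd j (X i) = (\<lambda>x. if i = j then 1 else 0)"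
  by (rule ext, subst partial_deriv_eq[OF X_deriv]) (simp add: axis_def)

private lemma pd_J: "pd j J = (\<lambda>x. - 1 * (X j x * (J x * (J x * J x))))"
  by (rule ext, subst partial_deriv_eq[OF J_deriv]) (simp add: inner_axis X_def power3_eq_cube)

private lemma pd_Ex: "pd j EE = (\<lambda>x. - k * (X j x * (J x * EE x)))"
  by (rule ext, subst partial_deriv_eq[OF Ex_deriv]) (simp add: inner_axis X_def mult_ac)

private lemma smooth_XJE:
  assumes "f \<in> insert J (insert EE (range X))" shows "smooth f"
proof (rule smooth_alg[where G = "insert J (insert EE (range X))"])
  let ?G = "insert J (insert EE (range X))"
  show "g differentiable (at x)" if "g \<in> ?G" for g x
    using that differentiableI[OF X_deriv] differentiableI[OF J_deriv] differentiableI[OF Ex_deriv] by auto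
  show "pd i g \<in> alg ?G" if "g \<in> ?G" for g i
    using that
  proof (elim insertE imageE)
    assume "g = J"
    then show ?thesis by (simp only: pd_J) (intro alg.mult alg.const; rule alg.gen; blast)
  next
    assume "g = EE"
    then show ?thesis by (simp only: pd_Ex) (intro alg.mult alg.const; rule alg.gen; blast)
  next
    fix j assume "g = X j"
    then show ?thesis by (simp only: pd_X) (rule alg.const)
  qed
  show "f \<in> alg ?G" using assms by (rule alg.gen)
qed

private lemma smooth_X: "smooth (X i)" and smooth_J: "smooth J" and smooth_E: "smooth EE"
  by (rule smooth_XJE; simp)+

lemmas generator_smooth = smooth_X smooth_J smooth_E smooth_mult smooth_add smooth_const

private lemma rkern_eq: "(rkern k e) = (\<lambda>x. EE x * J x)"
  by (simp add: rkern_def[abs_def] EE_def J_def)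

lemma smooth_rkern: "smooth (rkern k e)"
  unfolding rkern_eq by (intro generator_smooth)

lemma lap_rkern:
  "k\<^sup>2 * (rkern k e) x - lap (rkern k e) x = of_real (e\<^sup>2) * exp (- (k * of_real (rho e x))) *
     (k\<^sup>2 / of_real (rho e x) ^ 3 + 3 * k / of_real (rho e x) ^ 4 + 3 / of_real (rho e x) ^ 5)"
proof -
  have p1: "pd i (rkern k e) = (\<lambda>x. - 1 * (X i x * (EE x * (k * (J x * J x) + J x * (J x * J x)))))" for i
    unfolding rkern_eq
    by (simp only: pd_mult pd_Ex pd_J generator_smooth) (simp add: algebra_simps)
  have p2: "pd i (pd i (rkern k e)) x
      = - (EE x * (k * J x ^ 2 + J x ^ 3)) + X i x ^ 2 * (EE x * (k\<^sup>2 * J x ^ 3 + 3 * k * J x ^ 4 + 3 * J x ^ 5))" for i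
    unfolding p1
    by (simp only: pd_mult pd_add pd_X pd_Ex pd_J generator_smooth partial_deriv_const if_True)
      (simp add: algebra_simps power2_eq_square power3_eq_cube power4_eq_xxxx eval_nat_numeral)
  define r where "r = complex_of_real (rho e x)"
  have r: "r \<noteq> 0" using rho_pos[OF e, of x] by (simp add: r_def)
  have J: "J x = 1 / r" by (simp add: J_def r_def)
  \<comment> \<open>Writing |x|^2 as r^2 - e^2 makes the terms without the factor e^2 collapse to
    k^2 times the kernel; only the e^2 part survives in the difference.\<close>
  have "(\<Sum>i\<in>UNIV. X i x ^ 2) = of_real ((norm x)\<^sup>2)"
    unfolding X_def power2_norm_eq_inner inner_vec_def by (simp add: power2_eq_square)
  also have "\<dots> = r\<^sup>2 - of_real (e\<^sup>2)"
    using rho_sq[of e x] by (simp add: r_def flip: of_real_power of_real_diff)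
  finally have sX: "(\<Sum>i\<in>UNIV. X i x ^ 2) = r\<^sup>2 - of_real (e\<^sup>2)" .
  have "lap (rkern k e) x = - 3 * (EE x * (k * J x ^ 2 + J x ^ 3))
      + (r\<^sup>2 - of_real (e\<^sup>2)) * (EE x * (k\<^sup>2 * J x ^ 3 + 3 * k * J x ^ 4 + 3 * J x ^ 5))"
    unfolding lap_def p2 sum.distrib sum_distrib_right[symmetric] sX by simp
  note lap_eq = this
  show ?thesis
    unfolding lap_eq fun_cong[OF rkern_eq] J EE_def r_def[symmetric]
    using r by (simp add: field_simps power2_eq_square power3_eq_cube power4_eq_xxxx eval_nat_numeral)
qed

end

text \<open>Green's identity is applied while the kernel is still smooth, with \<open>f\<close>
  supplying compact support. The singular limit is taken only afterwards, so no boundary terms on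
  small spheres appear.\<close>

lemma rkern_integral:
  assumes e: "e > 0" and f: "test_function f"
  shows "(LINT x|lborel. rkern k e x * (k\<^sup>2 * f x - lap f x)) =
    (LINT x|lborel. of_real (e\<^sup>2) * exp (- (k * of_real (rho e x))) *
     (k\<^sup>2 / of_real (rho e x) ^ 3 + 3 * k / of_real (rho e x) ^ 4 + 3 / of_real (rho e x) ^ 5) * f x)"
proof -
  note s = smooth_rkern[OF e, of k]
  have i: "integrable lborel (\<lambda>x. rkern k e x * (k\<^sup>2 * f x))" "integrable lborel (\<lambda>x. rkern k e x * lap f x)"
    "integrable lborel (\<lambda>x. lap (rkern k e) x * f x)"
    by (intro test_function_integrable test_function_mult_left f s test_function_cmult test_function_lap smooth_lap)+
  have "(LINT x|lborel. rkern k e x * (k\<^sup>2 * f x - lap f x))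
     = (LINT x|lborel. rkern k e x * (k\<^sup>2 * f x)) - (LINT x|lborel. rkern k e x * lap f x)"
    using i by (simp add: right_diff_distrib)
  also have "\<dots> = (LINT x|lborel. rkern k e x * (k\<^sup>2 * f x)) - (LINT x|lborel. lap (rkern k e) x * f x)"
    by (simp only: integral_lap_test[OF s f])
  also have "\<dots> = (LINT x|lborel. (k\<^sup>2 * rkern k e x - lap (rkern k e) x) * f x)"
    using i by (subst Bochner_Integration.integral_diff[symmetric]) (auto simp: algebra_simps)
  finally show ?thesis by (simp only: lap_rkern[OF e])
qed

text \<open>The value is \<open>4\<pi>\<close>, but only positivity matters: the constant cancels.\<close>

definition C0 :: real where "C0 = (LINT x|lborel. 3 / rho 1 x ^ 5)"

lemma C0_pos: "C0 > 0"
proof -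
  have i: "integrable lborel (\<lambda>x. 3 / rho 1 x ^ 5)"
    using integrable_mult_right[OF integrable_rho_5, of 3] by simp
  have pos: "3 / rho 1 x ^ 5 > 0" for x using rho_pos[of 1 x] by simp
  have "C0 \<ge> 0" unfolding C0_def by (rule Bochner_Integration.integral_nonneg) (use pos less_imp_le in blast)
  moreover have "C0 \<noteq> 0"
  proof
    assume "C0 = 0"
    then have "AE x in lborel. 3 / rho 1 x ^ 5 = 0"
      unfolding C0_def using integral_nonneg_eq_0_iff_AE[OF i] pos less_imp_le by (metis (mono_tags, lifting) AE_I2)
    then have "AE x in (lborel :: R3 measure). False"
      by eventually_elim (use pos in \<open>metis less_irrefl\<close>)
    then have "emeasure lborel (UNIV :: R3 set) = 0" by (simp add: AE_iff_null null_sets_def)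
    then show False by simp
  qed
  ultimately show ?thesis by simp
qed

text \<open>Limit of \<open>rkern_integral\<close> as e tends to 0. The right hand side splits into
  \<open>P\<close>, which has an integrable majorant and tends to 0 pointwise, and \<open>Q\<close>,
  which the substitution x = e y turns into an integral with a fixed majorant and limit
  \<open>C0 * f 0\<close>.\<close>

theorem fundamental_solution:
  assumes k: "Re k > 0" and f: "test_function f"
  shows "(LINT x|lborel. kern k x * (k\<^sup>2 * f x - lap f x)) = of_real C0 * f 0"
proof -
  define e where "e n = inverse (real (Suc n))" for n
  have e: "e n > 0" for n by (simp add: e_def)
  have e0: "e \<longlonglongrightarrow> 0" unfolding e_def by (rule LIMSEQ_inverse_real_of_nat)
  define g where "g x = k\<^sup>2 * f x - lap f x" for x
  have g: "test_function g"
    unfolding g_def[abs_def] by (intro test_function_diff test_function_cmult test_function_lap f)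
  have fm [measurable]: "f \<in> borel_measurable borel" and gm [measurable]: "g \<in> borel_measurable borel"
    using f g smooth_measurable test_function_smooth by auto
  have rm [measurable]: "rho a \<in> borel_measurable borel" for a unfolding rho_def by measurable
  have rho_le1: "exp (- (Re k * rho a x)) \<le> 1" if "a > 0" for a x
    using k rho_pos[OF that, of x] by simp
  have rho_lim: "(\<lambda>n. rho (e n) x) \<longlonglongrightarrow> norm x" for x
  proof -
    have "(\<lambda>n. sqrt ((norm x)\<^sup>2 + (e n)\<^sup>2)) \<longlonglongrightarrow> sqrt ((norm x)\<^sup>2 + 0\<^sup>2)"
      by (intro tendsto_intros e0)
    then show ?thesis by (simp add: rho_def)
  qed
  \<comment> \<open>One majorant scheme for both sides. On the support
    \<open>norm x \<le> r\<close>, so \<open>exp r\<close> compensates the decaying exponential of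
    the known integrable function.\<close>
  have dom: "\<exists>w. integrable lborel w \<and> (\<forall>x. x \<noteq> 0 \<longrightarrow> cmod (h x) * (1 / norm x + 1 / (norm x)\<^sup>2) \<le> w x)"
    if h: "test_function h" for h
  proof -
    obtain B where B: "B > 0" "\<And>x. cmod (h x) \<le> B" using test_function_bounded[OF h] by blast
    obtain r where r: "r > 0" "\<And>x. h x \<noteq> 0 \<Longrightarrow> norm x \<le> r" using test_function_support[OF h] by blast
    let ?w = "\<lambda>x :: R3. B * (r + 1) * exp r * (exp (- (1 * norm x)) / (norm x)\<^sup>2)"
    have "integrable lborel ?w" by (intro integrable_mult_right integrable_exp_norm_sq) simp
    moreover have "cmod (h x) * (1 / norm x + 1 / (norm x)\<^sup>2) \<le> ?w x" if "x \<noteq> 0" for x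
    proof (cases "h x = 0")
      case False
      have x: "norm x > 0" "norm x \<le> r" using that r(2)[OF False] by auto
      have "cmod (h x) * (1 / norm x + 1 / (norm x)\<^sup>2) = cmod (h x) * (norm x + 1) * (1 / (norm x)\<^sup>2)"
        using x by (simp add: field_simps power2_eq_square)
      also have "\<dots> \<le> (B * (r + 1)) * (exp r * exp (- norm x) / (norm x)\<^sup>2)"
        using B x r by (intro mult_mono divide_right_mono) (auto simp flip: exp_add)
      finally show ?thesis by (simp add: mult_ac)
    qed (use B r in simp)
    ultimately show ?thesis by blast
  qed
  have L: "(\<lambda>n. LINT x|lborel. rkern k (e n) x * g x) \<longlonglongrightarrow> (LINT x|lborel. kern k x * g x)"
  proof -
    obtain w where w: "integrable lborel w"
      "\<And>x. x \<noteq> 0 \<Longrightarrow> cmod (g x) * (1 / norm x + 1 / (norm x)\<^sup>2) \<le> w x"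
      using dom[OF g] by blast
    show ?thesis
    proof (rule integral_dominated_convergence[where w = w])
      show "AE x in lborel. (\<lambda>n. rkern k (e n) x * g x) \<longlonglongrightarrow> kern k x * g x"
        using AE_lborel_singleton[of "0 :: R3"]
      proof eventually_elim
        case (elim x)
        then show ?case
          unfolding rkern_def kern_def by (intro tendsto_intros rho_lim) simp
      qed
      show "AE x in lborel. norm (rkern k (e n) x * g x) \<le> w x" for n
        using AE_lborel_singleton[of "0 :: R3"]
      proof eventually_elim
        case (elim x)
        have "cmod (rkern k (e n) x) = exp (- (Re k * rho (e n) x)) / rho (e n) x"
          using rho_pos[OF e, of n x] by (simp add: rkern_def norm_divide)
        also have "\<dots> \<le> 1 / norm x"
          using elim rho_le1[OF e, of n x] rho_ge(1)[of x "e n"] by (intro frac_le) auto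
        also have "\<dots> \<le> 1 / norm x + 1 / (norm x)\<^sup>2" by simp
        finally have "cmod (rkern k (e n) x) * cmod (g x) \<le> (1 / norm x + 1 / (norm x)\<^sup>2) * cmod (g x)"
          by (intro mult_right_mono) auto
        with w(2)[OF elim] show ?case by (simp add: norm_mult mult.commute)
      qed
      show "(\<lambda>x. rkern k (e n) x * g x) \<in> borel_measurable lborel" for n
        unfolding rkern_def by simp
    qed (use w in auto)
  qed
  define P where "P n x = of_real ((e n)\<^sup>2) * exp (- (k * of_real (rho (e n) x))) *
     (k\<^sup>2 / of_real (rho (e n) x) ^ 3 + 3 * k / of_real (rho (e n) x) ^ 4) * f x" for n x
  define Q where "Q n x = of_real ((e n)\<^sup>2) * exp (- (k * of_real (rho (e n) x))) *
     (3 / of_real (rho (e n) x) ^ 5) * f x" for n x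
  \<comment> \<open>A factor \<open>1 / ?r^2\<close> is kept aside to absorb \<open>(e n)^2\<close>,
    since \<open>e n \<le> ?r\<close>; the rest is at most of order
    \<open>1 / (norm x)^2\<close>.\<close>
  have Pb: "cmod (P n x) \<le> ((cmod k)\<^sup>2 + 3 * cmod k) * (cmod (f x) * (1 / norm x + 1 / (norm x)\<^sup>2))"
    if x: "x \<noteq> 0" for n x
  proof -
    let ?r = "rho (e n) x"
    have r: "?r > 0" "norm x \<le> ?r" "e n \<le> ?r" "norm x > 0" using rho_pos[OF e] rho_ge e x by auto
    have "cmod (k\<^sup>2 / of_real ?r ^ 3 + 3 * k / of_real ?r ^ 4) \<le> (cmod k)\<^sup>2 / ?r ^ 3 + 3 * cmod k / ?r ^ 4"
      by (rule order_trans[OF norm_triangle_ineq]) (simp add: norm_divide norm_mult norm_power abs_of_pos[OF r(1)])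
    also have "\<dots> = ((cmod k)\<^sup>2 / ?r + 3 * cmod k / ?r ^ 2) / ?r\<^sup>2"
    proof -
      have "A / t ^ 3 + B / t ^ 4 = (A / t + B / t ^ 2) / t\<^sup>2" if "t > 0" for A B t :: real
        using that by (simp add: field_simps power2_eq_square power3_eq_cube power4_eq_xxxx)
      then show ?thesis using r(1) .
    qed
    also have "\<dots> \<le> ((cmod k)\<^sup>2 / norm x + 3 * cmod k / (norm x) ^ 2) / ?r\<^sup>2"
      using r x by (intro divide_right_mono add_mono frac_le power_mono) auto
    also have "\<dots> \<le> (((cmod k)\<^sup>2 + 3 * cmod k) * (1 / norm x + 1 / (norm x)\<^sup>2)) / ?r\<^sup>2"
      using r by (intro divide_right_mono) (auto simp: algebra_simps)
    finally have 1: "cmod (k\<^sup>2 / of_real ?r ^ 3 + 3 * k / of_real ?r ^ 4)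
       \<le> (((cmod k)\<^sup>2 + 3 * cmod k) * (1 / norm x + 1 / (norm x)\<^sup>2)) / ?r\<^sup>2" .
    have er: "(e n)\<^sup>2 / ?r\<^sup>2 \<le> 1" using r e[of n] by (simp add: power_mono)
    have "cmod (P n x) = (e n)\<^sup>2 * exp (- (Re k * ?r)) * cmod (k\<^sup>2 / of_real ?r ^ 3 + 3 * k / of_real ?r ^ 4) * cmod (f x)"
      by (simp add: P_def norm_mult norm_power)
    also have "\<dots> \<le> (e n)\<^sup>2 * 1 * ((((cmod k)\<^sup>2 + 3 * cmod k) * (1 / norm x + 1 / (norm x)\<^sup>2)) / ?r\<^sup>2) * cmod (f x)"
      using 1 rho_le1[OF e, of n x] by (intro mult_right_mono mult_mono) auto
    also have "\<dots> = ((e n)\<^sup>2 / ?r\<^sup>2) * (((cmod k)\<^sup>2 + 3 * cmod k) * (cmod (f x) * (1 / norm x + 1 / (norm x)\<^sup>2)))"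
      by simp
    also have "\<dots> \<le> 1 * (((cmod k)\<^sup>2 + 3 * cmod k) * (cmod (f x) * (1 / norm x + 1 / (norm x)\<^sup>2)))"
      using er by (intro mult_right_mono) auto
    finally show ?thesis by simp
  qed
  obtain w where w: "integrable lborel w"
      "\<And>x. x \<noteq> 0 \<Longrightarrow> cmod (f x) * (1 / norm x + 1 / (norm x)\<^sup>2) \<le> w x"
    using dom[OF f] by blast
  let ?w = "\<lambda>x. ((cmod k)\<^sup>2 + 3 * cmod k) * w x"
  have wi: "integrable lborel ?w" using w by simp
  have Pw: "AE x in lborel. norm (P n x) \<le> ?w x" for n
    using AE_lborel_singleton[of "0 :: R3"]
  proof eventually_elim
    case (elim x)
    show ?case by (rule order_trans[OF Pb[OF elim] mult_left_mono[OF w(2)[OF elim]]]) simp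
  qed
  have Pm: "P n \<in> borel_measurable lborel" for n unfolding P_def by simp
  have Pl: "(\<lambda>n. LINT x|lborel. P n x) \<longlonglongrightarrow> (LINT x|(lborel :: R3 measure). 0)"
  proof (rule integral_dominated_convergence[where w = ?w])
    show "AE x in lborel. (\<lambda>n. P n x) \<longlonglongrightarrow> 0"
      using AE_lborel_singleton[of "0 :: R3"]
    proof eventually_elim
      case (elim x)
      have "(\<lambda>n. P n x) \<longlonglongrightarrow> of_real (0\<^sup>2) * exp (- (k * of_real (norm x))) *
         (k\<^sup>2 / of_real (norm x) ^ 3 + 3 * k / of_real (norm x) ^ 4) * f x"
        unfolding P_def by (intro tendsto_intros rho_lim e0) (use elim in simp_all)
      then show ?case by simp
    qed
  qed (use wi Pw Pm in auto)
  have Pi: "integrable lborel (P n)" for n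
    by (rule Bochner_Integration.integrable_bound[OF wi Pm]) (use Pw[of n] in \<open>eventually_elim; auto\<close>)
  define S where "S n y = f (e n *\<^sub>R y) * exp (- (k * of_real (e n * rho 1 y))) * of_real (3 / rho 1 y ^ 5)" for n y
  obtain B where B: "B > 0" "\<And>x. cmod (f x) \<le> B" using test_function_bounded[OF f] by blast
  have r5: "integrable lborel (\<lambda>y. B * (3 / rho 1 y ^ 5))"
    using integrable_mult_right[OF integrable_rho_5, of "B * 3"] by simp
  have Sb: "cmod (S n y) \<le> B * (3 / rho 1 y ^ 5)" for n y
  proof -
    have "cmod (S n y) = (cmod (f (e n *\<^sub>R y)) * exp (- (Re k * (e n * rho 1 y)))) * (3 / rho 1 y ^ 5)"
      using rho_pos[of 1 y] by (simp add: S_def norm_mult norm_divide norm_power)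
    also have "\<dots> \<le> (B * 1) * (3 / rho 1 y ^ 5)"
      using B k e[of n] rho_pos[of 1 y] by (intro mult_right_mono mult_mono) auto
    finally show ?thesis by simp
  qed
  have Sm: "S n \<in> borel_measurable lborel" for n unfolding S_def by simp
  have Si: "integrable lborel (S n)" for n
    by (rule Bochner_Integration.integrable_bound[OF r5 Sm]) (use order_trans[OF Sb abs_ge_self] in \<open>simp only: real_norm_def AE_I2\<close>)
  \<comment> \<open>The factor e^2 against rho^5, which scales like e^5, leaves e^(-3): exactly
    cancelled by the Jacobian.\<close>
  have QS: "Q n (e n *\<^sub>R y) = of_real (1 / e n ^ 3) * S n y" for n y
    using e[of n] rho_pos[of 1 y] unfolding Q_def S_def rho_scale[OF e]
    by (simp add: field_simps power2_eq_square power3_eq_cube eval_nat_numeral)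
  have Qm: "Q n \<in> borel_measurable borel" for n unfolding Q_def by simp
  have Qi: "integrable lborel (Q n)" for n
    using integrable_affine_iff[of "e n" "Q n" 0] e[of n] Qm[of n] Si[of n] by (simp add: QS)
  have QI: "(LINT x|lborel. Q n x) = (LINT x|lborel. S n x)" for n
    using integral_affine[of "e n" "Q n" 0] e[of n] Qm[of n] by (simp add: QS) (simp add: scaleR_conv_of_real)
  have "(\<lambda>n. LINT x|lborel. S n x) \<longlonglongrightarrow> (LINT y|lborel. f 0 * of_real (3 / rho 1 y ^ 5))"
  proof (rule integral_dominated_convergence[OF _ Sm r5])
    show "AE y in lborel. (\<lambda>n. S n y) \<longlonglongrightarrow> f 0 * of_real (3 / rho 1 y ^ 5)"
    proof (rule AE_I2)
      fix y :: R3
      have "isCont f 0"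
        using smooth_continuous_on[OF test_function_smooth[OF f], of UNIV]
        by (simp add: continuous_on_eq_continuous_at)
      moreover have "(\<lambda>n. e n *\<^sub>R y) \<longlonglongrightarrow> 0 *\<^sub>R y" by (intro tendsto_intros e0)
      ultimately have "(\<lambda>n. f (e n *\<^sub>R y)) \<longlonglongrightarrow> f 0" by (intro isCont_tendsto_compose[of 0 f]) auto
      moreover have "(\<lambda>n. exp (- (k * of_real (e n * rho 1 y)))) \<longlonglongrightarrow> exp (- (k * of_real (0 * rho 1 y)))"
        by (intro tendsto_intros e0)
      ultimately have "(\<lambda>n. S n y) \<longlonglongrightarrow> f 0 * exp (- (k * of_real (0 * rho 1 y))) * of_real (3 / rho 1 y ^ 5)"
        unfolding S_def by (intro tendsto_mult tendsto_const)
      then show "(\<lambda>n. S n y) \<longlonglongrightarrow> f 0 * of_real (3 / rho 1 y ^ 5)" by simp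
    qed
  qed (use Sb in auto)
  also have "(LINT y|lborel. f 0 * of_real (3 / rho 1 y ^ 5)) = of_real C0 * f 0"
    unfolding C0_def by (simp only: integral_mult_right_zero integral_complex_of_real mult.commute)
  finally have Ql: "(\<lambda>n. LINT x|lborel. Q n x) \<longlonglongrightarrow> of_real C0 * f 0" unfolding QI .
  have "(LINT x|lborel. rkern k (e n) x * g x) = (LINT x|lborel. P n x) + (LINT x|lborel. Q n x)" for n
    unfolding g_def rkern_integral[OF e f]
    by (subst Bochner_Integration.integral_add[OF Pi Qi, symmetric]) (simp add: P_def Q_def algebra_simps)
  then have "(\<lambda>n. LINT x|lborel. rkern k (e n) x * g x) \<longlonglongrightarrow> 0 + of_real C0 * f 0"
    using tendsto_add[OF Pl Ql] by simp
  from LIMSEQ_unique[OF L this] show ?thesis by (simp add: g_def)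
qed


section \<open>Convolution with the Yukawa kernel\<close>

definition conv :: "complex \<Rightarrow> (R3 \<Rightarrow> complex) \<Rightarrow> R3 \<Rightarrow> complex" where
  "conv k f x = (LINT y|lborel. kern k y * f (x - y))"

definition kern_norm :: "complex \<Rightarrow> real" where
  "kern_norm k = (LINT y|lborel. cmod (kern k y))"

lemma kern_norm_nonneg: "kern_norm k \<ge> 0"
  by (simp add: kern_norm_def)

lemma test_function_reflect: "test_function f \<Longrightarrow> test_function (\<lambda>y. f (x - y))"
  using test_function_affine[of f "- 1" x] by simp

lemma square_integrable_reflect: "square_integrable f \<Longrightarrow> square_integrable (\<lambda>y. f (x - y))"
  using square_integrable_affine[of "- 1" f x] by simp

lemma integrable_conv:
  "Re k > 0 \<Longrightarrow> square_integrable f \<Longrightarrow> integrable lborel (\<lambda>y. kern k y * f (x - y))"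
  by (intro integrable_mult_square_integrable kern_square_integrable square_integrable_reflect)

lemma conv_add: "Re k > 0 \<Longrightarrow> square_integrable f \<Longrightarrow> square_integrable g \<Longrightarrow>
    conv k (\<lambda>x. f x + g x) = (\<lambda>x. conv k f x + conv k g x)"
  by (rule ext) (simp add: conv_def distrib_left integrable_conv)

lemma conv_diff: "Re k > 0 \<Longrightarrow> square_integrable f \<Longrightarrow> square_integrable g \<Longrightarrow>
    conv k (\<lambda>x. f x - g x) = (\<lambda>x. conv k f x - conv k g x)"
  by (rule ext) (simp add: conv_def right_diff_distrib integrable_conv)

lemma conv_cmult: "conv k (\<lambda>x. c * f x) = (\<lambda>x. c * conv k f x)"
  by (rule ext) (simp only: conv_def mult.left_commute[of _ c] integral_mult_right_zero)

lemma conv_bound: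
  assumes k: "Re k > 0" and f: "square_integrable f" and B: "\<And>x. cmod (f x) \<le> B"
  shows "cmod (conv k f x) \<le> kern_norm k * B"
proof -
  have "cmod (conv k f x) \<le> (LINT y|lborel. cmod (kern k y * f (x - y)))"
    unfolding conv_def by (rule integral_norm_bound)
  also have "\<dots> \<le> (LINT y|lborel. cmod (kern k y) * B)"
    by (intro integral_mono integrable_norm integrable_mult_left integrable_conv kern_integrable k f)
      (simp add: norm_mult mult_left_mono B)
  finally show ?thesis by (simp add: kern_norm_def)
qed

text \<open>The Taylor remainder of a test function is O(|h|^2) uniformly in the base point;
  convolution with an integrable kernel preserves this bound.\<close>

lemma conv_has_derivative:
  assumes k: "Re k > 0" and f: "test_function f"
  shows "(conv k f has_derivative (\<lambda>h. \<Sum>i\<in>UNIV. of_real (h $ i) * conv k (pd i f) x)) (at x)"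
proof -
  obtain L where L: "L > 0"
    "\<And>x h. cmod (f (x + h) - f x - (\<Sum>i\<in>UNIV. of_real (h $ i) * pd i f x)) \<le> L * (norm h)\<^sup>2"
    using test_function_taylor[OF f] by blast
  let ?D = "\<lambda>h :: R3. \<Sum>i\<in>UNIV. of_real (h $ i) * conv k (pd i f) x"
  have sq: "square_integrable f" "square_integrable (pd i f)" for i
    by (intro test_function_square_integrable test_function_partial f)+
  have est: "cmod (conv k f (x + h) - conv k f x - ?D h) \<le> kern_norm k * (L * (norm h)\<^sup>2)" for h
  proof -
    let ?g = "\<lambda>x. f (x + h) - f x - (\<Sum>i\<in>UNIV. of_real (h $ i) * pd i f x)"
    have "test_function (\<lambda>x. f (x + h))" using test_function_affine[OF f, of 1 h] by simp
    then have g: "square_integrable ?g"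
      by (intro test_function_square_integrable test_function_diff test_function_sum
          test_function_cmult test_function_partial f)
    have fh: "integrable lborel (\<lambda>y. kern k y * f (x + h - y))" by (rule integrable_conv[OF k sq(1)])
    have pt: "kern k y * ?g (x - y) = kern k y * f (x + h - y) - kern k y * f (x - y)
        - (\<Sum>i\<in>UNIV. of_real (h $ i) * (kern k y * pd i f (x - y)))" for y
      by (simp add: right_diff_distrib sum_distrib_left mult.left_commute diff_add_eq)
    have "conv k ?g x = conv k f (x + h) - conv k f x - ?D h"
      unfolding conv_def pt using integrable_conv[OF k sq(1), of x] integrable_conv[OF k sq(2), of _ x] fh
      by simp
    moreover have "cmod (conv k ?g x) \<le> kern_norm k * (L * (norm h)\<^sup>2)"
      by (rule conv_bound[OF k g L(2)])
    ultimately show ?thesis by (simp only:)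
  qed
  show ?thesis
  proof (rule has_derivativeI_sandwich[of 1])
    show "bounded_linear ?D"
      by (intro bounded_linear_sum bounded_linear_mult_const bounded_linear_compose[OF bounded_linear_of_real]
          bounded_linear_vec_nth)
    show "norm (conv k f y - conv k f x - ?D (y - x)) / norm (y - x) \<le> kern_norm k * L * norm (y - x)"
      if "y \<noteq> x" for y
      using est[of "y - x"] that by (simp add: divide_le_eq power2_eq_square mult.assoc)
    have "((\<lambda>y. kern_norm k * L * norm (y - x)) \<longlongrightarrow> kern_norm k * L * norm (x - x)) (at x)"
      by (intro tendsto_intros)
    then show "((\<lambda>y. kern_norm k * L * norm (y - x)) \<longlongrightarrow> 0) (at x)" by simp
  qed simp
qed

lemma partial_deriv_conv:
  assumes "Re k > 0" "test_function f"
  shows "pd i (conv k f) = conv k (pd i f)"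
  by (rule ext) (simp add: partial_deriv_eq[OF conv_has_derivative[OF assms]]
      sum_scale_axis[of 1, simplified])

lemma iter_partial_conv:
  assumes "Re k > 0" "test_function f"
  shows "iter_partial is (conv k f) = conv k (iter_partial is f)"
  by (induction "is") (simp_all add: partial_deriv_conv assms test_function_iter_partial)

lemma smooth_conv:
  assumes k: "Re k > 0" and f: "test_function f"
  shows "smooth (conv k f)"
proof (rule smooth_coinduct[where P = "conv k ` {f. test_function f}"])
  show "g differentiable (at x)" if "g \<in> conv k ` {f. test_function f}" for g x
    using that conv_has_derivative[OF k] by (auto simp: differentiable_def)
  show "pd i g \<in> conv k ` {f. test_function f}" if "g \<in> conv k ` {f. test_function f}" for g i
    using that by (auto simp: partial_deriv_conv[OF k] intro!: imageI test_function_partial)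
qed (use f in auto)

lemma lap_conv:
  assumes k: "Re k > 0" and f: "test_function f"
  shows "lap (conv k f) x = conv k (lap f) x"
proof -
  have "lap (conv k f) x = (\<Sum>i\<in>UNIV. conv k (pd i (pd i f)) x)"
    by (simp add: lap_def partial_deriv_conv k f test_function_partial)
  also have "\<dots> = conv k (lap f) x"
    unfolding conv_def lap_def sum_distrib_left
    by (rule Bochner_Integration.integral_sum[symmetric])
      (intro integrable_conv k test_function_square_integrable test_function_partial f)
  finally show ?thesis .
qed

lemma lap_reflect:
  assumes f: "test_function f"
  shows "lap (\<lambda>y. f (x - y)) y = lap f (x - y)"
proof -
  have p: "pd i (\<lambda>y. g (x - y)) = (\<lambda>y. - pd i g (x - y))" if "smooth g" for g i
    using partial_deriv_affine[OF that, of i "- 1" x] by (auto simp: fun_eq_iff)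
  have "pd i (pd i (\<lambda>y. f (x - y))) y = pd i (pd i f) (x - y)" for i
  proof -
    have s: "smooth (\<lambda>y. pd i f (x - y))"
      by (intro test_function_smooth test_function_reflect test_function_partial f)
    have "pd i (pd i (\<lambda>y. f (x - y))) y
        = pd i (\<lambda>y. (- 1) * pd i f (x - y)) y"
      using p[OF test_function_smooth[OF f]] by simp
    also have "\<dots> = - pd i (\<lambda>y. pd i f (x - y)) y"
      by (subst pd_cmult[OF s]) simp
    finally show ?thesis
      using p[OF smooth_partial[OF test_function_smooth[OF f]]] by simp
  qed
  then show ?thesis by (simp add: lap_def)
qed

text \<open>\<open>fundamental_solution\<close> for the reflected function
  \<open>\<lambda>y. f (x - y)\<close>, whose value at 0 is \<open>f x\<close>; the two signs from
  reflection cancel in the Laplacian.\<close>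

theorem conv_pde:
  assumes k: "Re k > 0" and f: "test_function f"
  shows "k\<^sup>2 * conv k f x - lap (conv k f) x = of_real C0 * f x"
proof -
  note g = test_function_reflect[OF f, of x]
  have "of_real C0 * f x = (LINT y|lborel. kern k y * (k\<^sup>2 * f (x - y) - lap f (x - y)))"
    using fundamental_solution[OF k g] by (simp add: lap_reflect[OF f])
  also have "\<dots> = conv k (\<lambda>x. k\<^sup>2 * f x - lap f x) x" by (simp add: conv_def)
  also have "\<dots> = k\<^sup>2 * conv k f x - lap (conv k f) x"
    using f by (subst conv_diff[OF k])
      (auto simp: conv_cmult lap_conv[OF k f] intro!: test_function_square_integrable test_function_cmult test_function_lap)
  finally show ?thesis by simp
qed

text \<open>Young's inequality, from Cauchy-Schwarz with the weight \<open>|kern k|\<close>.\<close>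

lemma conv_l2_bound:
  assumes k: "Re k > 0" and f: "square_integrable f"
  shows "square_integrable (conv k f)" "norm (abs_l2 (conv k f)) \<le> kern_norm k * norm (abs_l2 f)"
proof -
  have fm [measurable]: "f \<in> borel_measurable borel" using f by (simp add: square_integrable_def)
  let ?K = "\<lambda>y. ennreal (cmod (kern k y))"
  let ?F = "\<lambda>x. ennreal ((cmod (f x))\<^sup>2)"
  have cm [measurable]: "conv k f \<in> borel_measurable borel"
  proof -
    have "(\<lambda>x. LINT y|lborel. kern k y * f (x - y)) \<in> borel_measurable lborel"
      by (rule lborel.borel_measurable_lebesgue_integral) simp
    then show ?thesis by (simp add: conv_def[abs_def])
  qed
  have K: "(\<integral>\<^sup>+y. ?K y \<partial>lborel) = ennreal (kern_norm k)"
    using kern_integrable[OF k] by (simp add: kern_norm_def nn_integral_eq_integral)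
  have pt: "ennreal ((cmod (conv k f x))\<^sup>2) \<le> ennreal (kern_norm k) * (\<integral>\<^sup>+y. ?K y * ?F (x - y) \<partial>lborel)" for x
  proof -
    let ?a = "\<lambda>y. ennreal (sqrt (cmod (kern k y)))"
    let ?b = "\<lambda>y. ennreal (sqrt (cmod (kern k y)) * cmod (f (x - y)))"
    have "ennreal (cmod (conv k f x)) \<le> (\<integral>\<^sup>+y. ennreal (cmod (kern k y * f (x - y))) \<partial>lborel)"
      unfolding conv_def by (rule integral_norm_bound_ennreal[OF integrable_conv[OF k f]])
    also have "\<dots> = (\<integral>\<^sup>+y. ?a y * ?b y \<partial>lborel)"
      by (intro nn_integral_cong) (simp add: ennreal_mult[symmetric] norm_mult mult.assoc[symmetric])
    finally have "(ennreal (cmod (conv k f x)))\<^sup>2 \<le> (\<integral>\<^sup>+y. ?a y * ?b y \<partial>lborel)\<^sup>2"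
      by (intro power_mono) auto
    also have "\<dots> \<le> (\<integral>\<^sup>+y. (?a y)\<^sup>2 \<partial>lborel) * (\<integral>\<^sup>+y. (?b y)\<^sup>2 \<partial>lborel)"
      by (rule Cauchy_Schwarz_nn_integral) auto
    also have "(\<integral>\<^sup>+y. (?a y)\<^sup>2 \<partial>lborel) = ennreal (kern_norm k)"
      unfolding K[symmetric] by (intro nn_integral_cong) (simp add: ennreal_power)
    also have "(\<integral>\<^sup>+y. (?b y)\<^sup>2 \<partial>lborel) = (\<integral>\<^sup>+y. ?K y * ?F (x - y) \<partial>lborel)"
      by (intro nn_integral_cong) (simp add: ennreal_power ennreal_mult[symmetric] power_mult_distrib)
    finally show ?thesis by (simp add: ennreal_power)
  qed
  have tr: "(\<integral>\<^sup>+x. ?F (x - y) \<partial>lborel) = (\<integral>\<^sup>+x. ?F x \<partial>lborel)" for y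
  proof -
    have "(\<integral>\<^sup>+x. ?F (- y + x) \<partial>lborel) = (\<integral>\<^sup>+x. ?F x \<partial>distr lborel borel ((+) (- y)))"
      by (subst nn_integral_distr) auto
    then show ?thesis by (simp add: lborel_distr_plus)
  qed
  have "(\<integral>\<^sup>+x. ennreal ((cmod (conv k f x))\<^sup>2) \<partial>lborel)
    \<le> (\<integral>\<^sup>+x. ennreal (kern_norm k) * (\<integral>\<^sup>+y. ?K y * ?F (x - y) \<partial>lborel) \<partial>lborel)"
    by (intro nn_integral_mono pt)
  also have "\<dots> = ennreal (kern_norm k) * (\<integral>\<^sup>+x. (\<integral>\<^sup>+y. ?K y * ?F (x - y) \<partial>lborel) \<partial>lborel)"
    by (intro nn_integral_cmult) measurable
  also have "(\<integral>\<^sup>+x. (\<integral>\<^sup>+y. ?K y * ?F (x - y) \<partial>lborel) \<partial>lborel)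
      = (\<integral>\<^sup>+y. (\<integral>\<^sup>+x. ?K y * ?F (x - y) \<partial>lborel) \<partial>lborel)"
    by (intro lborel_pair.Fubini') simp
  also have "\<dots> = (\<integral>\<^sup>+y. ?K y * (\<integral>\<^sup>+x. ?F (x - y) \<partial>lborel) \<partial>lborel)"
    by (intro nn_integral_cong nn_integral_cmult) simp
  also have "\<dots> = ennreal (kern_norm k) * (\<integral>\<^sup>+x. ?F x \<partial>lborel)"
    unfolding tr by (subst nn_integral_multc) (simp_all add: K)
  also have "(\<integral>\<^sup>+x. ?F x \<partial>lborel) = ennreal ((norm (abs_l2 f))\<^sup>2)"
    by (rule norm_abs_l2_nn[OF f, symmetric])
  finally have main: "(\<integral>\<^sup>+x. ennreal ((cmod (conv k f x))\<^sup>2) \<partial>lborel) \<le> ennreal ((kern_norm k * norm (abs_l2 f))\<^sup>2)"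
    using kern_norm_nonneg[of k]
    by (simp add: ennreal_mult[symmetric] power_mult_distrib power2_eq_square mult_ac)
  show sc: "square_integrable (conv k f)"
    by (rule square_integrable_nn) (use main in \<open>auto simp: le_less_trans\<close>)
  have "(norm (abs_l2 (conv k f)))\<^sup>2 \<le> (kern_norm k * norm (abs_l2 f))\<^sup>2"
    using main unfolding norm_abs_l2_nn[OF sc, symmetric] by (simp add: ennreal_le_iff)
  then show "norm (abs_l2 (conv k f)) \<le> kern_norm k * norm (abs_l2 f)"
    by (rule power2_le_imp_le) (simp add: kern_norm_nonneg)
qed

text \<open>The zero function for \<open>Re k \<le> 0\<close> makes the lifted operator total, as
  decay of the kernel is guaranteed only for \<open>Re k > 0\<close>.\<close>

lift_definition convop :: "complex \<Rightarrow> l2 \<Rightarrow> l2" is "\<lambda>k f. if Re k > 0 then conv k f else (\<lambda>x. 0)"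
proof -
  fix k f g assume fg: "l2_rel f g"
  have "conv k f x = conv k g x" if "Re k > 0" for x
    unfolding conv_def
  proof (rule integral_cong_AE)
    show "AE y in lborel. kern k y * f (x - y) = kern k y * g (x - y)"
      using AE_affine[of "- 1" "\<lambda>y. f y = g y" x] fg by (auto simp: l2_rel_def)
    show "(\<lambda>y. kern k y * f (x - y)) \<in> borel_measurable lborel"
      "(\<lambda>y. kern k y * g (x - y)) \<in> borel_measurable lborel"
      using fg by (auto simp: l2_rel_def square_integrable_def)
  qed
  then show "l2_rel (if Re k > 0 then conv k f else (\<lambda>x. 0)) (if Re k > 0 then conv k g else (\<lambda>x. 0))"
    using fg conv_l2_bound(1) by (auto simp: l2_rel_def square_integrable_0)
qed

lemma convop_abs_l2: "Re k > 0 \<Longrightarrow> square_integrable f \<Longrightarrow> convop k (abs_l2 f) = abs_l2 (conv k f)"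
  using convop.abs_eq[OF l2_rel_refl, of f k] by simp

lemma norm_convop_le: "Re k > 0 \<Longrightarrow> norm (convop k u) \<le> kern_norm k * norm u"
  by (rule abs_l2_cases[of u]) (simp add: convop_abs_l2 conv_l2_bound)

lemma convop_add: "Re k > 0 \<Longrightarrow> convop k (u + v) = convop k u + convop k v"
  by (rule abs_l2_cases[of u]; rule abs_l2_cases[of v])
    (simp add: convop_abs_l2 conv_l2_bound abs_l2_add square_integrable_add conv_add)

lemma convop_scaleC: "Re k > 0 \<Longrightarrow> convop k (c *\<^sub>C u) = c *\<^sub>C convop k u"
  by (rule abs_l2_cases[of u])
    (simp add: convop_abs_l2 conv_l2_bound abs_l2_scaleC square_integrable_mult conv_cmult)

lemma bounded_linear_convop: "Re k > 0 \<Longrightarrow> bounded_linear (convop k)"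
  by (rule bounded_linear_intro[where K = "kern_norm k"])
    (simp_all add: convop_add convop_scaleC scaleR_eq_scaleC norm_convop_le mult.commute[of _ "kern_norm k"])

text \<open>Defined as a shifted class and not by a formula, so that continuity in the center is an
  instance of \<open>continuous_on_shift\<close>.\<close>

definition kern_at :: "complex \<Rightarrow> R3 \<Rightarrow> l2" where "kern_at k x = shift x (abs_l2 (kern k))"

lemma kern_at_eq: "Re k > 0 \<Longrightarrow> kern_at k x = abs_l2 (\<lambda>y. kern k (y - x))"
  by (simp add: kern_at_def shift_abs_l2 kern_square_integrable)

lemma green_at_eq: "lam > 0 \<Longrightarrow> green_at lam x = kern_at (of_real (sqrt lam)) x"
  by (simp add: kern_at_eq green_at_def green_eq_kern)

text \<open>The kernel is even, so a convolution evaluated at \<open>x\<close> is a pairing with the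
  kernel centered at \<open>x\<close>. Hence the same vector serves as range and as functional in
  the finite rank terms of the resolvents.\<close>

lemma conv_eq_pair:
  assumes k: "Re k > 0" and f: "square_integrable f"
  shows "conv k f x = pair (kern_at k x) (abs_l2 f)"
proof -
  have fm: "f \<in> borel_measurable borel" using f by (simp add: square_integrable_def)
  have kf: "square_integrable (\<lambda>y. kern k (y - x))"
    by (intro square_integrable_translate kern_square_integrable k)
  have e: "kern k (x - y - x) = kern k y" for y using kern_uminus[of k y] by simp
  have "pair (kern_at k x) (abs_l2 f) = (LINT y|lborel. kern k (y - x) * f y)"
    by (simp add: kern_at_eq[OF k] pair_abs_l2 kf f)
  also have "\<dots> = (LINT y|lborel. kern k (x - y - x) * f (x - y))"
    using integral_affine[of "- 1" "\<lambda>y. kern k (y - x) * f y" x] fm by simp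
  finally show ?thesis unfolding e conv_def by simp
qed

text \<open>Plays the part of the Sobolev embedding: the continuous representative is the pairing
  with the kernel, continuous because the kernel moves continuously in L^2.\<close>

lemma has_value_at_convop:
  assumes k: "Re k > 0" shows "has_value_at (convop k u) x (pair (kern_at k x) u)"
proof -
  obtain f where f: "square_integrable f" "u = abs_l2 f" by (rule abs_l2_cases)
  have "continuous_on UNIV (\<lambda>x. pair (kern_at k x) u)"
    unfolding kern_at_def
    by (rule bounded_bilinear.continuous_on[OF bounded_bilinear_pair continuous_on_shift continuous_on_const])
  then have "continuous_on UNIV (conv k f)" by (simp add: conv_eq_pair[OF k f(1)] f(2)[symmetric] cong: continuous_on_cong)
  from has_value_at_abs_l2[OF conv_l2_bound(1)[OF k f(1)] this, of x]
  show ?thesis using f k by (simp add: convop_abs_l2 conv_eq_pair)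
qed


section \<open>Elliptic regularity\<close>

text \<open>
  A cutoff converging to a nonzero constant, instead of to \<open>1\<close>, serves as well, so no plateau is
  needed.
\<close>

definition cutoff :: "real \<Rightarrow> R3 \<Rightarrow> complex" where
  "cutoff s x = bump 1 (- (\<chi> i. 1)) (\<chi> i. 1) (s *\<^sub>R x)"

abbreviation "cutoff_value \<equiv> bump 1 (- (\<chi> i. 1)) (\<chi> i. 1) 0"

lemma cutoff_value_neq_0: "cutoff_value \<noteq> 0"
  by (simp add: bump_def flat_def)

lemma test_function_cutoff: "s > 0 \<Longrightarrow> test_function (cutoff s)"
  using test_function_affine[OF test_function_bump[of 1 "- (\<chi> i. 1)" "\<chi> i. 1"], of s 0]
  by (simp add: cutoff_def[abs_def])

text \<open>By the chain rule every derivative emits a factor \<open>s\<close>; the Laplacian sums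
  three second partials, hence \<open>3 * B\<close> as the common constant.\<close>

lemma cutoff_partials:
  "\<exists>B>0. (\<forall>s x. cmod (cutoff s x) \<le> B) \<and>
     (\<forall>s i x. cmod (pd i (cutoff s) x) \<le> \<bar>s\<bar> * B) \<and>
     (\<forall>s x. cmod (lap (cutoff s) x) \<le> s\<^sup>2 * B)"
proof -
  define c where "c = bump 1 (- (\<chi> i. 1)) (\<chi> i. 1)"
  have c: "test_function c" by (simp add: c_def test_function_bump)
  have sc: "smooth c" using c by (rule test_function_smooth)
  obtain B where B: "B > 0" "\<And>is x. length is \<le> 2 \<Longrightarrow> cmod (iter_partial is c x) \<le> B"
    using test_function_partials_bounded[OF c, where n = 2] by blast
  have ceq: "cutoff s = (\<lambda>x. c (s *\<^sub>R x + 0))" for s by (simp add: cutoff_def[abs_def] c_def)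
  have p1: "pd i (cutoff s) = (\<lambda>x. of_real s * pd i c (s *\<^sub>R x + 0))" for i s
    unfolding ceq by (rule ext) (rule partial_deriv_affine[OF sc])
  have p2: "pd i (pd i (cutoff s)) x
      = of_real s * (of_real s * pd i (pd i c) (s *\<^sub>R x + 0))" for i s x
    unfolding p1 by (subst pd_cmult) (simp_all only: smooth_affine smooth_partial sc partial_deriv_affine)
  show ?thesis
  proof (intro exI[of _ "3 * B"] conjI allI)
    show "cmod (cutoff s x) \<le> 3 * B" for s x
      using B(2)[of "[]" "s *\<^sub>R x"] B(1) by (simp add: ceq)
    show "cmod (pd i (cutoff s) x) \<le> \<bar>s\<bar> * (3 * B)" for s i x
      using B(2)[of "[i]" "s *\<^sub>R x"] B(1) by (simp add: p1 norm_mult mult_left_mono)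
    show "cmod (lap (cutoff s) x) \<le> s\<^sup>2 * (3 * B)" for s x
    proof -
      have "cmod (lap (cutoff s) x) \<le> (\<Sum>i\<in>(UNIV :: 3 set). s\<^sup>2 * B)"
        unfolding lap_def
      proof (rule sum_norm_le)
        fix i
        have "cmod (pd i (pd i (cutoff s)) x)
            = s\<^sup>2 * cmod (pd i (pd i c) (s *\<^sub>R x + 0))"
          unfolding p2 by (simp add: norm_mult power2_eq_square)
        also have "\<dots> \<le> s\<^sup>2 * B"
          using B(2)[of "[i, i]" "s *\<^sub>R x + 0"] by (intro mult_left_mono) auto
        finally show "cmod (pd i (pd i (cutoff s)) x) \<le> s\<^sup>2 * B" .
      qed
      then show ?thesis by simp
    qed
  qed (use B in auto)
qed

lemma scale_tendsto_0: "(\<lambda>n. inverse (real (Suc n))) \<longlonglongrightarrow> 0"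
  by (rule LIMSEQ_inverse_real_of_nat)

lemma cutoff_tendsto: "(\<lambda>n. cutoff (inverse (real (Suc n))) x) \<longlonglongrightarrow> cutoff_value"
proof -
  have "continuous_on UNIV (bump 1 (- (\<chi> i. 1)) (\<chi> i. 1))"
    by (rule smooth_continuous_on[OF smooth_bump])
  then have c: "isCont (bump 1 (- (\<chi> i. 1)) (\<chi> i. 1)) 0" by (simp add: continuous_on_eq_continuous_at)
  have "(\<lambda>n. inverse (real (Suc n)) *\<^sub>R x) \<longlonglongrightarrow> 0 *\<^sub>R x"
    by (intro tendsto_intros scale_tendsto_0)
  then have "(\<lambda>n. inverse (real (Suc n)) *\<^sub>R x) \<longlonglongrightarrow> 0" by (simp only: scale_zero_left)
  with c show ?thesis
    unfolding cutoff_def by (rule isCont_tendsto_compose)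
qed

text \<open>After multiplication by a cutoff the function is a test function. The term with the
  derivative on the cutoff is O(s), so in the limit \<open>cutoff_value\<close> times the integral
  is 0.\<close>

lemma integral_partial_eq_0:
  assumes F: "smooth F" "integrable lborel F" "integrable lborel (pd i F)"
  shows "(LINT x|lborel. pd i F x) = 0"
proof -
  from cutoff_partials obtain B where B0: "B > 0 \<and> (\<forall>s x. cmod (cutoff s x) \<le> B) \<and>
     (\<forall>s i x. cmod (pd i (cutoff s) x) \<le> \<bar>s\<bar> * B)"
    by auto
  then have B: "B > 0" "\<And>s x. cmod (cutoff s x) \<le> B"
    "\<And>s i x. cmod (pd i (cutoff s) x) \<le> \<bar>s\<bar> * B"
    by auto
  define s where "s n = inverse (real (Suc n))" for n
  have s: "s n > 0" "s n \<le> 1" for n by (auto simp: s_def field_simps)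
  note tc = test_function_cutoff[OF s(1)]
  note sm = smooth_measurable[OF F(1)] smooth_measurable[OF smooth_partial[OF F(1)]]
    smooth_measurable[OF test_function_smooth[OF tc]]
    smooth_measurable[OF smooth_partial[OF test_function_smooth[OF tc]]]
  let ?w = "\<lambda>x. B * cmod (F x) + B * cmod (pd i F x)"
  have w: "integrable lborel ?w" using F by simp
  have "(\<lambda>n. LINT x|lborel. pd i (\<lambda>x. cutoff (s n) x * F x) x)
      \<longlonglongrightarrow> (LINT x|lborel. cutoff_value * pd i F x)"
  proof (rule integral_dominated_convergence[OF _ _ w])
    have pd: "pd i (\<lambda>x. cutoff (s n) x * F x)
      = (\<lambda>x. pd i (cutoff (s n)) x * F x + cutoff (s n) x * pd i F x)" for n
      by (rule pd_mult[OF test_function_smooth[OF tc] F(1)])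
    have b1: "cmod (pd i (cutoff (s n)) x * F x) \<le> s n * (B * cmod (F x))" for n x
      using mult_right_mono[OF B(3)[of i "s n" x], of "cmod (F x)"] s[of n] by (simp add: norm_mult mult.assoc)
    have "(\<lambda>n. pd i (cutoff (s n)) x * F x) \<longlonglongrightarrow> 0" for x
    proof (rule Lim_null_comparison)
      show "\<forall>\<^sub>F n in sequentially. cmod (pd i (cutoff (s n)) x * F x) \<le> s n * (B * cmod (F x))"
        using b1 by simp
      have "(\<lambda>n. s n * (B * cmod (F x))) \<longlonglongrightarrow> 0 * (B * cmod (F x))"
        unfolding s_def by (intro tendsto_intros scale_tendsto_0)
      then show "(\<lambda>n. s n * (B * cmod (F x))) \<longlonglongrightarrow> 0" by simp
    qed
    moreover have "(\<lambda>n. cutoff (s n) x * pd i F x) \<longlonglongrightarrow> cutoff_value * pd i F x" for x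
      unfolding s_def by (intro tendsto_intros cutoff_tendsto)
    ultimately have "(\<lambda>n. pd i (cutoff (s n)) x * F x + cutoff (s n) x * pd i F x)
      \<longlonglongrightarrow> 0 + cutoff_value * pd i F x" for x by (intro tendsto_add)
    then show "AE x in lborel. (\<lambda>n. pd i (\<lambda>x. cutoff (s n) x * F x) x) \<longlonglongrightarrow> cutoff_value * pd i F x"
      by (simp add: pd)
    show "AE x in lborel. norm (pd i (\<lambda>x. cutoff (s n) x * F x) x) \<le> ?w x" for n
    proof (rule AE_I2)
      fix x
      have "s n * (B * cmod (F x)) \<le> 1 * (B * cmod (F x))"
        using s(2)[of n] B(1) by (intro mult_right_mono) auto
      moreover have "cmod (cutoff (s n) x * pd i F x) \<le> B * cmod (pd i F x)"
        using B(2) by (simp add: norm_mult mult_right_mono)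
      ultimately show "norm (pd i (\<lambda>x. cutoff (s n) x * F x) x) \<le> ?w x"
        unfolding pd using b1[of n x] by (intro norm_triangle_le) linarith
    qed
    show "pd i (\<lambda>x. cutoff (s n) x * F x) \<in> borel_measurable lborel" for n
      unfolding pd using sm by simp
  qed (use sm in simp)
  moreover have "(LINT x|lborel. pd i (\<lambda>x. cutoff (s n) x * F x) x) = 0" for n
    by (rule integral_partial_test_function[OF test_function_mult_right[OF tc F(1)]])
  ultimately have "(LINT x|lborel. cutoff_value * pd i F x) = 0"
    by (simp add: LIMSEQ_const_iff)
  then show ?thesis using cutoff_value_neq_0 by simp
qed

lemma integral_by_parts:
  assumes "smooth a" "smooth b" "square_integrable a" "square_integrable b"
    "square_integrable (pd i a)" "square_integrable (pd i b)"
  shows "(LINT x|lborel. pd i a x * b x) = - (LINT x|lborel. a x * pd i b x)"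
proof -
  have i: "integrable lborel (\<lambda>x. pd i a x * b x)" "integrable lborel (\<lambda>x. a x * pd i b x)"
    "integrable lborel (\<lambda>x. a x * b x)"
    by (intro integrable_mult_square_integrable assms)+
  have "(LINT x|lborel. pd i (\<lambda>x. a x * b x) x) = 0"
    using i by (intro integral_partial_eq_0 smooth_mult assms) (simp_all add: pd_mult assms)
  then show ?thesis using i by (simp add: pd_mult assms add_eq_0_iff2)
qed

lemma square_integrable_cnj: "square_integrable f \<Longrightarrow> square_integrable (\<lambda>x. cnj (f x))"
  using measurable_compose[OF _ borel_measurable_continuous_onI[of cnj], of f borel]
  by (auto simp: square_integrable_def intro: continuous_intros)

lemma pd_cnj: "smooth f \<Longrightarrow> pd i (\<lambda>x. cnj (f x)) = (\<lambda>x. cnj (pd i f x))"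
  by (rule ext) (rule partial_deriv_cnj)

lemma integral_mult_cnj:
  assumes "square_integrable f"
  shows "(LINT x|lborel. f x * cnj (f x)) = of_real ((norm (abs_l2 f))\<^sup>2)"
  using assms by (simp add: norm_abs_l2_sq complex_norm_square del: of_real_power flip: integral_complex_of_real)

lemma integral_mult_cnj_le:
  assumes "square_integrable f" "square_integrable g"
  shows "cmod (LINT x|lborel. f x * cnj (g x)) \<le> norm (abs_l2 f) * norm (abs_l2 g)"
proof -
  have "norm (abs_l2 (\<lambda>x. cnj (g x))) = norm (abs_l2 g)"
    using assms by (simp add: norm_abs_l2 square_integrable_cnj)
  then show ?thesis
    using cmod_pair_le[of "abs_l2 f" "abs_l2 (\<lambda>x. cnj (g x))"] assms
    by (simp add: pair_abs_l2 square_integrable_cnj)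
qed

text \<open>Commutation of partials is an assumption here because it was proved for test functions,
  whereas \<open>v\<close> will be a convolution without compact support. For a convolution it is
  inherited from the test function onto which all derivatives can be moved.\<close>

context
  fixes v :: "R3 \<Rightarrow> complex"
  assumes v: "smooth v" and sq: "\<And>is. square_integrable (iter_partial is v)"
    and sym: "\<And>i j x. pd i (pd j v) x = pd j (pd i v) x"
      "\<And>i j x. pd j (pd j (pd i v)) x = pd i (pd j (pd j v)) x"
begin

private lemma sq1: "square_integrable v" "square_integrable (pd i v)"
  "square_integrable (pd j (pd i v))"
  "square_integrable (pd l (pd j (pd i v)))"
  using sq[of "[]"] sq[of "[i]"] sq[of "[j, i]"] sq[of "[l, j, i]"] by simp_all

private lemma s1: "smooth (pd i v)" "smooth (pd j (pd i v))"
  by (intro smooth_partial v)+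

private lemma sq_lap: "square_integrable (lap v)"
  unfolding lap_def[abs_def] by (rule abs_l2_sum(1)) (rule sq1)

private lemma ibp_cnj:
  assumes "smooth a" "smooth b" "square_integrable a" "square_integrable b"
    "square_integrable (pd i a)" "square_integrable (pd i b)"
  shows "(LINT x|lborel. pd i a x * cnj (b x)) = - (LINT x|lborel. a x * cnj (pd i b x))"
  using integral_by_parts[of a "\<lambda>x. cnj (b x)" i] assms
  by (simp add: smooth_cnj square_integrable_cnj pd_cnj)

lemma norm_partial2_le: "norm (abs_l2 (pd j (pd i v))) \<le> norm (abs_l2 (lap v))"
proof -
  define N where "N i j = (norm (abs_l2 (pd j (pd i v))))\<^sup>2" for i j
  \<comment> \<open>integrate by parts in direction \<open>j\<close>, then in direction \<open>i\<close>\<close>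
  have ij: "of_real (N i j) = (LINT x|lborel. pd i (pd i v) x * cnj (pd j (pd j v) x))"
    for i j
  proof -
    have "of_real (N i j) = (LINT x|lborel. pd j (pd i v) x * cnj (pd j (pd i v) x))"
      unfolding N_def by (rule integral_mult_cnj[symmetric]) (rule sq1)
    also have "\<dots> = - (LINT x|lborel. pd i v x * cnj (pd j (pd j (pd i v)) x))"
      by (intro ibp_cnj s1 sq1)
    also have "\<dots> = - (LINT x|lborel. pd i v x * cnj (pd i (pd j (pd j v)) x))"
      by (simp only: sym(2))
    also have "\<dots> = (LINT x|lborel. pd i (pd i v) x * cnj (pd j (pd j v) x))"
      by (intro ibp_cnj[symmetric] s1 sq1)
    finally show ?thesis .
  qed
  have int: "integrable lborel (\<lambda>x. pd i (pd i v) x * cnj (pd j (pd j v) x))" for i j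
    by (intro integrable_mult_square_integrable square_integrable_cnj sq1)
  have "complex_of_real ((norm (abs_l2 (lap v)))\<^sup>2) = (LINT x|lborel. lap v x * cnj (lap v x))"
    by (rule integral_mult_cnj[OF sq_lap, symmetric])
  also have "\<dots> = (LINT x|lborel. (\<Sum>i\<in>UNIV. \<Sum>j\<in>UNIV.
      pd i (pd i v) x * cnj (pd j (pd j v) x)))"
    unfolding lap_def cnj_sum sum_product ..
  also have "\<dots> = (\<Sum>i\<in>UNIV. \<Sum>j\<in>UNIV. of_real (N i j))"
    unfolding ij using int by simp
  also have "\<dots> = complex_of_real (\<Sum>i\<in>UNIV. \<Sum>j\<in>UNIV. N i j)" by simp
  finally have "(norm (abs_l2 (lap v)))\<^sup>2 = (\<Sum>i\<in>UNIV. \<Sum>j\<in>UNIV. N i j)"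
    by (simp only: of_real_eq_iff)
  moreover have "N i j \<le> (\<Sum>j\<in>UNIV. N i j)"
    by (rule member_le_sum) (auto simp: N_def)
  moreover have "(\<Sum>j\<in>UNIV. N i j) \<le> (\<Sum>i\<in>UNIV. \<Sum>j\<in>UNIV. N i j)"
    by (rule member_le_sum) (auto simp: N_def intro: sum_nonneg)
  ultimately have "N i j \<le> (norm (abs_l2 (lap v)))\<^sup>2" by linarith
  then show ?thesis unfolding N_def by (rule power2_le_imp_le) simp
qed

text \<open>Interpolation between orders 0 and 2: one integration by parts moves a derivative over,
  leaving \<open>v\<close> against a second partial.\<close>

lemma norm_partial1_le: "(norm (abs_l2 (pd i v)))\<^sup>2 \<le> 3 * (norm (abs_l2 v) * norm (abs_l2 (lap v)))"
proof -
  have "of_real ((norm (abs_l2 (pd i v)))\<^sup>2) = (LINT x|lborel. pd i v x * cnj (pd i v x))"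
    by (rule integral_mult_cnj[symmetric]) (rule sq1)
  also have "\<dots> = - (LINT x|lborel. v x * cnj (pd i (pd i v) x))"
    by (intro ibp_cnj s1 sq1 v)
  finally have "cmod (of_real ((norm (abs_l2 (pd i v)))\<^sup>2))
      = cmod (- (LINT x|lborel. v x * cnj (pd i (pd i v) x)))" by (rule arg_cong)
  then have "(norm (abs_l2 (pd i v)))\<^sup>2 = cmod (LINT x|lborel. v x * cnj (pd i (pd i v) x))"
    unfolding norm_minus_cancel norm_of_real by simp
  also have "\<dots> \<le> norm (abs_l2 v) * norm (abs_l2 (pd i (pd i v)))"
    by (rule integral_mult_cnj_le) (rule sq1)+
  also have "\<dots> \<le> norm (abs_l2 v) * norm (abs_l2 (lap v))"
    by (intro mult_left_mono norm_partial2_le) simp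
  also have "\<dots> \<le> 3 * (norm (abs_l2 v) * norm (abs_l2 (lap v)))" by simp
  finally show ?thesis .
qed

end

text \<open>What matters is that \<open>C\<close> does not depend on \<open>f\<close>, so the bound
  survives the passage to limits. Order 0 is Young's inequality with constant \<open>M\<close>; the
  equation expresses the Laplacian through \<open>v\<close> and \<open>f\<close>, giving
  \<open>D\<close> for order 2; interpolation gives order 1.\<close>

lemma conv_partials_bound:
  assumes k: "Re k > 0"
  obtains C where "C \<ge> 0" "\<And>f is. test_function f \<Longrightarrow> length is \<le> 2 \<Longrightarrow>
    norm (abs_l2 (iter_partial is (conv k f))) \<le> C * norm (abs_l2 f)"
proof -
  define M where "M = kern_norm k"
  define D where "D = (cmod k)\<^sup>2 * M + C0"
  have M: "M \<ge> 0" by (simp add: M_def kern_norm_nonneg)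
  have D: "D \<ge> 0" using M C0_pos by (simp add: D_def)
  show ?thesis
  proof (rule that[of "M + D + sqrt (3 * (M * D))"])
    show "0 \<le> M + D + sqrt (3 * (M * D))" using M D by simp
    fix f and "is" :: "3 list" assume f: "test_function f" and l: "length is \<le> 2"
    let ?v = "conv k f"
    have sf: "square_integrable f" using f by (rule test_function_square_integrable)
    have v: "smooth ?v" by (rule smooth_conv[OF k f])
    have sq: "square_integrable (iter_partial js ?v)" for js
      unfolding iter_partial_conv[OF k f]
      by (intro conv_l2_bound k test_function_square_integrable test_function_iter_partial f)
    have sy: "pd i (pd j g) = pd j (pd i g)"
      if "test_function g" for g i j
      using partial_deriv_commute[OF that] by (rule ext)
    note t = f test_function_partial[OF f] test_function_partial[OF test_function_partial[OF f]]
    have sym1: "pd i (pd j ?v) x = pd j (pd i ?v) x" for i j x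
      using sy[OF f, of i j] by (simp add: partial_deriv_conv k t)
    have sym2: "pd j (pd j (pd i ?v)) x
        = pd i (pd j (pd j ?v)) x" for i j x
      using sy[OF f, of i j] sy[OF t(2), of i j j] by (simp add: partial_deriv_conv k t)
    have n0: "norm (abs_l2 ?v) \<le> M * norm (abs_l2 f)" unfolding M_def by (rule conv_l2_bound[OF k sf])
    have nl: "norm (abs_l2 (lap ?v)) \<le> D * norm (abs_l2 f)"
    proof -
      have sv: "square_integrable ?v" using sq[of "[]"] by simp
      have "lap ?v = (\<lambda>x. k\<^sup>2 * ?v x - of_real C0 * f x)"
        using conv_pde[OF k f] by (auto simp: fun_eq_iff algebra_simps)
      then have "abs_l2 (lap ?v) = k\<^sup>2 *\<^sub>C abs_l2 ?v - of_real C0 *\<^sub>C abs_l2 f"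
        using sv sf by (simp add: abs_l2_scaleC abs_l2_diff square_integrable_mult)
      then have "norm (abs_l2 (lap ?v)) \<le> (cmod k)\<^sup>2 * norm (abs_l2 ?v) + C0 * norm (abs_l2 f)"
        using norm_triangle_ineq4[of "k\<^sup>2 *\<^sub>C abs_l2 ?v" "of_real C0 *\<^sub>C abs_l2 f"] C0_pos
        by (simp add: norm_scaleC norm_power)
      also have "\<dots> \<le> (cmod k)\<^sup>2 * (M * norm (abs_l2 f)) + C0 * norm (abs_l2 f)"
        by (intro add_right_mono mult_left_mono n0) simp
      finally show ?thesis by (simp add: D_def algebra_simps)
    qed
    have n2: "norm (abs_l2 (pd j (pd i ?v))) \<le> D * norm (abs_l2 f)" for i j
      by (rule order_trans[OF norm_partial2_le[OF v sq sym1 sym2] nl])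
    have n1: "norm (abs_l2 (pd i ?v)) \<le> sqrt (3 * (M * D)) * norm (abs_l2 f)" for i
    proof -
      have "(norm (abs_l2 (pd i ?v)))\<^sup>2 \<le> 3 * (norm (abs_l2 ?v) * norm (abs_l2 (lap ?v)))"
        by (rule norm_partial1_le[OF v sq sym1 sym2])
      also have "\<dots> \<le> 3 * ((M * norm (abs_l2 f)) * (D * norm (abs_l2 f)))"
        using M by (intro mult_left_mono mult_mono n0 nl) auto
      also have "\<dots> = (sqrt (3 * (M * D)) * norm (abs_l2 f))\<^sup>2"
        using M D by (simp add: power_mult_distrib power2_eq_square)
      finally show ?thesis by (rule power2_le_imp_le) (use M D in simp)
    qed
    have nn: "0 \<le> M * norm (abs_l2 f)" "0 \<le> D * norm (abs_l2 f)" "0 \<le> sqrt (3 * (M * D)) * norm (abs_l2 f)"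
      using M D by simp_all
    consider "is = []" | i where "is = [i]" | i j where "is = [j, i]"
      using l by (cases "is"; cases "tl is"; cases "tl (tl is)") auto
    then show "norm (abs_l2 (iter_partial is ?v)) \<le> (M + D + sqrt (3 * (M * D))) * norm (abs_l2 f)"
    proof cases
      case 1
      then show ?thesis using n0 nn unfolding distrib_right by simp
    next
      case 2
      then show ?thesis using n1[of i] nn unfolding distrib_right by simp
    next
      case 3
      then show ?thesis using n2[of j i] nn unfolding distrib_right by simp
    qed
  qed
qed

text \<open>Integration by parts strips the outermost derivative of \<open>f\<close> first, and it
  is then the innermost one on \<open>v\<close>; hence the reversed list.\<close>

lemma integral_iter_partial_test:
  assumes "smooth v" "test_function f"
  shows "(LINT x|lborel. v x * iter_partial is f x) = (- 1) ^ length is * (LINT x|lborel. iter_partial (rev is) v x * f x)"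
  using assms(1)
proof (induction "is" arbitrary: v)
  case (Cons i "is")
  have "(LINT x|lborel. v x * iter_partial (i # is) f x) = - (LINT x|lborel. pd i v x * iter_partial is f x)"
    using integral_by_parts_test[OF Cons.prems test_function_iter_partial[OF assms(2)], of i "is"] by simp
  also have "\<dots> = - ((- 1) ^ length is * (LINT x|lborel. iter_partial (rev is) (pd i v) x * f x))"
    by (subst Cons.IH[OF smooth_partial[OF Cons.prems]]) rule
  finally show ?case by (simp add: iter_partial_append)
qed simp

lemma weak_deriv_conv:
  assumes k: "Re k > 0" and f: "test_function f"
  shows "weak_deriv is (abs_l2 (conv k f)) (abs_l2 (iter_partial (rev is) (conv k f)))"
proof -
  have "square_integrable (iter_partial js (conv k f))" for js
    unfolding iter_partial_conv[OF k f]
    by (intro conv_l2_bound k test_function_square_integrable test_function_iter_partial f)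
  from this[of "[]"] this[of "rev is"] show ?thesis
    using integral_iter_partial_test[OF smooth_conv[OF k f], of _ "is"]
    by (simp add: weak_deriv.abs_eq[OF l2_rel_refl l2_rel_refl])
qed

text \<open>For test functions this is \<open>conv_pde\<close>. In general the uniform bound,
  applied to differences \<open>f m - f n\<close>, makes all derivatives up to order 2 Cauchy;
  completeness gives limits and closedness identifies them as weak derivatives.\<close>

theorem convop_in_h0:
  assumes k: "Re k > 0"
  shows "(convop k u, of_real C0 *\<^sub>C u - k\<^sup>2 *\<^sub>C convop k u) \<in> h0"
proof -
  obtain f where f: "\<And>n :: nat. test_function (f n)" "(\<lambda>n. abs_l2 (f n)) \<longlonglongrightarrow> u"
    using test_l2_approx[of u] by blast
  obtain C where C: "C \<ge> 0" "\<And>f is. test_function f \<Longrightarrow> length is \<le> 2 \<Longrightarrow>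
    norm (abs_l2 (iter_partial is (conv k f))) \<le> C * norm (abs_l2 f)"
    using conv_partials_bound[OF k] by blast
  have sf: "square_integrable (f n)" for n using f(1) by (rule test_function_square_integrable)
  define D where "D is n = abs_l2 (iter_partial is (conv k (f n)))" for "is" n
  have sq: "square_integrable (iter_partial is (conv k (f n)))" for "is" n
    unfolding iter_partial_conv[OF k f(1)]
    by (intro conv_l2_bound k test_function_square_integrable test_function_iter_partial f)
  have "convergent (D is)" if l: "length is \<le> 2" for "is"
  proof -
    have dist: "norm (D is m - D is n) \<le> C * norm (abs_l2 (f m) - abs_l2 (f n))" for m n
    proof -
      have t: "test_function (\<lambda>x. f m x - f n x)" by (intro test_function_diff f)
      have "iter_partial is (\<lambda>x. g x - h x) = (\<lambda>x. iter_partial is g x - iter_partial is h x)"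
        if "test_function g" "test_function h" for g h
      proof (induction "is")
        case (Cons i "is")
        show ?case
          unfolding iter_partial_Cons Cons.IH
          by (rule ext) (intro partial_deriv_diff test_function_smooth test_function_iter_partial that)
      qed simp
      note it = this
      have "iter_partial is (conv k (\<lambda>x. f m x - f n x))
          = (\<lambda>x. iter_partial is (conv k (f m)) x - iter_partial is (conv k (f n)) x)"
        unfolding iter_partial_conv[OF k t] iter_partial_conv[OF k f(1)] it[OF f(1) f(1)]
        by (rule conv_diff) (intro k test_function_square_integrable test_function_iter_partial f)+
      then have "D is m - D is n = abs_l2 (iter_partial is (conv k (\<lambda>x. f m x - f n x)))"
        by (simp add: D_def abs_l2_diff sq)
      with C(2)[OF t l] show ?thesis by (simp add: abs_l2_diff sf)
    qed
    have "Cauchy (D is)"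
      unfolding Cauchy_iff
    proof (intro allI impI)
      fix e :: real assume e: "e > 0"
      have "Cauchy (\<lambda>n. abs_l2 (f n))" using f(2) by (rule LIMSEQ_imp_Cauchy)
      \<comment> \<open>The \<open>+ 1\<close> covers the case \<open>C = 0\<close>.\<close>
      moreover have "e / (C + 1) > 0" using e C by simp
      ultimately obtain N where N: "\<And>m n. m \<ge> N \<Longrightarrow> n \<ge> N \<Longrightarrow> norm (abs_l2 (f m) - abs_l2 (f n)) < e / (C + 1)"
        unfolding Cauchy_iff by blast
      have "norm (D is m - D is n) < e" if "m \<ge> N" "n \<ge> N" for m n
      proof -
        have "norm (D is m - D is n) \<le> (C + 1) * norm (abs_l2 (f m) - abs_l2 (f n))"
          using dist[of m n] by (simp add: distrib_right add_increasing2)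
        also have "\<dots> < (C + 1) * (e / (C + 1))"
          using N[OF that] C by (intro mult_strict_left_mono) auto
        finally show ?thesis using C by simp
      qed
      then show "\<exists>M. \<forall>m\<ge>M. \<forall>n\<ge>M. norm (D is m - D is n) < e" by blast
    qed
    then show ?thesis by (rule Cauchy_convergent)
  qed
  then have Dlim: "D is \<longlonglongrightarrow> lim (D is)" if "length is \<le> 2" for "is"
    using that by (simp add: convergent_LIMSEQ_iff)
  have w: "(\<lambda>n. abs_l2 (conv k (f n))) \<longlonglongrightarrow> convop k u"
    using bounded_linear.tendsto[OF bounded_linear_convop[OF k] f(2)] by (simp add: convop_abs_l2 k sf)
  have wd: "weak_deriv is (convop k u) (lim (D (rev is)))" if "length is \<le> 2" for "is"
    by (rule weak_deriv_limit[OF weak_deriv_conv[OF k f(1)] w]) (use Dlim[of "rev is"] that in \<open>simp add: D_def[symmetric]\<close>)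
  then have "convop k u \<in> H2" by (auto simp: H2_def)
  moreover have "weak_deriv [i, i] (convop k u) (lim (D [i, i]))" for i using wd[of "[i, i]"] by simp
  moreover have "of_real C0 *\<^sub>C u - k\<^sup>2 *\<^sub>C convop k u = - (\<Sum>i\<in>UNIV. lim (D [i, i]))"
  proof (rule LIMSEQ_unique)
    show "(\<lambda>n. - (\<Sum>i\<in>UNIV. D [i, i] n)) \<longlonglongrightarrow> - (\<Sum>i\<in>UNIV. lim (D [i, i]))"
      by (intro tendsto_minus tendsto_sum Dlim) simp
    have "(\<Sum>i\<in>UNIV. D [i, i] n) = k\<^sup>2 *\<^sub>C abs_l2 (conv k (f n)) - of_real C0 *\<^sub>C abs_l2 (f n)" for n
    proof -
      have "(\<Sum>i\<in>UNIV. D [i, i] n) = abs_l2 (lap (conv k (f n)))"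
        unfolding D_def lap_def[abs_def] using sq[of "[i, i]" n for i] by (simp add: abs_l2_sum(2))
      also have "lap (conv k (f n)) = (\<lambda>x. k\<^sup>2 * conv k (f n) x - of_real C0 * f n x)"
        using conv_pde[OF k f(1)[of n]] by (auto simp: fun_eq_iff algebra_simps)
      finally show ?thesis
        using sq[of "[]" n] by (simp add: abs_l2_scaleC abs_l2_diff square_integrable_mult sf)
    qed
    then show "(\<lambda>n. - (\<Sum>i\<in>UNIV. D [i, i] n)) \<longlonglongrightarrow> of_real C0 *\<^sub>C u - k\<^sup>2 *\<^sub>C convop k u"
      using tendsto_diff[OF tendsto_scaleC[OF f(2), of "of_real C0"] tendsto_scaleC[OF w, of "k\<^sup>2"]] by simp
  qed
  ultimately show ?thesis
    unfolding h0_def by (intro CollectI exI[of _ "convop k u"] exI[of _ "\<lambda>i. lim (D [i, i])"]) simp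
qed


section \<open>The free resolvent\<close>

lemma square_integrable_norm: "square_integrable f \<Longrightarrow> square_integrable (\<lambda>x. of_real (cmod (f x)))"
  by (auto simp: square_integrable_def)

lemma lap_mult:
  assumes "smooth f" "smooth g"
  shows "lap (\<lambda>x. f x * g x) x
    = lap f x * g x + 2 * (\<Sum>i\<in>UNIV. pd i f x * pd i g x) + f x * lap g x"
proof -
  have "pd i (pd i (\<lambda>x. f x * g x)) x
    = pd i (pd i f) x * g x + 2 * (pd i f x * pd i g x)
      + f x * pd i (pd i g) x" for i
    by (simp add: pd_mult pd_add assms smooth_partial smooth_mult)
  then show ?thesis
    by (simp add: lap_def sum.distrib sum_distrib_left sum_distrib_right)
qed

text \<open>
  The functions \<open>(- \<Delta> + k\<^sup>2) (cutoff s \<cdot> conv k f)\<close>, \<open>f\<close> a test function, approximate multiples of \<open>f\<close>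
  in \<open>L\<^sup>2\<close> as \<open>s \<rightarrow> 0\<close>.
\<close>

lemma helmholtz_unique:
  assumes k: "Re k > 0"
    and w: "\<And>f. test_function f \<Longrightarrow> pair w (abs_l2 (\<lambda>x. k\<^sup>2 * f x - lap f x)) = 0"
  shows "w = 0"
proof (rule pair_test_eq_0)
  fix f assume f: "test_function f"
  \<comment> \<open>The Helmholtz operator sends \<open>?v\<close> to \<open>C0 * f\<close>, but
    \<open>?v\<close> lacks compact support and cannot be inserted into the hypothesis on
    \<open>w\<close> directly.\<close>
  let ?v = "conv k f"
  have v: "smooth ?v" by (rule smooth_conv[OF k f])
  have sf: "square_integrable f" using f by (rule test_function_square_integrable)
  have sv: "square_integrable ?v" by (rule conv_l2_bound[OF k sf])
  have spv: "square_integrable (pd i ?v)" for i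
    unfolding partial_deriv_conv[OF k f]
    by (intro conv_l2_bound k test_function_square_integrable test_function_partial f)
  from cutoff_partials obtain B where B0: "B > 0 \<and> (\<forall>s x. cmod (cutoff s x) \<le> B) \<and>
     (\<forall>s i x. cmod (pd i (cutoff s) x) \<le> \<bar>s\<bar> * B) \<and>
     (\<forall>s x. cmod (lap (cutoff s) x) \<le> s\<^sup>2 * B)"
    by auto
  then have B: "B > 0" "\<And>s x. cmod (cutoff s x) \<le> B"
    "\<And>s i x. cmod (pd i (cutoff s) x) \<le> \<bar>s\<bar> * B"
    "\<And>s x. cmod (lap (cutoff s) x) \<le> s\<^sup>2 * B"
    by auto
  define s where "s n = inverse (real (Suc n))" for n
  have s: "s n > 0" "s n \<le> 1" for n by (auto simp: s_def field_simps)
  have s0: "s \<longlonglongrightarrow> 0" unfolding s_def by (rule scale_tendsto_0)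
  note tc = test_function_cutoff[OF s(1)]
  \<comment> \<open>All terms of the product rule with a derivative on the cutoff. Each carries at
    least one factor \<open>s n\<close>, so \<open>E n\<close> tends to 0 and, since
    \<open>s n \<le> 1\<close>, is majorised by \<open>B * G\<close>.\<close>
  define E where "E n x = 2 * (\<Sum>i\<in>UNIV. pd i (cutoff (s n)) x * pd i ?v x) + lap (cutoff (s n)) x * ?v x" for n x
  define G where "G x = 2 * (\<Sum>i\<in>UNIV. cmod (pd i ?v x)) + cmod (?v x)" for x
  define h where "h n x = cutoff (s n) x * (of_real C0 * f x)
     - E n x" for n x
  have t: "test_function (\<lambda>x. cutoff (s n) x * ?v x)" for n
    by (rule test_function_mult_right[OF tc v])
  have h_eq: "h n = (\<lambda>x. k\<^sup>2 * (cutoff (s n) x * ?v x) - lap (\<lambda>x. cutoff (s n) x * ?v x) x)" for n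
  proof (rule ext)
    fix x
    show "h n x = k\<^sup>2 * (cutoff (s n) x * ?v x) - lap (\<lambda>x. cutoff (s n) x * ?v x) x"
      unfolding lap_mult[OF test_function_smooth[OF tc] v] h_def E_def conv_pde[OF k f, symmetric]
      by (simp add: algebra_simps)
  qed
  have hm: "h n \<in> borel_measurable borel" for n
    unfolding h_eq
    by (intro smooth_measurable smooth_diff smooth_cmult smooth_lap test_function_smooth t)
  define g where "g x = B * (C0 * cmod (f x)) + B * G x" for x
  have g_sq: "integrable lborel (\<lambda>x. (g x)\<^sup>2)"
  proof -
    have "square_integrable (\<lambda>x. of_real B * (of_real C0 * of_real (cmod (f x)))
      + of_real B * (2 * (of_real (cmod (pd 1 ?v x)) + of_real (cmod (pd 2 ?v x))
          + of_real (cmod (pd 3 ?v x))) + of_real (cmod (?v x))))"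
      by (intro square_integrable_add square_integrable_mult square_integrable_norm sf sv spv)
    then have "square_integrable (\<lambda>x. complex_of_real (g x))"
      by (simp add: g_def G_def sum_3)
    then show ?thesis by (simp add: square_integrable_def)
  qed
  have err: "cmod (E n x) \<le> s n * (B * G x)" for n x
    unfolding E_def
  proof (rule norm_triangle_le)
    have "cmod (\<Sum>i\<in>UNIV. pd i (cutoff (s n)) x * pd i ?v x)
        \<le> (\<Sum>i\<in>UNIV. s n * B * cmod (pd i ?v x))"
    proof (rule sum_norm_le)
      fix i
      show "cmod (pd i (cutoff (s n)) x * pd i ?v x) \<le> s n * B * cmod (pd i ?v x)"
        using mult_right_mono[OF B(3)[of i "s n" x], of "cmod (pd i ?v x)"] s(1)[of n]
        by (simp add: norm_mult)
    qed
    also have "\<dots> = s n * B * (\<Sum>i\<in>UNIV. cmod (pd i ?v x))" by (simp only: sum_distrib_left)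
    finally have 1: "cmod (\<Sum>i\<in>UNIV. pd i (cutoff (s n)) x * pd i ?v x)
        \<le> s n * B * (\<Sum>i\<in>UNIV. cmod (pd i ?v x))" .
    have "(s n)\<^sup>2 * B \<le> s n * B"
      using s[of n] B(1) by (simp add: power2_eq_square mult_left_le)
    then have "cmod (lap (cutoff (s n)) x) \<le> s n * B" using B(4)[of "s n" x] by linarith
    then have 2: "cmod (lap (cutoff (s n)) x * ?v x) \<le> s n * B * cmod (?v x)"
      unfolding norm_mult by (intro mult_right_mono) auto
    show "cmod (2 * (\<Sum>i\<in>UNIV. pd i (cutoff (s n)) x * pd i ?v x)) + cmod (lap (cutoff (s n)) x * ?v x)
      \<le> s n * (B * G x)"
      using 1 2 by (simp add: G_def norm_mult distrib_left mult.assoc)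
  qed
  have "(\<lambda>n. abs_l2 (h n)) \<longlonglongrightarrow> abs_l2 (\<lambda>x. cutoff_value * (of_real C0 * f x))"
  proof (rule l2_dominated_convergence(3)[OF hm _ g_sq])
    show "(\<lambda>x. cutoff_value * (of_real C0 * f x)) \<in> borel_measurable borel"
      by (intro smooth_measurable smooth_cmult test_function_smooth f)
    show "cmod (h n x) \<le> g x" for n x
    proof -
      have "cmod (cutoff (s n) x * (of_real C0 * f x)) \<le> B * (C0 * cmod (f x))"
        using B(1,2) C0_pos by (simp add: norm_mult mult_right_mono)
      moreover have "s n * (B * G x) \<le> 1 * (B * G x)"
        using s(2)[of n] B(1) by (intro mult_right_mono) (auto simp: G_def sum_nonneg)
      ultimately show ?thesis
        unfolding h_def g_def using err[of n x] by (intro order_trans[OF norm_triangle_ineq4]) linarith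
    qed
    show "AE x in lborel. (\<lambda>n. h n x) \<longlonglongrightarrow> cutoff_value * (of_real C0 * f x)"
    proof (rule AE_I2)
      fix x
      have "(\<lambda>n. E n x) \<longlonglongrightarrow> 0"
      proof (rule Lim_null_comparison)
        show "\<forall>\<^sub>F n in sequentially. cmod (E n x) \<le> s n * (B * G x)"
          using err by simp
        have "(\<lambda>n. s n * (B * G x)) \<longlonglongrightarrow> 0 * (B * G x)"
          by (intro tendsto_mult_right s0)
        then show "(\<lambda>n. s n * (B * G x)) \<longlonglongrightarrow> 0"
          by simp
      qed
      moreover have "(\<lambda>n. cutoff (s n) x * (of_real C0 * f x)) \<longlonglongrightarrow> cutoff_value * (of_real C0 * f x)"
        unfolding s_def by (intro tendsto_mult_right cutoff_tendsto)
      ultimately have "(\<lambda>n. h n x) \<longlonglongrightarrow> cutoff_value * (of_real C0 * f x) - 0"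
        unfolding h_def by (intro tendsto_diff)
      then show "(\<lambda>n. h n x) \<longlonglongrightarrow> cutoff_value * (of_real C0 * f x)" by simp
    qed
  qed
  then have "(\<lambda>n. pair w (abs_l2 (h n))) \<longlonglongrightarrow> pair w (abs_l2 (\<lambda>x. cutoff_value * (of_real C0 * f x)))"
    by (intro tendsto_pair tendsto_const)
  moreover have "pair w (abs_l2 (h n)) = 0" for n
    unfolding h_eq by (rule w[OF t])
  ultimately have "pair w (abs_l2 (\<lambda>x. cutoff_value * (of_real C0 * f x))) = 0"
    by (simp add: LIMSEQ_const_iff)
  moreover have "abs_l2 (\<lambda>x. cutoff_value * (of_real C0 * f x)) = cutoff_value *\<^sub>C of_real C0 *\<^sub>C abs_l2 f"
    using sf by (simp add: abs_l2_scaleC square_integrable_mult)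
  ultimately show "pair w (abs_l2 f) = 0"
    using cutoff_value_neq_0 C0_pos by (simp add: pair_scaleC)
qed

section \<open>The graph of the free Laplacian in terms of its resolvent\<close>

lemma pair_sum_right: "pair w (\<Sum>a\<in>A. u a) = (\<Sum>a\<in>A. pair w (u a))"
  by (rule linear_sum[OF bounded_linear.linear[OF bounded_bilinear.bounded_linear_right[OF bounded_bilinear_pair]]])

lemma pair_sum_left: "pair (\<Sum>a\<in>A. u a) w = (\<Sum>a\<in>A. pair (u a) w)"
  by (simp only: pair_commute[of _ w] pair_sum_right)

lemma h0_pair:
  assumes "(w, h) \<in> h0" and f: "test_function f"
  shows "pair w (abs_l2 (\<lambda>x. k\<^sup>2 * f x - lap f x)) = pair (h + k\<^sup>2 *\<^sub>C w) (abs_l2 f)"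
proof -
  obtain v where h: "h = - (\<Sum>i\<in>UNIV. v i)" and v: "\<And>i. weak_deriv [i, i] w (v i)"
    using assms(1) by (auto simp: h0_def)
  have sq: "square_integrable f" "square_integrable (pd i (pd i f))" "square_integrable (lap f)" for i
    by (intro test_function_square_integrable test_function_partial test_function_lap f)+
  have "pair w (abs_l2 (lap f)) = (\<Sum>i\<in>UNIV. pair w (abs_l2 (pd i (pd i f))))"
    unfolding lap_def[abs_def] by (simp add: abs_l2_sum sq pair_sum_right)
  also have "\<dots> = (\<Sum>i\<in>UNIV. pair (v i) (abs_l2 f))"
    using v f by (intro sum.cong) (auto simp: weak_deriv_iff_pair)
  also have "\<dots> = pair (- h) (abs_l2 f)" by (simp add: h pair_sum_left)
  also have "\<dots> = - pair h (abs_l2 f)" using pair_scaleC(1)[of "- 1" h] by (simp add: scaleC_minus scaleC_simps)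
  finally have "pair w (abs_l2 (lap f)) = - pair h (abs_l2 f)" .
  moreover have "abs_l2 (\<lambda>x. k\<^sup>2 * f x - lap f x) = k\<^sup>2 *\<^sub>C abs_l2 f - abs_l2 (lap f)"
    using sq by (simp add: abs_l2_scaleC abs_l2_diff square_integrable_mult)
  ultimately show ?thesis by (simp add: pair_simps pair_scaleC)
qed

text \<open>Division by \<open>C0\<close> makes up for the kernel being a fundamental solution only
  up to this factor.\<close>

lift_definition free_resolvent :: "complex \<Rightarrow> l2 \<Rightarrow>\<^sub>L l2" is
  "\<lambda>k u. if Re k > 0 then convop k (of_real (1 / C0) *\<^sub>C u) else 0"
proof -
  fix k
  have "bounded_linear (\<lambda>u. of_real (1 / C0) *\<^sub>C u)"
    by (rule bounded_linear_intro[where K = "\<bar>1 / C0\<bar>"])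
      (auto simp: scaleC_simps scaleR_eq_scaleC norm_scaleC mult.commute norm_divide)
  then show "bounded_linear (\<lambda>u. if Re k > 0 then convop k (of_real (1 / C0) *\<^sub>C u) else 0)"
    by (cases "Re k > 0") (auto intro: bounded_linear_compose[OF bounded_linear_convop])
qed

lemma free_resolvent_eq: "Re k > 0 \<Longrightarrow> free_resolvent k u = convop k (of_real (1 / C0) *\<^sub>C u)"
  by transfer simp

lemma free_resolvent_scaleC: "Re k > 0 \<Longrightarrow> free_resolvent k (c *\<^sub>C u) = c *\<^sub>C free_resolvent k u"
  by (simp add: free_resolvent_eq scaleC_simps convop_scaleC[symmetric] mult.commute)

lemma free_resolvent_in_h0:
  assumes k: "Re k > 0"
  shows "(free_resolvent k u, u - k\<^sup>2 *\<^sub>C free_resolvent k u) \<in> h0"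
proof -
  have "of_real C0 *\<^sub>C of_real (1 / C0) *\<^sub>C u = u"
    using C0_pos by (simp add: scaleC_simps)
  then show ?thesis using convop_in_h0[OF k, of "of_real (1 / C0) *\<^sub>C u"] by (simp add: free_resolvent_eq k)
qed

text \<open>Uniqueness in the distributional sense: nothing is presupposed about the regularity of
  \<open>w\<close>, so it also yields membership in \<open>H2\<close> for differences of singular
  kernels.\<close>

lemma free_resolvent_unique:
  assumes k: "Re k > 0"
    and "\<And>f. test_function f \<Longrightarrow> pair w (abs_l2 (\<lambda>x. k\<^sup>2 * f x - lap f x)) = pair u (abs_l2 f)"
  shows "w = free_resolvent k u"
proof -
  have "w - free_resolvent k u = 0"
    using assms h0_pair[OF free_resolvent_in_h0[OF k, of u], of _ k]
    by (intro helmholtz_unique[OF k]) (simp add: pair_simps)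
  then show ?thesis by simp
qed

text \<open>Trades regularity and weak derivatives for one equation with a bounded operator; the
  boundary value problems below become linear algebra.\<close>

lemma h0_iff_free_resolvent:
  assumes k: "Re k > 0"
  shows "(w, h) \<in> h0 \<longleftrightarrow> w = free_resolvent k (h + k\<^sup>2 *\<^sub>C w)"
proof
  assume "(w, h) \<in> h0"
  then show "w = free_resolvent k (h + k\<^sup>2 *\<^sub>C w)"
    by (intro free_resolvent_unique k h0_pair)
next
  assume w: "w = free_resolvent k (h + k\<^sup>2 *\<^sub>C w)"
  show "(w, h) \<in> h0"
    using free_resolvent_in_h0[OF k, of "h + k\<^sup>2 *\<^sub>C w"] by (simp add: w[symmetric])
qed

lemma kern_at_pair:
  assumes k: "Re k > 0" and f: "test_function f"
  shows "pair (kern_at k x) (abs_l2 (\<lambda>x. k\<^sup>2 * f x - lap f x)) = of_real C0 * f x"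
proof -
  have sq: "square_integrable (\<lambda>x. k\<^sup>2 * f x)" "square_integrable (lap f)"
    by (intro test_function_square_integrable test_function_cmult test_function_lap f)+
  have "pair (kern_at k x) (abs_l2 (\<lambda>x. k\<^sup>2 * f x - lap f x)) = conv k (\<lambda>x. k\<^sup>2 * f x - lap f x) x"
    by (rule conv_eq_pair[symmetric]) (intro k square_integrable_diff sq)+
  also have "\<dots> = k\<^sup>2 * conv k f x - lap (conv k f) x"
    by (simp add: conv_diff k sq conv_cmult lap_conv f)
  also have "\<dots> = of_real C0 * f x" by (rule conv_pde[OF k f])
  finally show ?thesis .
qed

text \<open>The first resolvent identity applied to a delta function: both kernels have the source
  \<open>C0\<close> times delta at \<open>x\<close>, which cancels and leaves
  \<open>(l^2 - k^2)\<close> times the second kernel as right hand side.\<close>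

lemma kern_at_diff:
  assumes k: "Re k > 0" and l: "Re l > 0"
  shows "kern_at k x - kern_at l x = free_resolvent k ((l\<^sup>2 - k\<^sup>2) *\<^sub>C kern_at l x)"
proof (rule free_resolvent_unique[OF k])
  fix f assume f: "test_function f"
  have sq: "square_integrable f" "square_integrable (lap f)"
    by (intro test_function_square_integrable test_function_lap f)+
  have e: "abs_l2 (\<lambda>x. k\<^sup>2 * f x - lap f x) = k\<^sup>2 *\<^sub>C abs_l2 f - abs_l2 (lap f)" for k :: complex
    using sq by (simp add: abs_l2_scaleC abs_l2_diff square_integrable_mult)
  show "pair (kern_at k x - kern_at l x) (abs_l2 (\<lambda>x. k\<^sup>2 * f x - lap f x))
      = pair ((l\<^sup>2 - k\<^sup>2) *\<^sub>C kern_at l x) (abs_l2 f)"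
    using kern_at_pair[OF k f, of x] kern_at_pair[OF l f, of x]
    unfolding e by (simp add: pair_simps pair_scaleC algebra_simps)
qed

text \<open>The derivative of the numerator at 0. It gives the value of a kernel difference at its
  own center and, later, the limit of the coupling \<open>d\<close>.\<close>

lemma exp_quotient_tendsto:
  "((\<lambda>t. (exp (- (k * t)) - exp (- (l * t))) / t) \<longlongrightarrow> l - k) (at (0 :: complex))"
proof -
  have "((\<lambda>t. exp (- (k * t)) - exp (- (l * t))) has_field_derivative l - k) (at 0)"
    by (auto intro!: derivative_eq_intros)
  then show ?thesis by (simp add: has_field_derivative_iff)
qed

text \<open>The poles cancel, so the difference has a removable singularity at the center. The two
  cases are the diagonal and the off-diagonal contribution of a change from \<open>l\<close> to
  \<open>k\<close> in the boundary conditions.\<close>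

lemma has_value_at_kern_diff:
  assumes k: "Re k > 0" and l: "Re l > 0"
  shows "has_value_at (kern_at k x - kern_at l x) y
    (if y = x then l - k
     else (exp (- (k * of_real (norm (y - x)))) - exp (- (l * of_real (norm (y - x))))) / of_real (norm (y - x)))"
proof -
  define q where "q y = (if y = x then l - k
     else (exp (- (k * of_real (norm (y - x)))) - exp (- (l * of_real (norm (y - x))))) / of_real (norm (y - x)))" for y
  have sq: "square_integrable (\<lambda>y. kern k (y - x))" "square_integrable (\<lambda>y. kern l (y - x))"
    by (intro square_integrable_translate kern_square_integrable k l)+
  have ae: "AE y in lborel. kern k (y - x) - kern l (y - x) = q y"
    using AE_lborel_singleton[of x]
    by eventually_elim (simp add: q_def kern_def diff_divide_distrib)
  have c: "continuous_on UNIV q"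
    unfolding continuous_on_eq_continuous_at[OF open_UNIV]
  proof
    fix y
    show "isCont q y"
    proof (cases "y = x")
      case False
      have "isCont (\<lambda>y. (exp (- (k * of_real (norm (y - x)))) - exp (- (l * of_real (norm (y - x))))) / of_real (norm (y - x))) y"
        using False by (intro continuous_intros) auto
      moreover have "\<forall>\<^sub>F y in nhds y. (exp (- (k * of_real (norm (y - x)))) - exp (- (l * of_real (norm (y - x))))) / of_real (norm (y - x)) = q y"
        by (rule eventually_mono[OF t1_space_nhds[OF False]]) (simp add: q_def)
      ultimately show ?thesis by (rule isCont_cong[THEN iffD1, rotated])
    next
      case True
      have "((\<lambda>y. (exp (- (k * of_real (norm (y - x)))) - exp (- (l * of_real (norm (y - x))))) / of_real (norm (y - x)))
          \<longlongrightarrow> l - k) (at x)"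
      proof (rule filterlim_compose[OF exp_quotient_tendsto])
        have "((\<lambda>y. complex_of_real (norm (y - x))) \<longlongrightarrow> of_real (norm (x - x))) (at x)"
          by (intro tendsto_intros)
        then show "filterlim (\<lambda>y. complex_of_real (norm (y - x))) (at 0) (at x)"
          by (simp add: filterlim_at eventually_at_filter)
      qed
      then have "(q \<longlongrightarrow> l - k) (at x)"
        by (rule tendsto_cong[THEN iffD1, rotated]) (auto simp: q_def eventually_at_filter)
      then show ?thesis by (simp add: True isCont_def q_def)
    qed
  qed
  have "kern_at k x - kern_at l x = abs_l2 (\<lambda>y. kern k (y - x) - kern l (y - x))"
    using sq k l by (simp add: kern_at_eq abs_l2_diff)
  then show ?thesis
    using has_value_at.abs_eq[OF l2_rel_refl[OF square_integrable_diff[OF sq]]] ae c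
    unfolding q_def[symmetric] by auto
qed


section \<open>Krein's formula and the limit\<close>

lemma bounded_bilinear_scaleC: "bounded_bilinear scaleC"
  by standard (auto simp: scaleC_simps scaleR_eq_scaleC norm_scaleC scaleR_conv_of_real mult.commute
      intro!: exI[of _ 1])

lift_definition tens :: "l2 \<Rightarrow> l2 \<Rightarrow> l2 \<Rightarrow>\<^sub>L l2" is "\<lambda>h g u. pair g u *\<^sub>C h"
proof -
  fix h g :: l2
  show "bounded_linear (\<lambda>u. pair g u *\<^sub>C h)"
  proof (rule bounded_linear_intro[where K = "norm g * norm h"])
    fix u
    show "norm (pair g u *\<^sub>C h) \<le> norm u * (norm g * norm h)"
      using mult_right_mono[OF cmod_pair_le[of g u], of "norm h"] by (simp add: norm_scaleC mult_ac)
  qed (auto simp: pair_simps scaleC_simps scaleR_eq_scaleC pair_scaleC)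
qed

text \<open>Source of the convergence in operator norm: rank one operators depend continuously, in
  norm, on the two vectors that define them.\<close>

lemma bounded_bilinear_tens: "bounded_bilinear tens"
proof
  show "\<exists>K. \<forall>(a :: l2) b. norm (tens a b) \<le> norm a * norm b * K"
  proof (intro exI[of _ 1] allI norm_blinfun_bound)
    fix a b u :: l2
    have "cmod (pair b u) * norm a \<le> (norm b * norm u) * norm a"
      by (intro mult_right_mono cmod_pair_le) simp
    then show "norm (tens a b u) \<le> norm a * norm b * 1 * norm u"
      by (simp add: tens.rep_eq norm_scaleC mult_ac)
  qed simp
qed (auto intro!: blinfun_eqI simp: tens.rep_eq blinfun.add_left blinfun.scaleR_left scaleC_simps pair_simps
    scaleR_eq_scaleC pair_scaleC mult.commute)

lemma tens_scaleC: "tens (c *\<^sub>C h) g u = (c * pair g u) *\<^sub>C h"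
  by (simp add: tens.rep_eq scaleC_simps mult.commute)

definition trace_at :: "complex \<Rightarrow> R3 \<Rightarrow> l2 \<Rightarrow> complex" where
  "trace_at k x u = pair (kern_at k x) u / of_real C0"

lemma has_value_at_free_resolvent:
  "Re k > 0 \<Longrightarrow> has_value_at (free_resolvent k u) x (trace_at k x u)"
  using has_value_at_convop[of k "of_real (1 / C0) *\<^sub>C u" x]
  by (simp add: free_resolvent_eq trace_at_def pair_scaleC)

lemma has_value_at_iff: "has_value_at w x c \<Longrightarrow> has_value_at w x d \<longleftrightarrow> d = c"
  using has_value_at_unique by blast

text \<open>The two premises say that \<open>B\<close> is a left and a right inverse of the graph
  shifted by \<open>z\<close>.\<close>

lemma is_resolventI:
  assumes "\<And>\<psi> \<phi>. (\<psi>, \<phi>) \<in> A \<Longrightarrow> \<psi> = blinfun_apply B (\<phi> - z *\<^sub>C \<psi>)"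
    and "\<And>f. (blinfun_apply B f, f + z *\<^sub>C blinfun_apply B f) \<in> A"
  shows "is_resolvent A z B"
  unfolding is_resolvent_def
proof (intro set_eqI iffI)
  fix p assume "p \<in> {(\<psi>, \<phi> - z *\<^sub>C \<psi>) |\<psi> \<phi>. (\<psi>, \<phi>) \<in> A}\<inverse>"
  then show "p \<in> {(f, blinfun_apply B f) |f. True}" using assms(1) by auto
next
  fix p assume "p \<in> {(f, blinfun_apply B f) |f. True}"
  then obtain f where p: "p = (f, blinfun_apply B f)" by auto
  have "f = (f + z *\<^sub>C blinfun_apply B f) - z *\<^sub>C blinfun_apply B f" by simp
  with assms(2)[of f] show "p \<in> {(\<psi>, \<phi> - z *\<^sub>C \<psi>) |\<psi> \<phi>. (\<psi>, \<phi>) \<in> A}\<inverse>"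
    unfolding p by blast
qed

lemma is_resolvent_unique:
  assumes "is_resolvent A z B" "is_resolvent A z B'" shows "B = B'"
proof (rule blinfun_eqI)
  fix f
  have "{(f, blinfun_apply B f) | f. True} = {(f, blinfun_apply B' f) | f. True}"
    using assms by (simp add: is_resolvent_def)
  then show "blinfun_apply B f = blinfun_apply B' f" by blast
qed

lemma resolvent_eqI: "is_resolvent A z B \<Longrightarrow> resolvent A z = B"
  unfolding resolvent_def by (rule the_equality) (auto intro: is_resolvent_unique)

lemma in_resolvent_setI: "is_resolvent A z B \<Longrightarrow> z \<in> resolvent_set A"
  by (auto simp: resolvent_set_def)

lemma free_resolvent_kern_at:
  assumes "Re k > 0" "lam > 0"
  shows "free_resolvent k ((of_real lam - k\<^sup>2) *\<^sub>C kern_at (of_real (sqrt lam)) x)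
      = kern_at k x - kern_at (of_real (sqrt lam)) x"
  using kern_at_diff[of k "of_real (sqrt lam)" x] assms by (simp flip: of_real_power)

text \<open>
  The parameter \<open>lam\<close> drops out: the regular part with respect to \<open>lam\<close> is
  \<open>R\<^sub>0 f + \<Sum>\<^sub>i q\<^sub>i (kern_at k x\<^sub>i - kern_at \<surd>lam x\<^sub>i)\<close>, whose value at \<open>x\<^sub>1\<close> moves \<open>\<surd>lam\<close> to \<open>k\<close> in the
  boundary condition.
\<close>

lemma one_center_iff:
  assumes k: "Re k > 0" and lam: "lam > 0"
  shows "(\<psi>, \<phi>) \<in> one_center lam \<alpha> x1 \<longleftrightarrow>
    (\<exists>q. \<psi> = free_resolvent k (\<phi> + k\<^sup>2 *\<^sub>C \<psi>) + q *\<^sub>C kern_at k x1 \<and>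
       (of_real \<alpha> + k) * q = trace_at k x1 (\<phi> + k\<^sup>2 *\<^sub>C \<psi>))"
proof -
  define l where "l = complex_of_real (sqrt lam)"
  have l: "Re l > 0" using lam by (simp add: l_def)
  define f where "f = \<phi> + k\<^sup>2 *\<^sub>C \<psi>"
  have *: "(\<psi> - q *\<^sub>C kern_at l x1, \<phi> + of_real lam *\<^sub>C q *\<^sub>C kern_at l x1) \<in> h0 \<and>
      has_value_at (\<psi> - q *\<^sub>C kern_at l x1) x1 (of_real (\<alpha> + sqrt lam) * q) \<longleftrightarrow>
      \<psi> = free_resolvent k f + q *\<^sub>C kern_at k x1 \<and> (of_real \<alpha> + k) * q = trace_at k x1 f" for q
  proof -
    let ?w = "\<psi> - q *\<^sub>C kern_at l x1"
    let ?w' = "free_resolvent k f + q *\<^sub>C (kern_at k x1 - kern_at l x1)"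
    have "free_resolvent k (\<phi> + of_real lam *\<^sub>C q *\<^sub>C kern_at l x1 + k\<^sup>2 *\<^sub>C ?w)
        = free_resolvent k (f + q *\<^sub>C (of_real lam - k\<^sup>2) *\<^sub>C kern_at l x1)"
      by (simp add: f_def scaleC_simps algebra_simps)
    also have "\<dots> = ?w'"
      using free_resolvent_kern_at[OF k lam, of x1]
      by (simp add: l_def[symmetric] blinfun.add_right free_resolvent_scaleC k)
    finally have h: "(?w, \<phi> + of_real lam *\<^sub>C q *\<^sub>C kern_at l x1) \<in> h0 \<longleftrightarrow> ?w = ?w'"
      by (simp add: h0_iff_free_resolvent[OF k])
    have "has_value_at ?w' x1 (trace_at k x1 f + q * (l - k))"
      using has_value_at_kern_diff[OF k l, of x1 x1]
      by (intro has_value_at_add has_value_at_scaleC has_value_at_free_resolvent k) simp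
    then have v: "has_value_at ?w' x1 (of_real (\<alpha> + sqrt lam) * q) \<longleftrightarrow> (of_real \<alpha> + k) * q = trace_at k x1 f"
      by (subst has_value_at_iff) (auto simp: l_def algebra_simps)
    have "?w = ?w' \<longleftrightarrow> \<psi> = free_resolvent k f + q *\<^sub>C kern_at k x1"
      by (auto simp: scaleC_simps algebra_simps)
    with h v show ?thesis by metis
  qed
  have "(\<psi>, \<phi>) \<in> one_center lam \<alpha> x1 \<longleftrightarrow> (\<exists>q.
      (\<psi> - q *\<^sub>C kern_at l x1, \<phi> + of_real lam *\<^sub>C q *\<^sub>C kern_at l x1) \<in> h0 \<and>
      has_value_at (\<psi> - q *\<^sub>C kern_at l x1) x1 (of_real (\<alpha> + sqrt lam) * q))"
    unfolding one_center_def green_at_eq[OF lam] l_def[symmetric]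
  proof (safe, goal_cases)
    case (1 q w h0w)
    then show ?case by (intro exI[of _ q]) simp
  next
    case (2 q)
    then show ?case by (intro exI[of _ q] exI[of _ "\<psi> - q *\<^sub>C kern_at l x1"]
          exI[of _ "\<phi> + of_real lam *\<^sub>C q *\<^sub>C kern_at l x1"]) simp
  qed
  then show ?thesis unfolding * f_def .
qed

text \<open>As for one center, with one more cancellation: \<open>delta_fun\<close> splits into
  \<open>d + e\<close>, and \<open>e\<close> is the value of the kernel difference at the opposite
  center, so it occurs on both sides of the boundary conditions. What remains is \<open>d\<close>,
  the coupling with \<open>k\<close> in place of the root of \<open>lam\<close>.\<close>

lemma two_center_iff:
  fixes \<theta> :: "real \<Rightarrow> real"
  assumes k: "Re k > 0" and lam: "lam > 0" and x: "x1 \<noteq> x2"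
  defines "R \<equiv> norm (x1 - x2)"
  defines "d \<equiv> (of_real (\<theta> R) - exp (- (k * of_real R))) / of_real R"
  shows "(\<psi>, \<phi>) \<in> two_center lam \<alpha>1 \<alpha>2 \<theta> x1 x2 \<longleftrightarrow>
    (\<exists>q1 q2. \<psi> = free_resolvent k (\<phi> + k\<^sup>2 *\<^sub>C \<psi>) + q1 *\<^sub>C kern_at k x1 + q2 *\<^sub>C kern_at k x2 \<and>
       (of_real \<alpha>1 + k) * q1 + d * q2 = trace_at k x1 (\<phi> + k\<^sup>2 *\<^sub>C \<psi>) \<and>
       (of_real \<alpha>2 + k) * q2 + d * q1 = trace_at k x2 (\<phi> + k\<^sup>2 *\<^sub>C \<psi>))"
proof -
  define l where "l = complex_of_real (sqrt lam)"
  have l: "Re l > 0" using lam by (simp add: l_def)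
  have R: "R > 0" using x by (simp add: R_def)
  define f where "f = \<phi> + k\<^sup>2 *\<^sub>C \<psi>"
  define e where "e = (exp (- (k * of_real R)) - exp (- (l * of_real R))) / of_real R"
  have de: "complex_of_real (delta_fun lam \<theta> R) = d + e"
    by (simp add: delta_fun_def d_def e_def l_def add_divide_distrib[symmetric] exp_of_real[symmetric])
  have *: "(\<psi> - q1 *\<^sub>C kern_at l x1 - q2 *\<^sub>C kern_at l x2,
        \<phi> + of_real lam *\<^sub>C (q1 *\<^sub>C kern_at l x1 + q2 *\<^sub>C kern_at l x2)) \<in> h0 \<and>
      has_value_at (\<psi> - q1 *\<^sub>C kern_at l x1 - q2 *\<^sub>C kern_at l x2) x1
        (of_real (\<alpha>1 + sqrt lam) * q1 + of_real (delta_fun lam \<theta> R) * q2) \<and>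
      has_value_at (\<psi> - q1 *\<^sub>C kern_at l x1 - q2 *\<^sub>C kern_at l x2) x2
        (of_real (\<alpha>2 + sqrt lam) * q2 + of_real (delta_fun lam \<theta> R) * q1) \<longleftrightarrow>
      \<psi> = free_resolvent k f + q1 *\<^sub>C kern_at k x1 + q2 *\<^sub>C kern_at k x2 \<and>
      (of_real \<alpha>1 + k) * q1 + d * q2 = trace_at k x1 f \<and>
      (of_real \<alpha>2 + k) * q2 + d * q1 = trace_at k x2 f" for q1 q2
  proof -
    let ?w = "\<psi> - q1 *\<^sub>C kern_at l x1 - q2 *\<^sub>C kern_at l x2"
    let ?h = "\<phi> + of_real lam *\<^sub>C (q1 *\<^sub>C kern_at l x1 + q2 *\<^sub>C kern_at l x2)"
    let ?w' = "free_resolvent k f + q1 *\<^sub>C (kern_at k x1 - kern_at l x1) + q2 *\<^sub>C (kern_at k x2 - kern_at l x2)"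
    have "free_resolvent k (?h + k\<^sup>2 *\<^sub>C ?w)
        = free_resolvent k (f + q1 *\<^sub>C (of_real lam - k\<^sup>2) *\<^sub>C kern_at l x1 + q2 *\<^sub>C (of_real lam - k\<^sup>2) *\<^sub>C kern_at l x2)"
      by (simp add: f_def scaleC_simps algebra_simps)
    also have "\<dots> = ?w'"
      using free_resolvent_kern_at[OF k lam]
      by (simp add: l_def[symmetric] blinfun.add_right free_resolvent_scaleC k)
    finally have h: "(?w, ?h) \<in> h0 \<longleftrightarrow> ?w = ?w'"
      by (simp add: h0_iff_free_resolvent[OF k])
    have "has_value_at ?w' x1 (trace_at k x1 f + q1 * (l - k) + q2 * e)"
      using has_value_at_kern_diff[OF k l, of x1 x1] has_value_at_kern_diff[OF k l, of x2 x1] x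
      by (intro has_value_at_add has_value_at_scaleC has_value_at_free_resolvent k) (simp_all add: e_def R_def)
    then have v1: "has_value_at ?w' x1 (of_real (\<alpha>1 + sqrt lam) * q1 + of_real (delta_fun lam \<theta> R) * q2)
        \<longleftrightarrow> (of_real \<alpha>1 + k) * q1 + d * q2 = trace_at k x1 f"
      by (subst has_value_at_iff) (auto simp: l_def de algebra_simps)
    have "has_value_at ?w' x2 (trace_at k x2 f + q1 * e + q2 * (l - k))"
      using has_value_at_kern_diff[OF k l, of x1 x2] has_value_at_kern_diff[OF k l, of x2 x2] x
      by (intro has_value_at_add has_value_at_scaleC has_value_at_free_resolvent k)
        (simp_all add: e_def R_def norm_minus_commute)
    then have v2: "has_value_at ?w' x2 (of_real (\<alpha>2 + sqrt lam) * q2 + of_real (delta_fun lam \<theta> R) * q1)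
        \<longleftrightarrow> (of_real \<alpha>2 + k) * q2 + d * q1 = trace_at k x2 f"
      by (subst has_value_at_iff) (auto simp: l_def de algebra_simps)
    have "?w = ?w' \<longleftrightarrow> \<psi> = free_resolvent k f + q1 *\<^sub>C kern_at k x1 + q2 *\<^sub>C kern_at k x2"
      by (auto simp: scaleC_simps algebra_simps)
    with h v1 v2 show ?thesis by metis
  qed
  have "(\<psi>, \<phi>) \<in> two_center lam \<alpha>1 \<alpha>2 \<theta> x1 x2 \<longleftrightarrow> (\<exists>q1 q2.
      (\<psi> - q1 *\<^sub>C kern_at l x1 - q2 *\<^sub>C kern_at l x2,
        \<phi> + of_real lam *\<^sub>C (q1 *\<^sub>C kern_at l x1 + q2 *\<^sub>C kern_at l x2)) \<in> h0 \<and>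
      has_value_at (\<psi> - q1 *\<^sub>C kern_at l x1 - q2 *\<^sub>C kern_at l x2) x1
        (of_real (\<alpha>1 + sqrt lam) * q1 + of_real (delta_fun lam \<theta> R) * q2) \<and>
      has_value_at (\<psi> - q1 *\<^sub>C kern_at l x1 - q2 *\<^sub>C kern_at l x2) x2
        (of_real (\<alpha>2 + sqrt lam) * q2 + of_real (delta_fun lam \<theta> R) * q1))"
    unfolding two_center_def green_at_eq[OF lam] l_def[symmetric] R_def[symmetric]
  proof (safe, goal_cases)
    case (1 q1 q2 w h0w)
    then show ?case by (intro exI[of _ q1] exI[of _ q2]) simp
  next
    case (2 q1 q2)
    show ?case
      by (rule exI[of _ q1], rule exI[of _ q2],
          rule exI[of _ "\<psi> - q1 *\<^sub>C kern_at l x1 - q2 *\<^sub>C kern_at l x2"],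
          rule exI[of _ "\<phi> + of_real lam *\<^sub>C (q1 *\<^sub>C kern_at l x1 + q2 *\<^sub>C kern_at l x2)"])
        (use 2 in simp)
  qed
  then show ?thesis unfolding * f_def .
qed

section \<open>Explicit resolvents of the point interactions\<close>

definition one_center_resolvent :: "complex \<Rightarrow> complex \<Rightarrow> R3 \<Rightarrow> l2 \<Rightarrow>\<^sub>L l2" where
  "one_center_resolvent k m x = free_resolvent k + tens ((m / of_real C0) *\<^sub>C kern_at k x) (kern_at k x)"

lemma is_resolvent_one_center:
  assumes k: "Re k > 0" and lam: "lam > 0" and nz: "of_real \<alpha> + k \<noteq> 0"
  shows "is_resolvent (one_center lam \<alpha> x1) (- (k\<^sup>2)) (one_center_resolvent k (1 / (of_real \<alpha> + k)) x1)"
proof (rule is_resolventI)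
  let ?B = "one_center_resolvent k (1 / (of_real \<alpha> + k)) x1"
  have B: "blinfun_apply ?B f = free_resolvent k f + (trace_at k x1 f / (of_real \<alpha> + k)) *\<^sub>C kern_at k x1" for f
    by (simp add: one_center_resolvent_def blinfun.add_left tens_scaleC trace_at_def mult.commute)
  fix \<psi> \<phi> assume "(\<psi>, \<phi>) \<in> one_center lam \<alpha> x1"
  then obtain q where q: "\<psi> = free_resolvent k (\<phi> + k\<^sup>2 *\<^sub>C \<psi>) + q *\<^sub>C kern_at k x1"
    "(of_real \<alpha> + k) * q = trace_at k x1 (\<phi> + k\<^sup>2 *\<^sub>C \<psi>)"
    unfolding one_center_iff[OF k lam] by blast
  have "q = trace_at k x1 (\<phi> + k\<^sup>2 *\<^sub>C \<psi>) / (of_real \<alpha> + k)"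
    using q(2) nz by (simp add: field_simps)
  then show "\<psi> = blinfun_apply ?B (\<phi> - (- (k\<^sup>2)) *\<^sub>C \<psi>)"
    using q(1) by (simp add: B scaleC_minus)
next
  let ?B = "one_center_resolvent k (1 / (of_real \<alpha> + k)) x1"
  have B: "blinfun_apply ?B f = free_resolvent k f + (trace_at k x1 f / (of_real \<alpha> + k)) *\<^sub>C kern_at k x1" for f
    by (simp add: one_center_resolvent_def blinfun.add_left tens_scaleC trace_at_def mult.commute)
  fix f
  have e: "f + (- (k\<^sup>2)) *\<^sub>C blinfun_apply ?B f + k\<^sup>2 *\<^sub>C blinfun_apply ?B f = f"
    by (simp add: scaleC_minus)
  show "(blinfun_apply ?B f, f + (- (k\<^sup>2)) *\<^sub>C blinfun_apply ?B f) \<in> one_center lam \<alpha> x1"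
    unfolding one_center_iff[OF k lam] e using nz
    by (intro exI[of _ "trace_at k x1 f / (of_real \<alpha> + k)"]) (simp add: B)
qed

text \<open>The coefficients are the entries of the inverse of the symmetric matrix with diagonal
  \<open>a1\<close>, \<open>a2\<close> and off-diagonal \<open>d\<close>. The form as a sum of four
  rank one operators allows the limit to be taken term by term.\<close>

definition two_center_resolvent :: "complex \<Rightarrow> complex \<Rightarrow> complex \<Rightarrow> complex \<Rightarrow> R3 \<Rightarrow> R3 \<Rightarrow> l2 \<Rightarrow>\<^sub>L l2" where
  "two_center_resolvent k a1 a2 d x1 x2 =
     (let c = 1 / ((a1 * a2 - d\<^sup>2) * of_real C0) in
      free_resolvent k
      + tens ((c * a2) *\<^sub>C kern_at k x1) (kern_at k x1) + tens ((- c * d) *\<^sub>C kern_at k x1) (kern_at k x2)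
      + tens ((- c * d) *\<^sub>C kern_at k x2) (kern_at k x1) + tens ((c * a1) *\<^sub>C kern_at k x2) (kern_at k x2))"

lemma two_center_resolvent_apply:
  "blinfun_apply (two_center_resolvent k a1 a2 d x1 x2) f = free_resolvent k f
     + ((a2 * trace_at k x1 f - d * trace_at k x2 f) / (a1 * a2 - d\<^sup>2)) *\<^sub>C kern_at k x1
     + ((a1 * trace_at k x2 f - d * trace_at k x1 f) / (a1 * a2 - d\<^sup>2)) *\<^sub>C kern_at k x2"
proof -
  define D where "D = a1 * a2 - d\<^sup>2"
  let ?p1 = "pair (kern_at k x1) f" and ?p2 = "pair (kern_at k x2) f"
  have "(a2 * trace_at k x1 f - d * trace_at k x2 f) / D
      = 1 / (D * of_real C0) * a2 * ?p1 + - (1 / (D * of_real C0)) * d * ?p2"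
    "(a1 * trace_at k x2 f - d * trace_at k x1 f) / D
      = - (1 / (D * of_real C0)) * d * ?p1 + 1 / (D * of_real C0) * a1 * ?p2"
    by (simp_all add: trace_at_def diff_divide_distrib mult.commute)
  then show ?thesis
    unfolding two_center_resolvent_def Let_def D_def[symmetric]
    by (simp add: blinfun.add_left tens_scaleC) (simp add: scaleC_simps scaleC_minus)
qed

lemma is_resolvent_two_center:
  fixes \<theta> :: "real \<Rightarrow> real"
  assumes k: "Re k > 0" and lam: "lam > 0" and x: "x1 \<noteq> x2"
  defines "R \<equiv> norm (x1 - x2)"
  defines "d \<equiv> (of_real (\<theta> R) - exp (- (k * of_real R))) / of_real R"
  assumes nz: "(of_real \<alpha>1 + k) * (of_real \<alpha>2 + k) - d\<^sup>2 \<noteq> 0"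
  shows "is_resolvent (two_center lam \<alpha>1 \<alpha>2 \<theta> x1 x2) (- (k\<^sup>2))
     (two_center_resolvent k (of_real \<alpha>1 + k) (of_real \<alpha>2 + k) d x1 x2)"
proof -
  define a1 a2 where "a1 = complex_of_real \<alpha>1 + k" and "a2 = complex_of_real \<alpha>2 + k"
  define D where "D = a1 * a2 - d\<^sup>2"
  have D: "D \<noteq> 0" using nz by (simp add: D_def a1_def a2_def)
  let ?B = "two_center_resolvent k a1 a2 d x1 x2"
  note B = two_center_resolvent_apply[of k a1 a2 d x1 x2, folded D_def]
  note iff = two_center_iff[OF k lam x, of _ _ \<alpha>1 \<alpha>2 \<theta>, folded R_def, folded d_def a1_def a2_def]
  have "is_resolvent (two_center lam \<alpha>1 \<alpha>2 \<theta> x1 x2) (- (k\<^sup>2)) ?B"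
  proof (rule is_resolventI)
    fix \<psi> \<phi> assume "(\<psi>, \<phi>) \<in> two_center lam \<alpha>1 \<alpha>2 \<theta> x1 x2"
    then obtain q1 q2 where q: "\<psi> = free_resolvent k (\<phi> + k\<^sup>2 *\<^sub>C \<psi>) + q1 *\<^sub>C kern_at k x1 + q2 *\<^sub>C kern_at k x2"
      "a1 * q1 + d * q2 = trace_at k x1 (\<phi> + k\<^sup>2 *\<^sub>C \<psi>)"
      "a2 * q2 + d * q1 = trace_at k x2 (\<phi> + k\<^sup>2 *\<^sub>C \<psi>)"
      unfolding iff by blast
    \<comment> \<open>Cramer's rule.\<close>
    have "q1 = (a2 * (a1 * q1 + d * q2) - d * (a2 * q2 + d * q1)) / D"
      "q2 = (a1 * (a2 * q2 + d * q1) - d * (a1 * q1 + d * q2)) / D"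
      using D by (simp_all add: eq_divide_eq) (simp_all add: D_def algebra_simps power2_eq_square)
    then show "\<psi> = blinfun_apply ?B (\<phi> - (- (k\<^sup>2)) *\<^sub>C \<psi>)"
      using q(1) unfolding q(2,3) by (simp add: B scaleC_minus)
  next
    fix f
    have e: "f + (- (k\<^sup>2)) *\<^sub>C blinfun_apply ?B f + k\<^sup>2 *\<^sub>C blinfun_apply ?B f = f"
      by (simp add: scaleC_minus)
    let ?q1 = "(a2 * trace_at k x1 f - d * trace_at k x2 f) / D"
    let ?q2 = "(a1 * trace_at k x2 f - d * trace_at k x1 f) / D"
    have "a1 * ?q1 + d * ?q2 = trace_at k x1 f" "a2 * ?q2 + d * ?q1 = trace_at k x2 f"
      using D by (simp_all add: add_divide_distrib[symmetric] divide_eq_eq)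
        (simp_all add: D_def algebra_simps power2_eq_square)
    then show "(blinfun_apply ?B f, f + (- (k\<^sup>2)) *\<^sub>C blinfun_apply ?B f) \<in> two_center lam \<alpha>1 \<alpha>2 \<theta> x1 x2"
      unfolding iff e by (intro exI[of _ ?q1] exI[of _ ?q2]) (simp add: B)
  qed
  then show ?thesis by (simp add: a1_def a2_def)
qed

text \<open>The numerator is split at 1. The part \<open>\<theta> - 1\<close> contributes the
  derivative of \<open>\<theta>\<close> at zero, which is 0, and the part with the exponential
  contributes \<open>k\<close>.\<close>

lemma off_diagonal_tendsto:
  fixes k :: complex
  assumes "\<theta> 0 = 1" and "(\<theta> has_real_derivative 0) (at 0 within {0..})"
  shows "((\<lambda>x2. (of_real (\<theta> (norm (x1 - x2))) - exp (- (k * of_real (norm (x1 - x2))))) / of_real (norm (x1 - x2)))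
     \<longlongrightarrow> k) (at (x1 :: R3))"
proof -
  have n: "((\<lambda>x2. norm (x1 - x2)) \<longlongrightarrow> 0) (at x1)"
    using tendsto_norm[OF tendsto_diff[OF tendsto_const[of x1] tendsto_ident_at[of x1 UNIV]]] by simp
  have f1: "filterlim (\<lambda>x2. norm (x1 - x2)) (at 0 within {0..}) (at x1)"
    using n by (simp add: filterlim_at eventually_at_filter)
  have f2: "filterlim (\<lambda>x2. complex_of_real (norm (x1 - x2))) (at 0) (at x1)"
    using tendsto_of_real[OF n, where 'a = complex] by (simp add: filterlim_at eventually_at_filter)
  have "((\<lambda>r. (\<theta> r - 1) / r) \<longlongrightarrow> 0) (at 0 within {0..})"
    using assms by (simp add: has_field_derivative_iff)
  from tendsto_of_real[OF filterlim_compose[OF this f1], where 'a = complex]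
  have t1: "((\<lambda>x2. (of_real (\<theta> (norm (x1 - x2))) - 1) / of_real (norm (x1 - x2))) \<longlongrightarrow> (0 :: complex)) (at x1)"
    by simp
  have "((\<lambda>t. (1 - exp (- (k * t))) / t) \<longlongrightarrow> k) (at 0)"
    using exp_quotient_tendsto[of 0 k] by simp
  from filterlim_compose[OF this f2]
  have t2: "((\<lambda>x2. (1 - exp (- (k * of_real (norm (x1 - x2))))) / of_real (norm (x1 - x2))) \<longlongrightarrow> k) (at x1)" .
  show ?thesis using tendsto_add[OF t1 t2] by (simp add: add_divide_distrib[symmetric])
qed

lemma tendsto_kern_at: "((\<lambda>x2. kern_at k x2) \<longlongrightarrow> kern_at k x1) (at x1)"
  using continuous_on_shift[of "abs_l2 (kern k)"]
  by (simp add: kern_at_def continuous_on_eq_continuous_at isCont_def)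

text \<open>In the limit all four rank one operators become multiples of the same one, so the
  entries of the inverse matrix simply add up.\<close>

lemma two_center_resolvent_tendsto:
  assumes d: "(d \<longlongrightarrow> k) (at x1)" and nz: "(a1 - k) + (a2 - k) \<noteq> 0" "a1 * a2 - k\<^sup>2 \<noteq> 0"
  shows "((\<lambda>x2. two_center_resolvent k a1 a2 (d x2) x1 x2)
     \<longlongrightarrow> one_center_resolvent k ((a1 + a2 - 2 * k) / (a1 * a2 - k\<^sup>2)) x1) (at x1)"
proof -
  define c where "c = 1 / ((a1 * a2 - k\<^sup>2) * of_real C0)"
  let ?c = "\<lambda>x2. 1 / ((a1 * a2 - (d x2)\<^sup>2) * of_real C0)"
  let ?K = "kern_at k x1"
  have nz': "(a1 * a2 - k\<^sup>2) * of_real C0 \<noteq> 0" using nz C0_pos by simp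
  have c: "(?c \<longlongrightarrow> c) (at x1)"
    unfolding c_def by (intro tendsto_intros d nz')
  note K = tendsto_kern_at[of k x1]
  note ts = bounded_bilinear.tendsto[OF bounded_bilinear_tens] bounded_bilinear.tendsto[OF bounded_bilinear_scaleC]
  have "((\<lambda>x2. two_center_resolvent k a1 a2 (d x2) x1 x2) \<longlongrightarrow>
      free_resolvent k + tens ((c * a2) *\<^sub>C ?K) ?K + tens ((- c * k) *\<^sub>C ?K) ?K
      + tens ((- c * k) *\<^sub>C ?K) ?K + tens ((c * a1) *\<^sub>C ?K) ?K) (at x1)"
    unfolding two_center_resolvent_def Let_def
    by (intro tendsto_add ts tendsto_mult tendsto_minus c d K tendsto_const)
  also have "free_resolvent k + tens ((c * a2) *\<^sub>C ?K) ?K + tens ((- c * k) *\<^sub>C ?K) ?K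
      + tens ((- c * k) *\<^sub>C ?K) ?K + tens ((c * a1) *\<^sub>C ?K) ?K
      = one_center_resolvent k ((a1 + a2 - 2 * k) / (a1 * a2 - k\<^sup>2)) x1"
  proof (rule blinfun_eqI)
    fix u
    have "(a1 + a2 - 2 * k) / (a1 * a2 - k\<^sup>2) / of_real C0 = c * a2 + - c * k + - c * k + c * a1"
      by (simp add: c_def diff_divide_distrib add_divide_distrib algebra_simps)
    then show "blinfun_apply (free_resolvent k + tens ((c * a2) *\<^sub>C ?K) ?K + tens ((- c * k) *\<^sub>C ?K) ?K
      + tens ((- c * k) *\<^sub>C ?K) ?K + tens ((c * a1) *\<^sub>C ?K) ?K) u
      = blinfun_apply (one_center_resolvent k ((a1 + a2 - 2 * k) / (a1 * a2 - k\<^sup>2)) x1) u"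
      unfolding one_center_resolvent_def
      by (simp only: blinfun.add_left tens_scaleC scaleC_simps(3)[symmetric] distrib_right add.assoc)
  qed
  finally show ?thesis .
qed

text \<open>The imaginary part of \<open>z\<close> is -2 times the product of \<open>Re k\<close>
  and \<open>Im k\<close>, so neither factor vanishes. The first gives decay of the kernel, the
  second keeps real numbers plus \<open>k\<close> away from 0.\<close>

lemma csqrt_uminus:
  assumes "Im z \<noteq> 0"
  shows "Re (csqrt (- z)) > 0" "- ((csqrt (- z))\<^sup>2) = z" "Im (csqrt (- z)) \<noteq> 0"
proof -
  show 2: "- ((csqrt (- z))\<^sup>2) = z" by simp
  define k where "k = csqrt (- z)"
  have "Im (- (k\<^sup>2)) = Im z" using 2 by (simp add: k_def)
  then have "Re k * Im k \<noteq> 0" using assms by (auto simp: power2_eq_square)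
  moreover have "Re k \<ge> 0" unfolding k_def by (rule Re_csqrt)
  ultimately show "Re (csqrt (- z)) > 0" "Im (csqrt (- z)) \<noteq> 0" by (auto simp: k_def)
qed

theorem proposition4p2:
  fixes \<alpha>1 \<alpha>2 lam b :: real and \<theta> :: "real \<Rightarrow> real" and x1 :: "real ^ 3"
  assumes "\<alpha>1 + \<alpha>2 \<noteq> 0"
    and "lam > 0"
    and "\<theta> \<in> borel_measurable (lebesgue_on {0<..})"
    and "\<exists>M. AE r in lebesgue_on {0<..}. \<bar>\<theta> r\<bar> \<le> M"
    and "b > 0"
    and "AE r in lebesgue_on {0<..}. 1 - r / b \<le> \<theta> r \<and> \<theta> r \<le> 1 + r / b"
    and "\<theta> 0 = 1"
    and "(\<theta> has_real_derivative 0) (at 0 within {0..})"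
  shows "norm_resolvent_tendsto (\<lambda>x2. two_center lam \<alpha>1 \<alpha>2 \<theta> x1 x2)
           (one_center lam (\<alpha>1 * \<alpha>2 / (\<alpha>1 + \<alpha>2)) x1) (at x1)"
  unfolding norm_resolvent_tendsto_def
proof (intro allI impI)
  fix z :: complex assume z: "Im z \<noteq> 0"
  define k where "k = csqrt (- z)"
  have k: "Re k > 0" and zk: "- (k\<^sup>2) = z" and Imk: "Im k \<noteq> 0"
    using csqrt_uminus[OF z] by (simp_all add: k_def)
  define \<alpha> where "\<alpha> = \<alpha>1 * \<alpha>2 / (\<alpha>1 + \<alpha>2)"
  define a1 a2 where "a1 = complex_of_real \<alpha>1 + k" and "a2 = complex_of_real \<alpha>2 + k"
  have nz0: "of_real \<alpha> + k \<noteq> 0" using Imk by (auto simp: complex_eq_iff)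
  have sum: "a1 + a2 - 2 * k = of_real (\<alpha>1 + \<alpha>2)" by (simp add: a1_def a2_def)
  \<comment> \<open>The squares of \<open>k\<close> cancel, leaving \<alpha>1 \<alpha>2 + (\<alpha>1
    + \<alpha>2) k, from which the sum is factored out; this is where the harmonic form of \<alpha>
    originates.\<close>
  have det: "a1 * a2 - k\<^sup>2 = of_real (\<alpha>1 + \<alpha>2) * (of_real \<alpha> + k)"
  proof -
    have "of_real (\<alpha>1 + \<alpha>2) * of_real \<alpha> = complex_of_real (\<alpha>1 * \<alpha>2)"
      unfolding of_real_mult[symmetric] using assms(1) by (simp add: \<alpha>_def)
    then show ?thesis by (simp add: a1_def a2_def algebra_simps power2_eq_square)
  qed
  have det_nz: "a1 * a2 - k\<^sup>2 \<noteq> 0" using nz0 assms(1) by (simp add: det flip: of_real_add)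
  define d where "d x2 = (of_real (\<theta> (norm (x1 - x2))) - exp (- (k * of_real (norm (x1 - x2))))) / of_real (norm (x1 - x2))"
    for x2
  have d: "(d \<longlongrightarrow> k) (at x1)"
    unfolding d_def[abs_def] by (rule off_diagonal_tendsto) fact+
  have one: "is_resolvent (one_center lam \<alpha> x1) z (one_center_resolvent k (1 / (of_real \<alpha> + k)) x1)"
    using is_resolvent_one_center[OF k \<open>lam > 0\<close> nz0] by (simp only: zk)
  \<comment> \<open>Invertibility of the matrix is inherited from the limit and hence secured for
    \<open>x2\<close> near \<open>x1\<close>, which is all that is asked of the two-center resolvent
    sets.\<close>
  have "((\<lambda>x2. a1 * a2 - (d x2)\<^sup>2) \<longlongrightarrow> a1 * a2 - k\<^sup>2) (at x1)" by (intro tendsto_intros d)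
  then have "\<forall>\<^sub>F x2 in at x1. a1 * a2 - (d x2)\<^sup>2 \<noteq> 0"
    using det_nz by (rule tendsto_imp_eventually_ne)
  moreover have "\<forall>\<^sub>F x2 in at x1. x2 \<noteq> x1" by (simp add: eventually_at_filter)
  ultimately have two: "\<forall>\<^sub>F x2 in at x1. is_resolvent (two_center lam \<alpha>1 \<alpha>2 \<theta> x1 x2) z
      (two_center_resolvent k a1 a2 (d x2) x1 x2)"
  proof eventually_elim
    case (elim x2)
    then show ?case
      using is_resolvent_two_center[OF k \<open>lam > 0\<close>, of x1 x2 \<alpha>1 \<alpha>2 \<theta>]
      by (simp add: zk a1_def a2_def d_def)
  qed
  have "((\<lambda>x2. two_center_resolvent k a1 a2 (d x2) x1 x2)
      \<longlongrightarrow> one_center_resolvent k ((a1 + a2 - 2 * k) / (a1 * a2 - k\<^sup>2)) x1) (at x1)"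
    by (rule two_center_resolvent_tendsto[OF d _ det_nz])
      (use assms(1) in \<open>simp add: a1_def a2_def flip: of_real_add\<close>)
  also have "(a1 + a2 - 2 * k) / (a1 * a2 - k\<^sup>2) = 1 / (of_real \<alpha> + k)"
    using assms(1) unfolding sum det by (simp del: of_real_add)
  finally have lim: "((\<lambda>x2. two_center_resolvent k a1 a2 (d x2) x1 x2)
      \<longlongrightarrow> one_center_resolvent k (1 / (of_real \<alpha> + k)) x1) (at x1)" .
  have "((\<lambda>x2. resolvent (two_center lam \<alpha>1 \<alpha>2 \<theta> x1 x2) z) \<longlongrightarrow> resolvent (one_center lam \<alpha> x1) z) (at x1)"
    unfolding resolvent_eqI[OF one]
    by (rule tendsto_cong[THEN iffD1, OF _ lim]) (use two in \<open>eventually_elim; simp add: resolvent_eqI\<close>)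
  moreover have "\<forall>\<^sub>F x2 in at x1. z \<in> resolvent_set (two_center lam \<alpha>1 \<alpha>2 \<theta> x1 x2)"
    using two by eventually_elim (rule in_resolvent_setI)
  ultimately show "z \<in> resolvent_set (one_center lam (\<alpha>1 * \<alpha>2 / (\<alpha>1 + \<alpha>2)) x1) \<and>
      (\<forall>\<^sub>F x2 in at x1. z \<in> resolvent_set (two_center lam \<alpha>1 \<alpha>2 \<theta> x1 x2)) \<and>
      ((\<lambda>x2. resolvent (two_center lam \<alpha>1 \<alpha>2 \<theta> x1 x2) z) \<longlongrightarrow>
        resolvent (one_center lam (\<alpha>1 * \<alpha>2 / (\<alpha>1 + \<alpha>2)) x1) z) (at x1)"
    using in_resolvent_setI[OF one] by (simp add: \<alpha>_def)
qed

end
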